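(* Let $\tau\in\mathbb{H}$ and assume that $G(z;\tau)$ admits a pair of nontrivial critical points $\pm a$ with $a=r+s\tau$, $(r,s)\in[0,1/2]\times[0,1]\setminus\frac12\mathbb{Z}^2$. Let $\mathbf{u}_0(z;\tau,a)$ be the unique even solution in the unique even family $\{\mathbf{u}_\beta(z;\tau,a)\}$ of solutions of $\Delta u+e^{u}=8\pi\delta_0+4\pi(\delta_a+\delta_{-a})$ on $E_\tau$ that blows up at $\pm a$ as $\beta\to\pm\infty$, respectively, and let $v_0(z;\tau)$ be the unique even solution in the unique even family $\{v_\beta(z;\tau)\}$ of solutions of $\Delta v+e^{v}=8\pi\delta_0$ on $E_\tau$ (which blows up at $\pm a$ as $\beta\to\pm\infty$, respectively). Let $f(z;\tau,a)$ and $h(z;\tau)$ be their respective type II developing maps, so that $$\mathbf{u}_0=\log\frac{8|f'|^2}{(1+|f|^2)^2},\qquad v_0=\log\frac{8|h'|^2}{(1+|h|^2)^2},$$ taken compatibly with the parametrizations of the two families. Then, for a suitable choice of the unimodular multiplicative constants up to which $f$ and $h$ are determined, $$f(z;\tau,a)=h(z;\tau)^2 .$$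
   Context: $\mathbb{H}$ is the upper half plane, $\Lambda_\tau=\mathbb{Z}\oplus\tau\mathbb{Z}$, $E_\tau=\mathbb{C}/\Lambda_\tau$, $\delta_q$ is the Dirac measure at $q$. Green function: $G(z;\tau)$ is defined by $-\Delta G=\delta_0-\frac1{|E_\tau|}$ on $E_\tau$, $\int_{E_\tau}G=0$. The half periods $\frac12,\frac\tau2,\frac{1+\tau}2$ are always critical points ("trivial"); any other critical point is nontrivial. Nontrivial critical points, if any, form exactly one pair $\pm a$. Developing maps and families (for either equation): a solution $u$ can be written $u=\log\frac{8|f'|^2}{(1+|f|^2)^2}$ with $f$ meromorphic on $\mathbb{C}$ (a developing map); $f$ is of type II if $f(z+1)=e^{-4\pi i s'}f(z)$, $f(z+\tau)=e^{4\pi i r'}f(z)$ for some $(r',s')\in\mathbb{R}^2$ (the monodromy data). Given a type II developing map $f$, $u_\beta=\log\frac{8e^{2\beta}|f'|^2}{(1+e^{2\beta}|f|^2)^2}$, $\beta\in\mathbb{R}$, is a family of solutions; it is even if it contains an even solution (necessarily unique), which is here taken to be the member with $\beta=0$. Blow-up: as $\beta\to+\infty$ blow-up occurs at the zeros of $f$, as $\beta\to-\infty$ at its poles (at a conical point $q$ of angle $4\pi$, blow-up of $u_\beta$ means blow-up at $q$ of $u_\beta+4\pi G(z-q;\tau)$). So compatibility with the parametrizations means that $a$ is a zero and $-a$ a pole of both $f$ and $h$; with this convention $f$ and $h$ are determined by $\mathbf{u}_0$ and $v_0$ up to a multiplicative constant of modulus $1$. Under the hypothesis on $G$, both even families exist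 and are unique; the family $\{v_\beta(z;\tau)\}$ (due to Lin–Wang) has monodromy data $(r,s)$. *)

theory Defs
  imports "HOL-Complex_Analysis.Complex_Analysis"
begin

section \<open>The torus\<close>

text \<open>
  Functions on \<open>E = \<complex> / \<Lambda>\<close> are represented by doubly periodic functions on \<open>\<complex>\<close>,
  and integrals over \<open>E\<close> by integrals over a fundamental parallelogram.
\<close>

definition lattice :: "complex \<Rightarrow> complex set" where
  "lattice \<tau> = {of_int m + of_int n * \<tau> | m n. True}"

definition cell :: "complex \<Rightarrow> complex set" where
  "cell \<tau> = {of_real x + of_real y * \<tau> | x y. 0 \<le> x \<and> x < 1 \<and> 0 \<le> y \<and> y < 1}"

definition doubly_periodic :: "complex \<Rightarrow> (complex \<Rightarrow> 'a) \<Rightarrow> bool" where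
  "doubly_periodic \<tau> g \<longleftrightarrow> (\<forall>z. g (z + 1) = g z \<and> g (z + \<tau>) = g z)"

section \<open>Laplacian and test functions\<close>

definition dir_deriv :: "complex \<Rightarrow> (complex \<Rightarrow> real) \<Rightarrow> complex \<Rightarrow> real" where
  "dir_deriv v \<phi> z = deriv (\<lambda>t::real. \<phi> (z + of_real t * v)) 0"

definition laplacian :: "(complex \<Rightarrow> real) \<Rightarrow> complex \<Rightarrow> real" where
  "laplacian \<phi> z = dir_deriv 1 (dir_deriv 1 \<phi>) z + dir_deriv \<i> (dir_deriv \<i> \<phi>) z"

definition C1 :: "(complex \<Rightarrow> real) \<Rightarrow> bool" where
  "C1 \<phi> \<longleftrightarrow> (\<forall>z. \<phi> differentiable (at z)) \<and>
     continuous_on UNIV (dir_deriv 1 \<phi>) \<and> continuous_on UNIV (dir_deriv \<i> \<phi>)"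

definition C2 :: "(complex \<Rightarrow> real) \<Rightarrow> bool" where
  "C2 \<phi> \<longleftrightarrow> C1 \<phi> \<and> C1 (dir_deriv 1 \<phi>) \<and> C1 (dir_deriv \<i> \<phi>)"

text \<open>
  Equations with Dirac measures are understood in the sense of distributions on \<open>E\<close>. Test
  functions are of class \<open>C\<^sup>2\<close>; for locally integrable unknowns this is equivalent to testing
  with smooth functions.
\<close>

definition test_function :: "complex \<Rightarrow> (complex \<Rightarrow> real) \<Rightarrow> bool" where
  "test_function \<tau> \<phi> \<longleftrightarrow> doubly_periodic \<tau> \<phi> \<and> C2 \<phi>"

section \<open>Green function\<close>

text \<open>
  \<open>-\<Delta>G = \<delta>\<^sub>0 - 1/|E|\<close> with mean value zero. Continuity away from the lattice selects the
  classical representative of the distributional solution; the values on the lattice, where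
  \<open>G = \<infinity>\<close>, are irrelevant.
\<close>

definition green_function :: "complex \<Rightarrow> (complex \<Rightarrow> real) \<Rightarrow> bool" where
  "green_function \<tau> G \<longleftrightarrow>
     doubly_periodic \<tau> G \<and>
     continuous_on (- lattice \<tau>) G \<and>
     set_integrable lborel (cell \<tau>) G \<and>
     (\<forall>\<phi>. test_function \<tau> \<phi> \<longrightarrow>
        - (LINT z:cell \<tau>|lborel. G z * laplacian \<phi> z) =
        \<phi> 0 - (LINT z:cell \<tau>|lborel. \<phi> z) / measure lborel (cell \<tau>)) \<and>
     (LINT z:cell \<tau>|lborel. G z) = 0"

definition nontrivial_critical_point :: "complex \<Rightarrow> (complex \<Rightarrow> real) \<Rightarrow> complex \<Rightarrow> bool" where
  "nontrivial_critical_point \<tau> G z \<longleftrightarrow>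
     (G has_derivative (\<lambda>_. 0)) (at z) \<and> 2 * z \<notin> lattice \<tau>"

section \<open>Curvature equations with conical singularities\<close>

text \<open>
  A list \<open>ps\<close> of pairs \<open>(q, c)\<close> encodes the right-hand side \<open>\<Sum> c \<delta>\<^sub>q\<close>. As for the Green function,
  continuity off the singular set selects the classical representative, and the values at the
  singularities, where \<open>u = -\<infinity>\<close>, are irrelevant.
\<close>

definition singular_set :: "complex \<Rightarrow> (complex \<times> real) list \<Rightarrow> complex set" where
  "singular_set \<tau> ps = {z. \<exists>(q, c) \<in> set ps. z - q \<in> lattice \<tau>}"

definition solution :: "complex \<Rightarrow> (complex \<times> real) list \<Rightarrow> (complex \<Rightarrow> real) \<Rightarrow> bool" where
  "solution \<tau> ps u \<longleftrightarrow>
     doubly_periodic \<tau> u \<and>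
     continuous_on (- singular_set \<tau> ps) u \<and>
     set_integrable lborel (cell \<tau>) u \<and>
     set_integrable lborel (cell \<tau>) (\<lambda>z. exp (u z)) \<and>
     (\<forall>\<phi>. test_function \<tau> \<phi> \<longrightarrow>
        (LINT z:cell \<tau>|lborel. u z * laplacian \<phi> z + exp (u z) * \<phi> z) =
        (\<Sum>(q, c)\<leftarrow>ps. c * \<phi> q))"

section \<open>Developing maps, families, blow-up\<close>

text \<open>
  Meromorphic functions are normalised by \<open>nicely_meromorphic_on\<close>: they are continuous off
  their poles and take the value \<open>0\<close> at poles, so that identities between them can be stated
  pointwise on all of \<open>\<complex>\<close>.
\<close>

definition type_II :: "complex \<Rightarrow> (complex \<Rightarrow> complex) \<Rightarrow> bool" where
  "type_II \<tau> f \<longleftrightarrow> f nicely_meromorphic_on UNIV \<and>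
     (\<exists>r' s' :: real. \<forall>z. f (z + 1) = exp (- 4 * pi * \<i> * s') * f z \<and>
                          f (z + \<tau>) = exp (4 * pi * \<i> * r') * f z)"

text \<open>
  At a pole of \<open>f\<close> the formula for \<open>u \<beta>\<close> is read as a limit, i.e. it is determined by the
  formula off the poles and the continuity of \<open>u \<beta>\<close> contained in \<^const>\<open>solution\<close>.
\<close>

definition solution_family ::
  "complex \<Rightarrow> (complex \<times> real) list \<Rightarrow> (complex \<Rightarrow> complex) \<Rightarrow> (real \<Rightarrow> complex \<Rightarrow> real) \<Rightarrow> bool" where
  "solution_family \<tau> ps f u \<longleftrightarrow>
     type_II \<tau> f \<and>
     (\<forall>\<beta>. solution \<tau> ps (u \<beta>)) \<and>
     (\<forall>\<beta> z. z \<notin> singular_set \<tau> ps \<longrightarrow> \<not> is_pole f z \<longrightarrow>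
        u \<beta> z = ln (8 * exp (2 * \<beta>) * (cmod (deriv f z))\<^sup>2 /
                     (1 + exp (2 * \<beta>) * (cmod (f z))\<^sup>2)\<^sup>2))"

text \<open>The parameter is normalised so that the even member is the one with \<open>\<beta> = 0\<close>.\<close>

definition even_family ::
  "complex \<Rightarrow> (complex \<times> real) list \<Rightarrow> (complex \<Rightarrow> complex) \<Rightarrow> (real \<Rightarrow> complex \<Rightarrow> real) \<Rightarrow> bool" where
  "even_family \<tau> ps f u \<longleftrightarrow>
     solution_family \<tau> ps f u \<and>
     (\<forall>z. z \<notin> singular_set \<tau> ps \<longrightarrow> - z \<notin> singular_set \<tau> ps \<longrightarrow> u 0 (- z) = u 0 z)"

definition mass_at :: "complex \<Rightarrow> (complex \<times> real) list \<Rightarrow> complex \<Rightarrow> real" where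
  "mass_at \<tau> ps q = (\<Sum>(p, c)\<leftarrow>ps. if q - p \<in> lattice \<tau> then c else 0)"

text \<open>
  Blow-up at \<open>q\<close> along a filter on the parameter. At a regular point the term with \<open>G\<close> vanishes;
  at a conical point of angle \<open>4\<pi>\<close>, i.e. mass \<open>4\<pi>\<close>, the function considered is
  \<open>u \<beta> z + 4\<pi> G (z - q)\<close>, which extends continuously to \<open>q\<close>.
\<close>

definition blows_up_at ::
  "complex \<Rightarrow> (complex \<Rightarrow> real) \<Rightarrow> (complex \<times> real) list \<Rightarrow> (real \<Rightarrow> complex \<Rightarrow> real) \<Rightarrow>
   complex \<Rightarrow> real filter \<Rightarrow> bool" where
  "blows_up_at \<tau> G ps u q F \<longleftrightarrow>
     (\<exists>\<zeta> :: real \<Rightarrow> complex.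
        (\<zeta> \<longlongrightarrow> q) F \<and>
        (\<forall>\<^sub>F \<beta> in F. \<zeta> \<beta> \<notin> singular_set \<tau> ps) \<and>
        filterlim (\<lambda>\<beta>. u \<beta> (\<zeta> \<beta>) + mass_at \<tau> ps q * G (\<zeta> \<beta> - q)) at_top F)"

end

theory Submission
  imports Defs
begin

text \<open>
  The multipliers of \<open>f\<close> and \<open>h\<close> cancel in the quotients \<open>k\<^sub>f = f / f'\<close> and \<open>k\<^sub>h = h / h'\<close>, which
  are therefore elliptic functions. Once it is known that \<open>k\<^sub>h = 2 k\<^sub>f\<close>, the derivative of \<open>f / h\<^sup>2\<close>
  vanishes and \<open>f = C h\<^sup>2\<close>. So the point is to locate the zeros and poles of \<open>k\<^sub>f\<close> and \<open>k\<^sub>h\<close>, and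
  these are governed by the local behaviour of the developing maps.

  A point of mass \<open>m\<close> is one where \<open>u = m/(2\<pi>) log |z - p| + O(1)\<close>, and a developing map that is
  \<open>k\<close>-to-one near \<open>p\<close> gives \<open>u = 2 (k - 1) log |z - p| + O(1)\<close>; hence \<open>m = 4\<pi> (k - 1)\<close>
  (\<open>density_order_mass\<close>). Thus both maps are three-to-one at the lattice points, where \<open>k\<^sub>f\<close> and
  \<open>k\<^sub>h\<close> have at most a double pole. Elsewhere both maps are unramified, except that \<open>f\<close> is
  two-to-one at \<open>\<plusminus>a\<close>; but there \<open>f\<close> has a zero and a pole, and \<open>k\<^sub>f\<close> vanishes at both. So
  there are no further poles of \<open>k\<^sub>f\<close> and \<open>k\<^sub>h\<close>. Indeed, for \<open>\<beta> \<longrightarrow> \<infinity>\<close> the family stays bounded above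
  (after the correction by the Green function) near every point which is not a zero of the
  developing map, and for \<open>\<beta> \<longrightarrow> -\<infinity>\<close> near every point which is not a pole. So blow-up forces a
  zero at \<open>a\<close> and a pole at \<open>-a\<close> (\<open>blow_up_top_imp_zero\<close>, \<open>blow_up_bot_imp_pole\<close>). At \<open>a\<close> the
  quotients then vanish with slope \<open>1/2\<close> for \<open>f\<close> (double zero) and \<open>1\<close> for \<open>h\<close> (simple zero).

  There is no elliptic function whose only singularity modulo the lattice is one simple pole.
  Hence the combination of \<open>k\<^sub>f\<close> and \<open>k\<^sub>h\<close> in which the double poles cancel is constant, and it is
  zero because both vanish at \<open>a\<close> (\<open>elliptic_double_pole_proportional\<close>). So \<open>k\<^sub>f\<close> and \<open>k\<^sub>h\<close> are
  proportional, and the slopes at \<open>a\<close> give \<open>k\<^sub>h = 2 k\<^sub>f\<close>. The zeros of the two quotients need not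
  be counted, and no argument principle enters.

  It remains to see that \<open>|C| = 1\<close>. The function \<open>k\<^sub>h (- z)\<close> has the same leading coefficient at \<open>0\<close>
  as \<open>k\<^sub>h\<close> and also vanishes at \<open>a\<close>, because \<open>h\<close> has a pole at \<open>-a\<close>. So \<open>k\<^sub>h\<close> is even, which says
  that \<open>h(z) h(-z)\<close> is a constant \<open>K\<close>; consequently \<open>f(z) f(-z) = (C K)\<^sup>2\<close>. Evenness of the member
  \<open>\<beta> = 0\<close> makes both constants unimodular (\<open>even_family_constant_norm\<close>), and \<open>|C| = 1\<close> follows.

  The asymptotics of \<open>u\<close> and of the Green function are read off from the distributional equation
  without regularity theory (\<open>distributional_log_asymptotics\<close>). The equation is tested with
  differences of two regularised logarithms centred at a nearby point \<open>w\<close>: their Laplacians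
  are differences of two averaging kernels, and when the inner radius tends to \<open>0\<close> the inner
  average becomes \<open>2\<pi> u(w)\<close>, while the Dirac mass contributes \<open>m log |w - p|\<close> and everything else
  is bounded.
\<close>

section \<open>The lattice and its fundamental cell\<close>

lemma lattice_0 [simp]: "0 \<in> lattice \<tau>"
  unfolding lattice_def by (auto intro!: exI[of _ 0])

lemma lattice_1 [simp]: "1 \<in> lattice \<tau>"
  unfolding lattice_def by (intro CollectI exI[of _ 1] exI[of _ 0]) auto

lemma lattice_tau [simp]: "\<tau> \<in> lattice \<tau>"
  unfolding lattice_def by (intro CollectI exI[of _ 0] exI[of _ 1]) auto

lemma lattice_add [intro]: "x \<in> lattice \<tau> \<Longrightarrow> y \<in> lattice \<tau> \<Longrightarrow> x + y \<in> lattice \<tau>"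
  unfolding lattice_def
proof clarify
  fix m n m' n' :: int
  show "\<exists>k l. of_int m + of_int n * \<tau> + (of_int m' + of_int n' * \<tau>) = of_int k + of_int l * \<tau> \<and> True"
    by (rule exI[of _ "m + m'"], rule exI[of _ "n + n'"]) (simp add: algebra_simps)
qed

lemma lattice_uminus [intro]: "x \<in> lattice \<tau> \<Longrightarrow> - x \<in> lattice \<tau>"
  unfolding lattice_def
proof clarify
  fix m n :: int
  show "\<exists>k l. - (of_int m + of_int n * \<tau>) = of_int k + of_int l * \<tau> \<and> True"
    by (rule exI[of _ "- m"], rule exI[of _ "- n"]) (simp add: algebra_simps)
qed

lemma lattice_uminus_iff [simp]: "- x \<in> lattice \<tau> \<longleftrightarrow> x \<in> lattice \<tau>"
  using lattice_uminus[of x \<tau>] lattice_uminus[of "- x" \<tau>] by auto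

lemma lattice_diff [intro]: "x \<in> lattice \<tau> \<Longrightarrow> y \<in> lattice \<tau> \<Longrightarrow> x - y \<in> lattice \<tau>"
  using lattice_add[of x \<tau> "- y"] by auto

lemma lattice_add_cancel: "x \<in> lattice \<tau> \<Longrightarrow> x + y \<in> lattice \<tau> \<longleftrightarrow> y \<in> lattice \<tau>"
  using lattice_add[of x \<tau> y] lattice_diff[of "x + y" \<tau> x] by auto

lemma lattice_diff_commute: "x - y \<in> lattice \<tau> \<longleftrightarrow> y - x \<in> lattice \<tau>"
  using lattice_uminus_iff[of "x - y" \<tau>] by simp

lemma lattice_translation_invariant:
  assumes per: "\<And>z. g (z + 1) = g z" "\<And>z. g (z + \<tau>) = g z" and l: "l \<in> lattice \<tau>"
  shows "g (z + l) = g z"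
proof -
  have nat1: "g (z + of_nat n) = g z" for n z
  proof (induction n)
    case (Suc n)
    have "g (z + of_nat (Suc n)) = g ((z + of_nat n) + 1)"
      by (simp add: algebra_simps)
    then show ?case using per(1)[of "z + of_nat n"] Suc by metis
  qed simp
  have nat2: "g (z + of_nat n * \<tau>) = g z" for n z
  proof (induction n)
    case (Suc n)
    have "g (z + of_nat (Suc n) * \<tau>) = g ((z + of_nat n * \<tau>) + \<tau>)"
      by (simp add: algebra_simps)
    then show ?case using per(2)[of "z + of_nat n * \<tau>"] Suc by metis
  qed simp
  have int1: "g (z + of_int m) = g z" for m z
  proof (cases m)
    case (neg n)
    then have "z = (z + of_int m) + of_nat (Suc n)" by simp
    then show ?thesis using nat1[of "z + of_int m" "Suc n"] by metis
  qed (simp add: nat1)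
  have int2: "g (z + of_int m * \<tau>) = g z" for m z
  proof (cases m)
    case (neg n)
    then have "of_int m = - (of_nat (Suc n) :: complex)" by simp
    then have "z = (z + of_int m * \<tau>) + of_nat (Suc n) * \<tau>" by (simp only:) (simp add: algebra_simps)
    then show ?thesis using nat2[of "z + of_int m * \<tau>" "Suc n"] by metis
  qed (simp add: nat2)
  from l obtain m n where "l = of_int m + of_int n * \<tau>" by (auto simp: lattice_def)
  then show ?thesis using int2[of "z + of_int m" n] int1[of z m] by (simp add: algebra_simps)
qed

lemma doubly_periodic_lattice:
  "doubly_periodic \<tau> g \<Longrightarrow> l \<in> lattice \<tau> \<Longrightarrow> g (z + l) = g z"
  by (rule lattice_translation_invariant) (auto simp: doubly_periodic_def)

lemma doubly_periodic_lattice_diff: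
  "doubly_periodic \<tau> g \<Longrightarrow> l \<in> lattice \<tau> \<Longrightarrow> g (z - l) = g z"
  using doubly_periodic_lattice[of \<tau> g l "z - l"] by simp

lemma lattice_norm_ge:
  assumes "Im \<tau> > 0" "l \<in> lattice \<tau>" "l \<noteq> 0"
  shows "min 1 (Im \<tau>) \<le> cmod l"
proof -
  obtain m n where l: "l = of_int m + of_int n * \<tau>" using assms by (auto simp: lattice_def)
  show ?thesis
  proof (cases "n = 0")
    case True
    then have "m \<noteq> 0" using l assms by auto
    then have "1 \<le> \<bar>real_of_int m\<bar>" by linarith
    then show ?thesis using l True by simp
  next
    case False
    have "Im \<tau> \<le> \<bar>real_of_int n\<bar> * Im \<tau>"
      using False assms(1) by (simp add: mult_le_cancel_right1)
    also have "\<dots> = \<bar>Im l\<bar>" using l assms(1) by (simp add: abs_mult)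
    also have "\<dots> \<le> cmod l" by (rule abs_Im_le_cmod)
    finally show ?thesis by simp
  qed
qed

lemma finite_bounded_lattice:
  assumes "Im \<tau> > 0"
  shows "finite {l \<in> lattice \<tau>. cmod l \<le> R}"
proof -
  define B where "B = \<lceil>R / Im \<tau>\<rceil>"
  define A where "A = \<lceil>R + real_of_int B * cmod \<tau>\<rceil>"
  have "{l \<in> lattice \<tau>. cmod l \<le> R} \<subseteq> (\<lambda>(m,n). of_int m + of_int n * \<tau>) ` ({-A..A} \<times> {-B..B})"
  proof
    fix l assume "l \<in> {l \<in> lattice \<tau>. cmod l \<le> R}"
    then obtain m n where l: "l = of_int m + of_int n * \<tau>" and R: "cmod l \<le> R"
      by (auto simp: lattice_def)
    have "\<bar>real_of_int n\<bar> * Im \<tau> = \<bar>Im l\<bar>" using l assms(1) by (simp add: abs_mult)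
    then have "\<bar>real_of_int n\<bar> * Im \<tau> \<le> R" using R abs_Im_le_cmod[of l] by simp
    then have n: "\<bar>real_of_int n\<bar> \<le> R / Im \<tau>" using assms by (simp add: field_simps)
    then have nB: "\<bar>n\<bar> \<le> B" unfolding B_def by linarith
    have "\<bar>real_of_int m\<bar> = cmod (l - of_int n * \<tau>)" using l by simp
    also have "\<dots> \<le> cmod l + \<bar>real_of_int n\<bar> * cmod \<tau>"
      using norm_triangle_ineq4[of l "of_int n * \<tau>"] by (simp add: norm_mult)
    also have "\<dots> \<le> R + real_of_int B * cmod \<tau>"
      using R nB by (intro add_mono mult_right_mono) auto
    finally have "\<bar>m\<bar> \<le> A" unfolding A_def by linarith
    then show "l \<in> (\<lambda>(m,n). of_int m + of_int n * \<tau>) ` ({-A..A} \<times> {-B..B})"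
      using l nB by (intro image_eqI[of _ _ "(m,n)"]) auto
  qed
  then show ?thesis by (rule finite_subset) auto
qed

lemma cell_iff:
  assumes "Im \<tau> > 0"
  shows "z \<in> cell \<tau> \<longleftrightarrow>
    0 \<le> Im z / Im \<tau> \<and> Im z / Im \<tau> < 1 \<and>
    0 \<le> Re z - Im z / Im \<tau> * Re \<tau> \<and> Re z - Im z / Im \<tau> * Re \<tau> < 1"
proof
  assume "z \<in> cell \<tau>"
  then show "0 \<le> Im z / Im \<tau> \<and> Im z / Im \<tau> < 1 \<and>
    0 \<le> Re z - Im z / Im \<tau> * Re \<tau> \<and> Re z - Im z / Im \<tau> * Re \<tau> < 1"
    using assms by (auto simp: cell_def)
next
  assume *: "0 \<le> Im z / Im \<tau> \<and> Im z / Im \<tau> < 1 \<and>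
    0 \<le> Re z - Im z / Im \<tau> * Re \<tau> \<and> Re z - Im z / Im \<tau> * Re \<tau> < 1"
  have "z = of_real (Re z - Im z / Im \<tau> * Re \<tau>) + of_real (Im z / Im \<tau>) * \<tau>"
    using assms by (simp add: complex_eq_iff)
  then show "z \<in> cell \<tau>" unfolding cell_def using * by blast
qed

lemma cell_borel [measurable]:
  assumes "Im \<tau> > 0"
  shows "cell \<tau> \<in> sets borel"
proof -
  have "cell \<tau> = {z \<in> space borel. 0 \<le> Im z / Im \<tau> \<and> Im z / Im \<tau> < 1 \<and>
    0 \<le> Re z - Im z / Im \<tau> * Re \<tau> \<and> Re z - Im z / Im \<tau> * Re \<tau> < 1}"
    using cell_iff[OF assms] by auto
  also have "\<dots> \<in> sets borel" by measurable
  finally show ?thesis .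
qed

lemma cell_bounded: "z \<in> cell \<tau> \<Longrightarrow> cmod z \<le> 1 + cmod \<tau>"
proof -
  assume "z \<in> cell \<tau>"
  then obtain x y where z: "z = of_real x + of_real y * \<tau>" "0 \<le> x" "x < 1" "0 \<le> y" "y < 1"
    by (auto simp: cell_def)
  have "cmod z \<le> x + y * cmod \<tau>"
    unfolding z(1) using norm_triangle_ineq[of "of_real x" "of_real y * \<tau>"] z by (simp add: norm_mult)
  also have "\<dots> \<le> 1 + cmod \<tau>" using z mult_right_mono[of y 1 "cmod \<tau>"] by simp
  finally show ?thesis .
qed

lemma ex_cell_translate:
  assumes "Im \<tau> > 0"
  shows "\<exists>l \<in> lattice \<tau>. z - l \<in> cell \<tau>"
proof -
  define y where "y = Im z / Im \<tau>"
  define x where "x = Re z - y * Re \<tau>"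
  have z: "z = of_real x + of_real y * \<tau>" using assms by (simp add: complex_eq_iff x_def y_def)
  have "z - (of_int \<lfloor>x\<rfloor> + of_int \<lfloor>y\<rfloor> * \<tau>) = of_real (frac x) + of_real (frac y) * \<tau>"
    unfolding z by (simp add: frac_def algebra_simps)
  also have "\<dots> \<in> cell \<tau>" unfolding cell_def
    using frac_ge_0[of x] frac_lt_1[of x] frac_ge_0[of y] frac_lt_1[of y] by blast
  finally show ?thesis by (auto simp: lattice_def)
qed

lemma cell_translate_unique:
  assumes "Im \<tau> > 0" "z \<in> cell \<tau>" "z + l \<in> cell \<tau>" "l \<in> lattice \<tau>"
  shows "l = 0"
proof -
  obtain m n where l: "l = of_int m + of_int n * \<tau>" using assms by (auto simp: lattice_def)
  have Im: "Im (z + l) / Im \<tau> = Im z / Im \<tau> + of_int n"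
    using assms(1) l by (simp add: field_simps)
  have Re: "Re (z + l) - Im (z + l) / Im \<tau> * Re \<tau> = Re z - Im z / Im \<tau> * Re \<tau> + of_int m"
    unfolding Im using assms(1) l by (simp add: algebra_simps)
  have "n = 0" using assms(2,3) unfolding cell_iff[OF assms(1)] Im by linarith
  moreover have "m = 0" using assms(2,3) unfolding cell_iff[OF assms(1)] Re by linarith
  ultimately show ?thesis using l by simp
qed

section \<open>Unfolding integrals of periodic functions\<close>

lemma integrable_translate:
  fixes f :: "'a::euclidean_space \<Rightarrow> real"
  assumes "integrable lborel f"
  shows "integrable lborel (\<lambda>z. f (z + c))" "(LINT z|lborel. f (z + c)) = (LINT z|lborel. f z)"
proof -
  have d: "distr lborel borel (\<lambda>z. z + c) = lborel"
    using lborel_distr_plus[of c] by (simp add: add.commute [of _ c])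
  have m: "f \<in> borel_measurable borel" using assms by (auto dest: borel_measurable_integrable)
  have "integrable (distr lborel borel (\<lambda>z. z + c)) f" using assms d by simp
  then show "integrable lborel (\<lambda>z. f (z + c))" by (subst (asm) integrable_distr_eq) (use m in auto)
  have "(LINT z|lborel. f z) = (LINT z|distr lborel borel (\<lambda>z. z + c). f z)" using d by simp
  also have "\<dots> = (LINT z|lborel. f (z + c))" by (rule integral_distr) (use m in auto)
  finally show "(LINT z|lborel. f (z + c)) = (LINT z|lborel. f z)" ..
qed

text \<open>
  A bounded set \<open>A\<close> that injects into the torus meets finitely many translates of the cell. Cutting
  \<open>A\<close> along these translates and moving the pieces back into the cell turns an integral over \<open>A\<close>
  into one over the cell; this frees local computations from the position of \<open>A\<close> relative to the
  cell, in particular when the centre of \<open>A\<close> lies on the boundary of the cell.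
\<close>
lemma doubly_periodic_integral_unfold:
  fixes H :: "complex \<Rightarrow> real"
  assumes tau: "Im \<tau> > 0" and per: "doubly_periodic \<tau> H"
    and int: "set_integrable lborel (cell \<tau>) H"
    and A: "bounded A" "A \<in> sets borel"
    and inj: "\<And>z l. z \<in> A \<Longrightarrow> l \<in> lattice \<tau> \<Longrightarrow> z + l \<in> A \<Longrightarrow> l = 0"
  shows "set_integrable lborel A H"
    and "(\<And>z. H z \<noteq> 0 \<Longrightarrow> \<exists>l \<in> lattice \<tau>. z + l \<in> A) \<Longrightarrow>
      (LINT z:cell \<tau>|lborel. H z) = (LINT z:A|lborel. H z)"
proof -
  define L where "L = {l \<in> lattice \<tau>. \<exists>z \<in> cell \<tau>. z + l \<in> A}"
  obtain R where R: "\<And>z. z \<in> A \<Longrightarrow> cmod z \<le> R" using A(1) by (auto simp: bounded_iff)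
  have "L \<subseteq> {l \<in> lattice \<tau>. cmod l \<le> R + (1 + cmod \<tau>)}"
  proof
    fix l assume "l \<in> L"
    then obtain z where z: "l \<in> lattice \<tau>" "z \<in> cell \<tau>" "z + l \<in> A" by (auto simp: L_def)
    have "cmod l \<le> cmod (z + l) + cmod z" using norm_triangle_ineq4[of "z + l" z] by simp
    then show "l \<in> {l \<in> lattice \<tau>. cmod l \<le> R + (1 + cmod \<tau>)}"
      using R[OF z(3)] cell_bounded[OF z(2)] z(1) by simp
  qed
  then have finL: "finite L" using finite_bounded_lattice[OF tau] by (rule finite_subset)
  define g where "g l z = indicator (cell \<tau>) z * indicator A (z + l) * H z" for l z
  have gi: "integrable lborel (g l)" for l
  proof -
    have m: "{z. z + l \<in> A} \<in> sets borel"
      using measurable_sets[OF _ A(2), of "\<lambda>z. z + l" borel] by (simp add: vimage_def)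
    have "set_integrable lborel (cell \<tau> \<inter> {z. z + l \<in> A}) H"
      by (rule set_integrable_subset[OF int]) (use cell_borel[OF tau] m in auto)
    then show ?thesis unfolding set_integrable_def g_def
      by (rule back_subst[of "integrable lborel"]) (auto simp: indicator_def fun_eq_iff)
  qed
  have sumA: "(\<Sum>l\<in>L. g l (z - l)) = indicator A z * H z" for z
  proof (cases "z \<in> A")
    case True
    obtain l where l: "l \<in> lattice \<tau>" "z - l \<in> cell \<tau>" using ex_cell_translate[OF tau] by blast
    then have lL: "l \<in> L" using True by (auto simp: L_def intro!: bexI[of _ "z - l"])
    have "(\<Sum>k\<in>L. g k (z - k)) = (\<Sum>k\<in>L. if k = l then H z else 0)"
    proof (rule sum.cong[OF refl])
      fix k assume k: "k \<in> L"
      show "g k (z - k) = (if k = l then H z else 0)"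
      proof (cases "z - k \<in> cell \<tau>")
        case cell: True
        have "k = l"
          using cell_translate_unique[OF tau cell, of "k - l"] l k by (auto simp: L_def)
        then show ?thesis
          using True l doubly_periodic_lattice_diff[OF per l(1), of z] by (simp add: g_def)
      next
        case False
        then have "k \<noteq> l" using l by blast
        then show ?thesis using False by (simp add: g_def)
      qed
    qed
    then show ?thesis using True lL finL by simp
  qed (auto simp: g_def)
  have gd: "integrable lborel (\<lambda>z. g l (z - l))"
    "(LINT z|lborel. g l (z - l)) = (LINT z|lborel. g l z)" for l
    using integrable_translate[OF gi, of l "- l"] by simp_all
  have "integrable lborel (\<lambda>z. \<Sum>l\<in>L. g l (z - l))"
    by (intro Bochner_Integration.integrable_sum gd)
  then show "set_integrable lborel A H" by (simp add: sumA set_integrable_def)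
  assume supp: "\<And>z. H z \<noteq> 0 \<Longrightarrow> \<exists>l \<in> lattice \<tau>. z + l \<in> A"
  have sumC: "(\<Sum>l\<in>L. g l z) = indicator (cell \<tau>) z * H z" for z
  proof (cases "z \<in> cell \<tau> \<and> H z \<noteq> 0")
    case True
    then obtain l where l: "l \<in> lattice \<tau>" "z + l \<in> A" using supp by blast
    then have lL: "l \<in> L" using True by (auto simp: L_def)
    have "(\<Sum>k\<in>L. g k z) = (\<Sum>k\<in>L. if k = l then H z else 0)"
    proof (rule sum.cong[OF refl])
      fix k assume k: "k \<in> L"
      show "g k z = (if k = l then H z else 0)"
      proof (cases "z + k \<in> A")
        case kA: True
        have "l - k \<in> lattice \<tau>" "z + k + (l - k) \<in> A"
          using l k by (auto simp: L_def)
        from inj[OF kA this] have "k = l" by simp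
        then show ?thesis using True l by (simp add: g_def)
      next
        case False
        then have "k \<noteq> l" using l by blast
        then show ?thesis using False by (simp add: g_def)
      qed
    qed
    then show ?thesis using True lL finL by simp
  qed (auto simp: g_def)
  have "(LINT z:cell \<tau>|lborel. H z) = (LINT z|lborel. (\<Sum>l\<in>L. g l z))"
    by (simp add: sumC set_lebesgue_integral_def)
  also have "\<dots> = (\<Sum>l\<in>L. LINT z|lborel. g l z)"
    by (rule Bochner_Integration.integral_sum) (rule gi)
  also have "\<dots> = (\<Sum>l\<in>L. LINT z|lborel. g l (z - l))"
    by (simp add: gd)
  also have "\<dots> = (LINT z|lborel. (\<Sum>l\<in>L. g l (z - l)))"
    by (rule Bochner_Integration.integral_sum[symmetric]) (rule gd)
  also have "\<dots> = (LINT z:A|lborel. H z)"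
    by (simp add: sumA set_lebesgue_integral_def)
  finally show "(LINT z:cell \<tau>|lborel. H z) = (LINT z:A|lborel. H z)" .
qed

section \<open>Radial test functions\<close>

lemma dir_deriv_eqI:
  assumes "(f has_derivative D) (at z)"
  shows "dir_deriv v f z = D v"
proof -
  have 1: "((\<lambda>t::real. z + of_real t * v) has_derivative (\<lambda>t. of_real t * v)) (at 0)"
    by (auto intro!: derivative_eq_intros)
  have 2: "((\<lambda>t::real. f (z + of_real t * v)) has_derivative (\<lambda>t. D (of_real t * v))) (at 0)"
    using has_derivative_compose[OF 1, of f D] assms by simp
  have "D (of_real t * v) = t * D v" for t
    using linear_cmul[OF has_derivative_linear[OF assms], of t v] by (simp add: scaleR_conv_of_real)
  then have "((\<lambda>t::real. f (z + of_real t * v)) has_real_derivative D v) (at 0)"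
    using 2 by (simp add: has_field_derivative_def mult.commute[of _ "D v"])
  then show ?thesis unfolding dir_deriv_def by (rule DERIV_imp_deriv)
qed

lemma
  assumes der: "\<And>z. (f has_derivative (\<lambda>h. A z * Re h + B z * Im h)) (at z)"
  shows dir_deriv_1_eqI: "dir_deriv 1 f = A"
    and dir_deriv_ii_eqI: "dir_deriv \<i> f = B"
    and C1I: "continuous_on UNIV A \<Longrightarrow> continuous_on UNIV B \<Longrightarrow> C1 f"
proof -
  show 1: "dir_deriv 1 f = A" by (rule ext) (simp add: dir_deriv_eqI[OF der])
  show 2: "dir_deriv \<i> f = B" by (rule ext) (simp add: dir_deriv_eqI[OF der])
  assume "continuous_on UNIV A" "continuous_on UNIV B"
  then show "C1 f" using 1 2 der by (auto simp: C1_def differentiable_def)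
qed

lemma eventually_nhds_shift:
  fixes z v :: complex
  assumes "eventually P (nhds z)"
  shows "\<forall>\<^sub>F t::real in nhds 0. P (z + of_real t * v)"
proof -
  have "((\<lambda>t::real. z + of_real t * v) \<longlongrightarrow> z + of_real 0 * v) (nhds 0)"
    by (intro tendsto_intros filterlim_ident)
  then show ?thesis using assms by (simp add: filterlim_def le_filter_def eventually_filtermap)
qed

text \<open>
  All ingredients of a test function are local, so a periodised bump may be compared with a single
  radial function near each point.
\<close>
lemma dir_deriv_cong_ev:
  assumes "\<forall>\<^sub>F w in nhds z. f w = g w"
  shows "dir_deriv v f z = dir_deriv v g z"
  unfolding dir_deriv_def by (rule deriv_cong_ev[OF eventually_nhds_shift[OF assms] refl])

lemma eventually_dir_deriv_cong_ev:
  assumes "\<forall>\<^sub>F w in nhds z. f w = g w"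
  shows "\<forall>\<^sub>F w in nhds z. dir_deriv v f w = dir_deriv v g w"
proof -
  have "\<forall>\<^sub>F y in nhds z. \<forall>\<^sub>F w in nhds y. f w = g w"
    using assms by (simp add: eventually_eventually)
  then show ?thesis by (rule eventually_mono) (rule dir_deriv_cong_ev)
qed

lemma laplacian_cong_ev:
  assumes "\<forall>\<^sub>F w in nhds z. f w = g w"
  shows "laplacian f z = laplacian g z"
  unfolding laplacian_def
  by (intro arg_cong2[of _ _ _ _ "(+)"] dir_deriv_cong_ev eventually_dir_deriv_cong_ev assms)

lemma C1_local:
  assumes loc: "\<And>z. \<exists>g. C1 g \<and> (\<forall>\<^sub>F w in nhds z. f w = g w)"
  shows "C1 f"
  unfolding C1_def
proof (intro conjI allI)
  fix z
  obtain g where g: "C1 g" "\<forall>\<^sub>F w in nhds z. f w = g w" using loc by blast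
  obtain D where "(g has_derivative D) (at z)" using g(1) by (auto simp: C1_def differentiable_def)
  then have "(f has_derivative D) (at z)"
  proof (rule has_derivative_transform_eventually)
    show "\<forall>\<^sub>F x in at z. g x = f x"
      using g(2) by (auto simp: eventually_at_filter elim: eventually_mono)
    show "g z = f z" using eventually_nhds_x_imp_x[OF g(2)] by simp
  qed auto
  then show "f differentiable (at z)" by (auto simp: differentiable_def)
next
  have "isCont (dir_deriv v f) z" if "v = 1 \<or> v = \<i>" for v z
  proof -
    obtain g where g: "C1 g" "\<forall>\<^sub>F w in nhds z. f w = g w" using loc by blast
    have "isCont (dir_deriv v g) z" using g(1) that by (auto simp: C1_def continuous_on_eq_continuous_at)
    moreover have "isCont (dir_deriv v f) z \<longleftrightarrow> isCont (dir_deriv v g) z"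
      by (rule isCont_cong) (rule eventually_dir_deriv_cong_ev[OF g(2)])
    ultimately show ?thesis by simp
  qed
  then show "continuous_on UNIV (dir_deriv 1 f)" "continuous_on UNIV (dir_deriv \<i> f)"
    by (auto simp: continuous_on_eq_continuous_at)
qed

lemma C2_local:
  assumes loc: "\<And>z. \<exists>g. C2 g \<and> (\<forall>\<^sub>F w in nhds z. f w = g w)"
  shows "C2 f"
  unfolding C2_def
proof (intro conjI C1_local)
  fix z
  obtain g where g: "C2 g" "\<forall>\<^sub>F w in nhds z. f w = g w" using loc by blast
  show "\<exists>g. C1 g \<and> (\<forall>\<^sub>F w in nhds z. f w = g w)" using g by (auto simp: C2_def)
  show "\<exists>g. C1 g \<and> (\<forall>\<^sub>F w in nhds z. dir_deriv 1 f w = g w)"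
       "\<exists>g. C1 g \<and> (\<forall>\<^sub>F w in nhds z. dir_deriv \<i> f w = g w)"
    using g eventually_dir_deriv_cong_ev[OF g(2)] by (auto simp: C2_def)
qed

lemma C2_zero: "C2 (\<lambda>_. 0)" and laplacian_zero [simp]: "laplacian (\<lambda>_. 0) z = 0"
proof -
  have d: "dir_deriv v (\<lambda>_. 0) = (\<lambda>_. 0)" for v by (simp add: dir_deriv_def fun_eq_iff)
  then show "C2 (\<lambda>_. 0)" by (simp add: C2_def C1_def)
  show "laplacian (\<lambda>_. 0) z = 0" by (simp add: laplacian_def d)
qed

lemma
  fixes \<Phi> \<Phi>' \<Phi>'' :: "real \<Rightarrow> real" and w :: complex
  assumes d1: "\<And>t. (\<Phi> has_real_derivative \<Phi>' t) (at t)"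
    and d2: "\<And>t. (\<Phi>' has_real_derivative \<Phi>'' t) (at t)"
    and c: "continuous_on UNIV \<Phi>''"
  defines "f \<equiv> \<lambda>z. \<Phi> ((cmod (z - w))\<^sup>2)"
  shows C2_radial: "C2 f"
    and laplacian_radial:
      "laplacian f z = 4 * ((cmod (z - w))\<^sup>2 * \<Phi>'' ((cmod (z - w))\<^sup>2) + \<Phi>' ((cmod (z - w))\<^sup>2))"
proof -
  define N where "N z = (Re z - Re w)\<^sup>2 + (Im z - Im w)\<^sup>2" for z
  have N: "(cmod (z - w))\<^sup>2 = N z" for z by (simp add: cmod_power2 N_def)
  have f: "f = (\<lambda>z. \<Phi> (N z))" by (simp add: f_def N)
  have dN: "(N has_derivative (\<lambda>h. 2 * (Re z - Re w) * Re h + 2 * (Im z - Im w) * Im h)) (at z)" for z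
    unfolding N_def by (auto intro!: derivative_eq_intros simp: algebra_simps)
  have dc: "((\<lambda>z. F (N z)) has_derivative (\<lambda>h. F' (N z) * (2 * (Re z - Re w) * Re h + 2 * (Im z - Im w) * Im h))) (at z)"
    if "\<And>t. (F has_real_derivative F' t) (at t)" for F F' :: "real \<Rightarrow> real" and z
    using has_derivative_compose[OF dN[of z], of F "\<lambda>h. F' (N z) * h"] that[of "N z"]
    by (simp add: has_field_derivative_def)
  have cN: "continuous_on UNIV N" unfolding N_def by (intro continuous_intros)
  have cc: "continuous_on UNIV (\<lambda>z. F (N z))" if "continuous_on UNIV F" for F :: "real \<Rightarrow> real"
    by (rule continuous_on_compose2[OF that cN]) auto
  have c1: "continuous_on UNIV \<Phi>'"
    using d2 by (auto simp: continuous_on_eq_continuous_at intro: DERIV_isCont)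
  define A where "A z = \<Phi>' (N z) * (2 * (Re z - Re w))" for z
  define B where "B z = \<Phi>' (N z) * (2 * (Im z - Im w))" for z
  have df: "(f has_derivative (\<lambda>h. A z * Re h + B z * Im h)) (at z)" for z
    unfolding f A_def B_def
    by (rule has_derivative_eq_rhs[OF dc[OF d1]]) (auto simp: algebra_simps)
  have lin: "((\<lambda>z. 2 * (Re z - Re w)) has_derivative (\<lambda>h. 2 * Re h)) (at z)"
            "((\<lambda>z. 2 * (Im z - Im w)) has_derivative (\<lambda>h. 2 * Im h)) (at z)" for z
    by (auto intro!: derivative_eq_intros)
  have dA: "(A has_derivative (\<lambda>h. (\<Phi>'' (N z) * (2 * (Re z - Re w))\<^sup>2 + 2 * \<Phi>' (N z)) * Re h
      + (\<Phi>'' (N z) * (2 * (Im z - Im w)) * (2 * (Re z - Re w))) * Im h)) (at z)" for z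
    unfolding A_def
    by (rule has_derivative_eq_rhs[OF has_derivative_mult[OF dc[OF d2] lin(1)]])
       (simp add: fun_eq_iff algebra_simps power2_eq_square)
  have dB: "(B has_derivative (\<lambda>h. (\<Phi>'' (N z) * (2 * (Re z - Re w)) * (2 * (Im z - Im w))) * Re h
      + (\<Phi>'' (N z) * (2 * (Im z - Im w))\<^sup>2 + 2 * \<Phi>' (N z)) * Im h)) (at z)" for z
    unfolding B_def
    by (rule has_derivative_eq_rhs[OF has_derivative_mult[OF dc[OF d2] lin(2)]])
       (simp add: fun_eq_iff algebra_simps power2_eq_square)
  note cont = continuous_intros cc[OF c] cc[OF c1]
  have fA: "dir_deriv 1 f = A" and fB: "dir_deriv \<i> f = B"
    using dir_deriv_1_eqI[OF df] dir_deriv_ii_eqI[OF df] by auto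
  have "C1 f" by (rule C1I[OF df]; unfold A_def B_def; intro cont)
  moreover have "C1 A" by (rule C1I[OF dA]; intro cont)
  moreover have "C1 B" by (rule C1I[OF dB]; intro cont)
  ultimately show "C2 f" unfolding C2_def fA fB by blast
  show "laplacian f z = 4 * ((cmod (z - w))\<^sup>2 * \<Phi>'' ((cmod (z - w))\<^sup>2) + \<Phi>' ((cmod (z - w))\<^sup>2))"
    unfolding laplacian_def fA fB dir_deriv_1_eqI[OF dA] dir_deriv_ii_eqI[OF dB] N
    by (simp add: N_def algebra_simps power2_eq_square)
qed

text \<open>
  The function \<open>\<Phi> (|z - w|\<^sup>2)\<close> repeated along the lattice. Only the translates within distance \<open>d\<close>
  are summed, so for small \<open>d\<close> the sum has at most one term; \<open>\<Phi>\<close> is meant to vanish from \<open>d\<^sup>2\<close> on.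
\<close>
definition periodize :: "complex \<Rightarrow> complex \<Rightarrow> real \<Rightarrow> (real \<Rightarrow> real) \<Rightarrow> complex \<Rightarrow> real" where
  "periodize \<tau> w d \<Phi> z = (\<Sum>l \<in> {l \<in> lattice \<tau>. cmod (z - w - l) < d}. \<Phi> ((cmod (z - w - l))\<^sup>2))"

context
  fixes \<tau> w :: complex and d :: real and \<Phi> :: "real \<Rightarrow> real"
  assumes tau: "Im \<tau> > 0" and d: "0 < d" "d \<le> min 1 (Im \<tau>) / 4"
    and supp: "\<And>t. d\<^sup>2 \<le> t \<Longrightarrow> \<Phi> t = 0"
begin

lemma periodize_near:
  assumes "l \<in> lattice \<tau>" "cmod (z - w - l) < min 1 (Im \<tau>) / 2"
  shows "periodize \<tau> w d \<Phi> z = \<Phi> ((cmod (z - w - l))\<^sup>2)"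
proof -
  have "k = l" if "k \<in> lattice \<tau>" "cmod (z - w - k) < d" for k
  proof (rule ccontr)
    assume "k \<noteq> l"
    then have "min 1 (Im \<tau>) \<le> cmod (k - l)" using that assms by (intro lattice_norm_ge tau) auto
    also have "\<dots> \<le> cmod (z - w - l) + cmod (z - w - k)"
      using norm_triangle_ineq4[of "z - w - l" "z - w - k"] by (simp add: algebra_simps)
    also have "\<dots> < min 1 (Im \<tau>) / 2 + min 1 (Im \<tau>) / 4" using that assms d by linarith
    finally show False using d by linarith
  qed
  then have sub: "{k \<in> lattice \<tau>. cmod (z - w - k) < d} \<subseteq> {l}" by blast
  have "{k \<in> lattice \<tau>. cmod (z - w - k) < d} = (if cmod (z - w - l) < d then {l} else {})"
  proof (cases "cmod (z - w - l) < d")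
    case True
    then have "{l} \<subseteq> {k \<in> lattice \<tau>. cmod (z - w - k) < d}" using assms(1) by blast
    then show ?thesis using True equalityI[OF sub] by simp
  next
    case False
    then have "l \<notin> {k \<in> lattice \<tau>. cmod (z - w - k) < d}" by blast
    then show ?thesis using False sub by auto
  qed
  moreover have "d\<^sup>2 \<le> (cmod (z - w - l))\<^sup>2" if "\<not> cmod (z - w - l) < d"
    using that d by (intro power_mono) auto
  ultimately show ?thesis using supp by (simp add: periodize_def)
qed

lemma periodize_far:
  assumes "\<And>l. l \<in> lattice \<tau> \<Longrightarrow> d \<le> cmod (z - w - l)"
  shows "periodize \<tau> w d \<Phi> z = 0"
proof -
  have "{l \<in> lattice \<tau>. cmod (z - w - l) < d} = {}" using assms by force
  then show ?thesis unfolding periodize_def by (simp only: sum.empty)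
qed

text \<open>
  The periodised function is radial on discs around \<open>w + \<Lambda>\<close> of at least twice the radius of its
  support, so a point outside these discs has a whole neighbourhood on which the function vanishes.
\<close>
lemma periodize_cases [case_names near far]:
  obtains l where "l \<in> lattice \<tau>" "cmod (z - w - l) < min 1 (Im \<tau>) / 2"
      "\<forall>\<^sub>F x in nhds z. periodize \<tau> w d \<Phi> x = \<Phi> ((cmod (x - (w + l)))\<^sup>2)"
  | "\<And>l. l \<in> lattice \<tau> \<Longrightarrow> d \<le> cmod (z - w - l)" "\<forall>\<^sub>F x in nhds z. periodize \<tau> w d \<Phi> x = 0"
proof (cases "\<exists>l\<in>lattice \<tau>. cmod (z - w - l) < min 1 (Im \<tau>) / 2")
  case True
  then obtain l where l: "l \<in> lattice \<tau>" "cmod (z - w - l) < min 1 (Im \<tau>) / 2" by blast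
  have "\<forall>\<^sub>F x in nhds z. x \<in> ball (w + l) (min 1 (Im \<tau>) / 2)"
    using l by (intro eventually_nhds_in_open) (auto simp: dist_norm norm_minus_commute algebra_simps)
  then have "\<forall>\<^sub>F x in nhds z. periodize \<tau> w d \<Phi> x = \<Phi> ((cmod (x - (w + l)))\<^sup>2)"
    by eventually_elim
       (use periodize_near[OF l(1)] in \<open>simp add: dist_norm norm_minus_commute diff_diff_eq\<close>)
  with l show ?thesis using that(1) by blast
next
  case False
  then have F: "min 1 (Im \<tau>) / 2 \<le> cmod (z - w - l)" if "l \<in> lattice \<tau>" for l using that by force
  have "\<forall>\<^sub>F x in nhds z. x \<in> ball z (min 1 (Im \<tau>) / 4)"
    using d by (intro eventually_nhds_in_open) auto
  then have "\<forall>\<^sub>F x in nhds z. periodize \<tau> w d \<Phi> x = 0"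
  proof eventually_elim
    case (elim x)
    show ?case
    proof (rule periodize_far)
      fix l assume "l \<in> lattice \<tau>"
      have "cmod (z - w - l) \<le> cmod (x - w - l) + cmod (z - x)"
        using norm_triangle_ineq[of "x - w - l" "z - x"] by (simp add: algebra_simps)
      moreover have "cmod (z - x) < min 1 (Im \<tau>) / 4" using elim by (simp add: dist_norm)
      ultimately show "d \<le> cmod (x - w - l)" using F[OF \<open>l \<in> lattice \<tau>\<close>] d(2) by linarith
    qed
  qed
  moreover have "d \<le> cmod (z - w - l)" if "l \<in> lattice \<tau>" for l using F[OF that] d by linarith
  ultimately show ?thesis using that(2) by blast
qed

lemma periodize_doubly_periodic: "doubly_periodic \<tau> (periodize \<tau> w d \<Phi>)"
proof -
  have "periodize \<tau> w d \<Phi> (z + k) = periodize \<tau> w d \<Phi> z" if k: "k \<in> lattice \<tau>" for k z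
    unfolding periodize_def
  proof (rule sum.reindex_bij_witness[of _ "\<lambda>l. l + k" "\<lambda>l. l - k"])
  qed (use k in \<open>auto simp: algebra_simps intro: lattice_diff lattice_add\<close>)
  then show ?thesis by (simp add: doubly_periodic_def)
qed

context
  fixes \<Phi>' \<Phi>'' :: "real \<Rightarrow> real"
  assumes d1: "\<And>t. (\<Phi> has_real_derivative \<Phi>' t) (at t)"
    and d2: "\<And>t. (\<Phi>' has_real_derivative \<Phi>'' t) (at t)"
    and c: "continuous_on UNIV \<Phi>''"
begin

lemma periodize_test_function: "test_function \<tau> (periodize \<tau> w d \<Phi>)"
proof -
  have "C2 (periodize \<tau> w d \<Phi>)"
  proof (rule C2_local)
    fix z
    show "\<exists>g. C2 g \<and> (\<forall>\<^sub>F x in nhds z. periodize \<tau> w d \<Phi> x = g x)"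
    proof (cases rule: periodize_cases[of z])
      case (near l)
      then show ?thesis using C2_radial[OF d1 d2 c] by blast
    next
      case far
      then show ?thesis using C2_zero by blast
    qed
  qed
  then show ?thesis using periodize_doubly_periodic by (simp add: test_function_def)
qed

lemma laplacian_periodize_near:
  assumes "cmod (z - w) < min 1 (Im \<tau>) / 2"
  shows "laplacian (periodize \<tau> w d \<Phi>) z =
    4 * ((cmod (z - w))\<^sup>2 * \<Phi>'' ((cmod (z - w))\<^sup>2) + \<Phi>' ((cmod (z - w))\<^sup>2))"
proof -
  have "\<forall>\<^sub>F x in nhds z. x \<in> ball w (min 1 (Im \<tau>) / 2)"
    using assms by (intro eventually_nhds_in_open) (auto simp: dist_norm norm_minus_commute)
  then have "\<forall>\<^sub>F x in nhds z. periodize \<tau> w d \<Phi> x = \<Phi> ((cmod (x - w))\<^sup>2)"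
    by eventually_elim
       (use periodize_near[OF lattice_0] in \<open>simp add: dist_norm norm_minus_commute\<close>)
  from laplacian_cong_ev[OF this] show ?thesis
    using laplacian_radial[OF d1 d2 c] by simp
qed

lemma laplacian_periodize_far:
  assumes "\<And>l. l \<in> lattice \<tau> \<Longrightarrow> d < cmod (z - w - l)"
  shows "laplacian (periodize \<tau> w d \<Phi>) z = 0"
proof (cases rule: periodize_cases[of z])
  case (near l)
  have "d < cmod (z - (w + l))" using assms[OF near(1)] by (simp add: diff_diff_eq)
  then have "\<forall>\<^sub>F x in nhds z. x \<in> - cball (w + l) d"
    by (intro eventually_nhds_in_open) (auto simp: dist_norm norm_minus_commute)
  with near(3) have "\<forall>\<^sub>F x in nhds z. periodize \<tau> w d \<Phi> x = 0"
  proof eventually_elim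
    case (elim x)
    have "d\<^sup>2 \<le> (cmod (x - (w + l)))\<^sup>2" using elim d
      by (intro power_mono) (auto simp: dist_norm norm_minus_commute)
    then show ?case using elim supp by simp
  qed
  from laplacian_cong_ev[OF this] show ?thesis by simp
next
  case far
  from laplacian_cong_ev[OF far(2)] show ?thesis by simp
qed

end
end

section \<open>Regularised logarithms\<close>

lemma DERIV_If_le:
  fixes f g f' g' :: "real \<Rightarrow> real"
  assumes f: "\<And>x. x \<le> c \<Longrightarrow> (f has_real_derivative f' x) (at x)"
    and g: "\<And>x. c \<le> x \<Longrightarrow> (g has_real_derivative g' x) (at x)"
    and eq: "f c = g c" "f' c = g' c"
  shows "((\<lambda>x. if x \<le> c then f x else g x) has_real_derivative (if x \<le> c then f' x else g' x)) (at x)"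
    (is "(?h has_real_derivative _) _")
proof -
  consider "x < c" | "x = c" | "c < x" by linarith
  then show ?thesis
  proof cases
    case 1
    then have "\<forall>\<^sub>F y in nhds x. y \<in> {..<c}" by (intro eventually_nhds_in_open) auto
    then have ev: "\<forall>\<^sub>F y in nhds x. ?h y = f y" by eventually_elim auto
    show ?thesis using 1 f[of x] DERIV_cong_ev[OF refl ev refl] by simp
  next
    case 3
    then have "\<forall>\<^sub>F y in nhds x. y \<in> {c<..}" by (intro eventually_nhds_in_open) auto
    then have ev: "\<forall>\<^sub>F y in nhds x. ?h y = g y" by eventually_elim auto
    show ?thesis using 3 g[of x] DERIV_cong_ev[OF refl ev refl] by simp
  next
    case 2
    have "(f has_real_derivative f' c) (at c within {..c})"
      using f[of c] has_field_derivative_at_within by blast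
    then have "(?h has_real_derivative f' c) (at c within {..c})"
      by (rule has_field_derivative_transform_within[where d = 1]) auto
    moreover have "(g has_real_derivative f' c) (at c within {c..})"
      using g[of c] eq has_field_derivative_at_within by force
    then have "(?h has_real_derivative f' c) (at c within {c..})"
      by (rule has_field_derivative_transform_within[where d = 1]) (use eq in auto)
    ultimately have "(?h has_real_derivative f' c) (at c within ({..c} \<union> {c..}))"
      unfolding has_field_derivative_iff by (subst at_within_union) (rule filterlim_sup)
    moreover have "{..c} \<union> {c..} = UNIV" by auto
    ultimately show ?thesis using 2 by simp
  qed
qed

text \<open>
  The function \<open>log |z|\<close>, written in terms of \<open>t = |z|\<^sup>2\<close>, with its singularity replaced for
  \<open>t \<le> d\<^sup>2\<close> by the second Taylor polynomial at \<open>t = d\<^sup>2\<close>. This makes it of class \<open>C\<^sup>2\<close>, as test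
  functions require.
\<close>
definition log_profile :: "real \<Rightarrow> real \<Rightarrow> real" where
  "log_profile d t = (if t \<le> d\<^sup>2 then ln d + ((t / d\<^sup>2 - 1) - (t / d\<^sup>2 - 1)\<^sup>2 / 2) / 2 else ln t / 2)"

definition log_profile' :: "real \<Rightarrow> real \<Rightarrow> real" where
  "log_profile' d t = (if t \<le> d\<^sup>2 then (2 - t / d\<^sup>2) / (2 * d\<^sup>2) else 1 / (2 * t))"

definition log_profile'' :: "real \<Rightarrow> real \<Rightarrow> real" where
  "log_profile'' d t = (if t \<le> d\<^sup>2 then - 1 / (2 * d ^ 4) else - 1 / (2 * t\<^sup>2))"

lemma log_profile_deriv:
  assumes d: "d > 0"
  shows "(log_profile d has_real_derivative log_profile' d t) (at t)"
proof -
  have pos: "0 < x" if "d\<^sup>2 \<le> x" for x using that d zero_less_power[OF d, of 2] by linarith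
  have "((\<lambda>t. if t \<le> d\<^sup>2 then ln d + ((t / d\<^sup>2 - 1) - (t / d\<^sup>2 - 1)\<^sup>2 / 2) / 2 else ln t / 2)
     has_real_derivative (if t \<le> d\<^sup>2 then (2 - t / d\<^sup>2) / (2 * d\<^sup>2) else 1 / (2 * t))) (at t)"
  proof (rule DERIV_If_le)
    show "((\<lambda>t. ln d + ((t / d\<^sup>2 - 1) - (t / d\<^sup>2 - 1)\<^sup>2 / 2) / 2) has_real_derivative (2 - x / d\<^sup>2) / (2 * d\<^sup>2)) (at x)" for x
      using d by (auto intro!: derivative_eq_intros simp: field_simps)
    show "((\<lambda>t. ln t / 2) has_real_derivative 1 / (2 * x)) (at x)" if "d\<^sup>2 \<le> x" for x
      using pos[OF that] by (auto intro!: derivative_eq_intros)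
  qed (use d in \<open>simp_all add: ln_realpow\<close>)
  then show ?thesis unfolding log_profile_def log_profile'_def .
qed

lemma log_profile'_deriv:
  assumes d: "d > 0"
  shows "(log_profile' d has_real_derivative log_profile'' d t) (at t)"
proof -
  have pos: "0 < x" if "d\<^sup>2 \<le> x" for x using that d zero_less_power[OF d, of 2] by linarith
  have "((\<lambda>t. if t \<le> d\<^sup>2 then (2 - t / d\<^sup>2) / (2 * d\<^sup>2) else 1 / (2 * t))
     has_real_derivative (if t \<le> d\<^sup>2 then - 1 / (2 * d ^ 4) else - 1 / (2 * t\<^sup>2))) (at t)"
  proof (rule DERIV_If_le)
    show "((\<lambda>t. (2 - t / d\<^sup>2) / (2 * d\<^sup>2)) has_real_derivative - 1 / (2 * d ^ 4)) (at x)" for x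
      using d by (auto intro!: derivative_eq_intros simp: field_simps power4_eq_xxxx power2_eq_square)
    show "((\<lambda>t. 1 / (2 * t)) has_real_derivative - 1 / (2 * x\<^sup>2)) (at x)" if "d\<^sup>2 \<le> x" for x
      using pos[OF that] by (auto intro!: derivative_eq_intros simp: field_simps power2_eq_square)
  qed (use d in \<open>simp_all add: power4_eq_xxxx power2_eq_square\<close>)
  then show ?thesis unfolding log_profile''_def log_profile'_def .
qed

lemma continuous_on_log_profile'':
  assumes d: "d > 0"
  shows "continuous_on UNIV (log_profile'' d)"
proof -
  have "continuous_on ({..d\<^sup>2} \<union> {d\<^sup>2..}) (\<lambda>t. if t \<le> d\<^sup>2 then - 1 / (2 * d ^ 4) else - 1 / (2 * t\<^sup>2))"
  proof (rule continuous_on_If)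
    have "x \<noteq> 0" if "d\<^sup>2 \<le> x" for x using that d zero_less_power[OF d, of 2] by linarith
    then show "continuous_on {d\<^sup>2..} (\<lambda>t. - 1 / (2 * t\<^sup>2))" by (intro continuous_intros) auto
  qed (auto simp flip: power_mult intro: continuous_intros)
  moreover have "{..d\<^sup>2} \<union> {d\<^sup>2..} = UNIV" by auto
  ultimately show ?thesis by (simp add: log_profile''_def[abs_def])
qed

text \<open>
  The left-hand side is the Laplacian of \<open>\<Phi> (|z|\<^sup>2)\<close> for \<open>\<Phi> = log_profile d\<close>. Outside the disc of
  radius \<open>d\<close> it vanishes because \<open>log |z|\<close> is harmonic.
\<close>
lemma log_profile_laplacian:
  assumes d: "d > 0"
  shows "4 * (t * log_profile'' d t + log_profile' d t) = 4 / d\<^sup>2 * max 0 (1 - t / d\<^sup>2)"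
proof (cases "t \<le> d\<^sup>2")
  case True
  then have "0 \<le> 1 - t / d\<^sup>2" using d by (simp add: field_simps)
  then show ?thesis using True d
    by (simp add: log_profile''_def log_profile'_def field_simps power4_eq_xxxx power2_eq_square)
next
  case False
  then have "t > 0" "1 - t / d\<^sup>2 \<le> 0" using d zero_less_power[OF d, of 2] by (linarith, simp add: field_simps)
  then show ?thesis using False
    by (simp add: log_profile''_def log_profile'_def field_simps power2_eq_square)
qed

lemma log_profile_outer: "d > 0 \<Longrightarrow> d\<^sup>2 \<le> t \<Longrightarrow> log_profile d t = ln t / 2"
  by (cases "t = d\<^sup>2") (auto simp: log_profile_def ln_realpow)

lemma log_profile_inner_bounds:
  assumes "d > 0" "0 \<le> t" "t \<le> d\<^sup>2"
  shows "ln d - 3 / 4 \<le> log_profile d t" "log_profile d t \<le> ln d"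
proof -
  define s where "s = 1 - t / d\<^sup>2"
  have s: "0 \<le> s" "s \<le> 1" using assms by (auto simp: s_def field_simps)
  then have "s\<^sup>2 \<le> 1" by (simp add: power_le_one)
  moreover have "log_profile d t = ln d + (- s - s\<^sup>2 / 2) / 2"
    using assms by (simp add: log_profile_def s_def power2_commute)
  moreover have "0 \<le> s\<^sup>2" by simp
  ultimately have "ln d - 3 / 4 \<le> log_profile d t \<and> log_profile d t \<le> ln d"
    using s by argo
  then show "ln d - 3 / 4 \<le> log_profile d t" "log_profile d t \<le> ln d" by auto
qed

lemma log_profile_halving:
  assumes d: "d > 0" and t: "0 \<le> t"
  shows "\<bar>log_profile d t - log_profile (d / 2) t\<bar> \<le> (if t < d\<^sup>2 then 2 else 0)"
proof -
  have h: "(d / 2)\<^sup>2 \<le> d\<^sup>2" using d by (intro power_mono) auto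
  have l2: "ln (d / 2) = ln d - ln 2" "0 < ln (2::real)" "ln (2::real) \<le> 1"
    using d ln_2_less_1 by (auto simp: ln_div)
  consider "d\<^sup>2 \<le> t" | "t < d\<^sup>2" "(d / 2)\<^sup>2 \<le> t" | "t < (d/2)\<^sup>2" by linarith
  then show ?thesis
  proof cases
    case 1
    then show ?thesis using log_profile_outer[of d t] log_profile_outer[of "d / 2" t] h d by simp
  next
    case 2
    then have "0 < t" using d zero_less_power[of "d / 2" 2] by linarith
    then have "ln t \<le> ln (d\<^sup>2)" "ln ((d / 2)\<^sup>2) \<le> ln t" using 2 d by simp_all
    then have "ln t \<le> 2 * ln d" "2 * ln (d / 2) \<le> ln t" using d ln_realpow[of d 2] ln_realpow[of "d / 2" 2] by simp_all
    then show ?thesis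
      using 2 log_profile_outer[of "d / 2" t] log_profile_inner_bounds[of d t] d t l2 by (auto simp: abs_le_iff)
  next
    case 3
    then have t2: "t \<le> (d / 2)\<^sup>2" "t < d\<^sup>2" using h by auto
    have "\<bar>log_profile d t - log_profile (d / 2) t\<bar> \<le> 2"
      using log_profile_inner_bounds[of d t] log_profile_inner_bounds[of "d / 2" t] d t l2 t2
      unfolding abs_le_iff by (auto simp del: ln_gt_zero_iff)
    then show ?thesis using t2 by simp
  qed
qed

text \<open>
  Each halving of the radius changes the profile by at most \<open>2\<close>, and only inside the current disc.
  Since the areas of these discs form a geometric series, the difference has an integral bounded
  independently of \<open>n\<close>.
\<close>
lemma log_profile_dyadic:
  assumes d: "d > 0" and t: "0 \<le> t"
  shows "\<bar>log_profile d t - log_profile (d / 2 ^ n) t\<bar> \<le> (\<Sum>j<n. if t < (d / 2 ^ j)\<^sup>2 then 2 else 0)"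
proof (induction n)
  case (Suc n)
  have "\<bar>log_profile (d / 2 ^ n) t - log_profile (d / 2 ^ Suc n) t\<bar> \<le> (if t < (d / 2 ^ n)\<^sup>2 then 2 else 0)"
    using log_profile_halving[of "d / 2 ^ n" t] d t by (simp add: mult.commute)
  then show ?case using Suc by simp
qed simp

lemma power2_less_iff_nonneg:
  fixes x y :: real
  assumes "0 \<le> x" "0 \<le> y"
  shows "x\<^sup>2 < y\<^sup>2 \<longleftrightarrow> x < y"
  using assms power_strict_mono[of x y 2] power2_less_imp_less[of x y] by auto

text \<open>
  Layer cake: the superlevel sets of the integrand are discs, whose areas are linear in the level.
\<close>
lemma integral_paraboloid:
  fixes w :: complex
  assumes d: "d > 0"
  shows "integrable lborel (\<lambda>z. max 0 (1 - (cmod (z - w))\<^sup>2 / d\<^sup>2))"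
    and "(LINT z|lborel. max 0 (1 - (cmod (z - w))\<^sup>2 / d\<^sup>2)) = pi * d\<^sup>2 / 2"
proof -
  define f where "f z = max 0 (1 - (cmod (z - w))\<^sup>2 / d\<^sup>2)" for z
  have [measurable]: "f \<in> borel_measurable borel" unfolding f_def by measurable
  have ball: "emeasure lborel {z. s < f z} = indicator {0<..<1} s * ennreal (pi * d\<^sup>2 * (1 - s))" if "0 < s" for s
  proof (cases "s < 1")
    case True
    have iff: "s < f z \<longleftrightarrow> z \<in> ball w (d * sqrt (1 - s))" for z
    proof -
      have "s < f z \<longleftrightarrow> s < 1 - (cmod (z - w))\<^sup>2 / d\<^sup>2" using that by (auto simp: f_def)
      also have "\<dots> \<longleftrightarrow> (cmod (z - w))\<^sup>2 < (d * sqrt (1 - s))\<^sup>2"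
        using True d by (simp add: power_mult_distrib field_simps)
      also have "\<dots> \<longleftrightarrow> cmod (z - w) < d * sqrt (1 - s)"
        using True d by (intro power2_less_iff_nonneg) auto
      finally show ?thesis by (simp add: dist_norm norm_minus_commute)
    qed
    have "{z. s < f z} = ball w (d * sqrt (1 - s))"
      by (rule set_eqI) (simp only: mem_Collect_eq iff)
    then show ?thesis using True that d
      by (simp add: emeasure_ball unit_ball_vol_2 power_mult_distrib mult.assoc)
  next
    case False
    have "f z \<le> 1" for z by (simp add: f_def)
    then have "{z. s < f z} = {}" using False by (force simp: not_less intro: order_trans)
    then show ?thesis using False by simp
  qed
  have "(\<integral>\<^sup>+z. ennreal (f z) \<partial>lborel) = (\<integral>\<^sup>+z. (\<integral>\<^sup>+s. indicator {0<..<f z} s \<partial>lborel) \<partial>lborel)"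
    by (intro nn_integral_cong) (simp add: f_def)
  also have "\<dots> = (\<integral>\<^sup>+z. (\<integral>\<^sup>+s. (if 0 < s \<and> s < f z then 1 else 0) \<partial>lborel) \<partial>lborel)"
    by (intro nn_integral_cong) (auto simp: indicator_def)
  also have "\<dots> = (\<integral>\<^sup>+s. (\<integral>\<^sup>+z. (if 0 < s \<and> s < f z then 1 else 0) \<partial>lborel) \<partial>lborel)"
    by (rule lborel_pair.Fubini') measurable
  also have "\<dots> = (\<integral>\<^sup>+s. ennreal (pi * d\<^sup>2 * (1 - s)) * indicator {0..1} s \<partial>lborel)"
  proof (rule nn_integral_cong_AE)
    show "AE s in lborel. (\<integral>\<^sup>+z. (if 0 < s \<and> s < f z then 1 else 0) \<partial>lborel) =
      ennreal (pi * d\<^sup>2 * (1 - s)) * indicator {0..1} s"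
      using AE_lborel_singleton[of 0] AE_lborel_singleton[of 1]
    proof eventually_elim
      case (elim s)
      show ?case
      proof (cases "0 < s")
        case True
        have "(\<integral>\<^sup>+z. (if 0 < s \<and> s < f z then 1 else 0) \<partial>lborel) = (\<integral>\<^sup>+z. indicator {z. s < f z} z \<partial>lborel)"
          using True by (intro nn_integral_cong) (auto simp: indicator_def)
        also have "\<dots> = emeasure lborel {z. s < f z}" by (rule nn_integral_indicator) measurable
        finally show ?thesis using ball[OF True] elim True by (auto simp: indicator_def mult.commute)
      qed (use elim in auto)
    qed
  qed
  also have "\<dots> = ennreal (pi * d\<^sup>2 * (1 - 1\<^sup>2 / 2) - pi * d\<^sup>2 * (0 - 0\<^sup>2 / 2))"
    by (rule nn_integral_FTC_Icc[where F = "\<lambda>s. pi * d\<^sup>2 * (s - s\<^sup>2 / 2)"])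
       (auto intro!: derivative_eq_intros simp: algebra_simps mult_left_le_one_le)
  finally have nn: "(\<integral>\<^sup>+z. ennreal (f z) \<partial>lborel) = ennreal (pi * d\<^sup>2 / 2)" by simp
  have hb: "has_bochner_integral lborel f (pi * d\<^sup>2 / 2)"
    by (rule has_bochner_integral_nn_integral[OF _ _ _ nn]) (auto simp: f_def)
  have "integrable lborel f" "(LINT z|lborel. f z) = pi * d\<^sup>2 / 2"
    using hb has_bochner_integral_integral_eq[OF hb] by (auto simp: integrable.simps)
  then show "integrable lborel (\<lambda>z. max 0 (1 - (cmod (z - w))\<^sup>2 / d\<^sup>2))"
    "(LINT z|lborel. max 0 (1 - (cmod (z - w))\<^sup>2 / d\<^sup>2)) = pi * d\<^sup>2 / 2"
    unfolding f_def[abs_def] .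
qed

section \<open>Logarithmic asymptotics of distributional solutions\<close>

lemma doubly_periodic_laplacian:
  assumes "doubly_periodic \<tau> f"
  shows "doubly_periodic \<tau> (laplacian f)"
proof -
  have "dir_deriv v g (z + l) = dir_deriv v g z"
    if "\<And>z. g (z + l) = g z" for g :: "complex \<Rightarrow> real" and v z l
  proof -
    have "g (z + l + x) = g (z + x)" for x using that[of "z + x"] by (simp add: algebra_simps)
    then show ?thesis by (simp add: dir_deriv_def)
  qed
  then show ?thesis using assms by (simp add: doubly_periodic_def laplacian_def)
qed

lemma continuous_on_laplacian: "C2 f \<Longrightarrow> continuous_on UNIV (laplacian f)"
  unfolding laplacian_def[abs_def] by (intro continuous_intros) (auto simp: C2_def C1_def)

lemma continuous_on_C2: "C2 f \<Longrightarrow> continuous_on UNIV f"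
  unfolding C2_def C1_def
  by (auto simp: continuous_on_eq_continuous_at intro: differentiable_imp_continuous_within)

lemma set_integrable_mult_continuous:
  fixes f g :: "complex \<Rightarrow> real"
  assumes f: "set_integrable lborel A f" and g: "continuous_on UNIV g" and A: "bounded A"
  shows "set_integrable lborel A (\<lambda>z. f z * g z)"
proof -
  have "compact (g ` closure A)"
    using A g by (intro compact_continuous_image) (auto intro: continuous_on_subset)
  then obtain B where B: "\<And>z. z \<in> closure A \<Longrightarrow> \<bar>g z\<bar> \<le> B"
    using compact_imp_bounded by (fastforce simp: bounded_iff)
  have gm: "g \<in> borel_measurable borel" using g by (rule borel_measurable_continuous_onI)
  have "integrable lborel (\<lambda>z. B * (indicator A z *\<^sub>R f z))"
    using f unfolding set_integrable_def by simp
  moreover have "(\<lambda>z. indicator A z *\<^sub>R (f z * g z)) = (\<lambda>z. (indicator A z *\<^sub>R f z) * g z)" by auto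
  then have "(\<lambda>z. indicator A z *\<^sub>R (f z * g z)) \<in> borel_measurable lborel"
    using borel_measurable_times[OF borel_measurable_integrable[OF f[unfolded set_integrable_def]], of g] gm
    by simp
  moreover have "AE z in lborel. norm (indicator A z *\<^sub>R (f z * g z)) \<le> norm (B * (indicator A z *\<^sub>R f z))"
  proof (rule AE_I2)
    fix z
    show "norm (indicator A z *\<^sub>R (f z * g z)) \<le> norm (B * (indicator A z *\<^sub>R f z))"
    proof (cases "z \<in> A")
      case True
      then have "\<bar>g z\<bar> \<le> B" using B closure_subset by blast
      then have "\<bar>g z\<bar> \<le> \<bar>B\<bar>" by linarith
      then show ?thesis using True
        by (simp add: abs_mult mult.commute[of "\<bar>B\<bar>"] mult_left_mono)
    qed simp
  qed
  ultimately show ?thesis unfolding set_integrable_def by (rule Bochner_Integration.integrable_bound)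
qed

text \<open>
  Only the finitely many lattice points in a disc compete for the distance to \<open>x\<close>.
\<close>
lemma not_in_lattice_distance:
  assumes "Im \<tau> > 0" "x \<notin> lattice \<tau>"
  shows "\<exists>r>0. \<forall>l \<in> lattice \<tau>. r \<le> cmod (x - l)"
proof -
  define L where "L = {l \<in> lattice \<tau>. cmod l \<le> cmod x + 1}"
  define r where "r = Min (insert 1 ((\<lambda>l. cmod (x - l)) ` L))"
  have fin: "finite (insert 1 ((\<lambda>l. cmod (x - l)) ` L))"
    using finite_bounded_lattice[OF assms(1)] by (simp add: L_def)
  have "0 < cmod (x - l)" if "l \<in> L" for l using that assms(2) by (auto simp: L_def)
  then have "0 < r" using fin by (auto simp: r_def)
  moreover have "r \<le> cmod (x - l)" if "l \<in> lattice \<tau>" for l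
  proof (cases "l \<in> L")
    case True
    then show ?thesis unfolding r_def using fin by (intro Min_le) auto
  next
    case False
    then have "1 \<le> cmod (x - l)"
      using that norm_triangle_ineq2[of l x] by (simp add: L_def norm_minus_commute)
    moreover have "r \<le> 1" unfolding r_def using fin by (intro Min_le) auto
    ultimately show ?thesis by simp
  qed
  ultimately show ?thesis by blast
qed

lemma avoid_translates:
  assumes "Im \<tau> > 0" "finite Q"
  shows "\<exists>r>0. \<forall>q\<in>Q. q \<notin> lattice \<tau> \<longrightarrow> (\<forall>l \<in> lattice \<tau>. r \<le> cmod (q - l))"
  using assms(2)
proof (induction Q)
  case (insert q Q)
  then obtain r where r: "r > 0" "\<forall>q\<in>Q. q \<notin> lattice \<tau> \<longrightarrow> (\<forall>l \<in> lattice \<tau>. r \<le> cmod (q - l))" by blast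
  obtain r' where r': "r' > 0" "q \<notin> lattice \<tau> \<Longrightarrow> \<forall>l \<in> lattice \<tau>. r' \<le> cmod (q - l)"
    using not_in_lattice_distance[OF assms(1)] by (metis zero_less_one)
  show ?case
  proof (intro exI[of _ "min r r'"] conjI ballI impI)
    fix x l assume "x \<in> insert q Q" "x \<notin> lattice \<tau>" "l \<in> lattice \<tau>"
    then have "r \<le> cmod (x - l) \<or> r' \<le> cmod (x - l)" using r(2) r'(2) by blast
    then show "min r r' \<le> cmod (x - l)" by linarith
  qed (use r r' in simp)
qed (auto intro: exI[of _ 1])

text \<open>
  The Laplacian of the regularised logarithm centred at \<open>w\<close>.
\<close>
definition log_kernel :: "real \<Rightarrow> complex \<Rightarrow> complex \<Rightarrow> real" where
  "log_kernel d w z = 4 / d\<^sup>2 * max 0 (1 - (cmod (z - w))\<^sup>2 / d\<^sup>2)"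

lemma log_kernel_continuous: "continuous_on UNIV (log_kernel d w)"
  unfolding log_kernel_def by (cases "d = 0") (auto intro!: continuous_intros)

lemma log_kernel_nonneg: "0 \<le> log_kernel d w z"
  by (simp add: log_kernel_def)

lemma log_kernel_le: "log_kernel d w z \<le> 4 / d\<^sup>2"
  unfolding log_kernel_def by (intro mult_left_le) auto

lemma log_kernel_outside:
  assumes "d > 0" "d \<le> cmod (z - w)"
  shows "log_kernel d w z = 0"
proof -
  have "d\<^sup>2 \<le> (cmod (z - w))\<^sup>2" using assms by (intro power_mono) auto
  then show ?thesis using assms by (simp add: log_kernel_def field_simps)
qed

lemma log_kernel_integral:
  assumes "d > 0"
  shows "integrable lborel (log_kernel d w)" "(LINT z|lborel. log_kernel d w z) = 2 * pi"
  using integral_paraboloid[OF assms, of w] assms unfolding log_kernel_def[abs_def]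
  by (auto simp: field_simps)

text \<open>
  The kernels are nonnegative with total mass \<open>2\<pi>\<close> and concentrate at \<open>w\<close>, so they approximate
  \<open>2\<pi> \<delta>\<^sub>w\<close>. Continuity of \<open>U\<close> at \<open>w\<close> replaces the mean value property.
\<close>
lemma log_kernel_average_tendsto:
  fixes U :: "complex \<Rightarrow> real"
  assumes U: "set_integrable lborel (ball w r) U" and cont: "isCont U w" and r: "r > 0"
    and e: "e \<longlonglongrightarrow> 0" "\<And>n. e n > 0"
  shows "(\<lambda>n. LINT z:ball w r|lborel. U z * log_kernel (e n) w z) \<longlonglongrightarrow> 2 * pi * U w"
proof (rule LIMSEQ_I)
  fix s :: real assume s: "0 < s"
  define s' where "s' = s / (4 * pi)"
  have s': "s' > 0" using s by (simp add: s'_def)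
  obtain d where d: "d > 0" "\<And>z. cmod (z - w) < d \<Longrightarrow> \<bar>U z - U w\<bar> < s'"
    using cont s' unfolding continuous_at_eps_delta by (auto simp: dist_norm)
  have "\<forall>\<^sub>F n in sequentially. e n < min d r"
    using order_tendstoD(2)[OF e(1), of "min d r"] d(1) r by simp
  then obtain N where N: "\<And>n. n \<ge> N \<Longrightarrow> e n < min d r" by (auto simp: eventually_sequentially)
  show "\<exists>N. \<forall>n\<ge>N. norm ((LINT z:ball w r|lborel. U z * log_kernel (e n) w z) - 2 * pi * U w) < s"
  proof (intro exI allI impI)
    fix n assume "N \<le> n"
    then have en: "e n < d" "e n < r" using N[of n] by auto
    let ?K = "log_kernel (e n) w"
    have K: "integrable lborel ?K" "(LINT z|lborel. ?K z) = 2 * pi" using log_kernel_integral[OF e(2)] by auto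
    have "set_integrable lborel (ball w r) (\<lambda>z. U z * ?K z)"
      by (rule set_integrable_mult_continuous[OF U log_kernel_continuous]) simp
    moreover have eq: "indicator (ball w r) z *\<^sub>R (U z * ?K z) = U z * ?K z" for z
      using log_kernel_outside[OF e(2), of n z w] en
      by (cases "z \<in> ball w r") (auto simp: dist_norm norm_minus_commute)
    ultimately have UK: "integrable lborel (\<lambda>z. U z * ?K z)" unfolding set_integrable_def eq by simp
    have "(LINT z:ball w r|lborel. U z * ?K z) - 2 * pi * U w
      = (LINT z|lborel. U z * ?K z) - (LINT z|lborel. U w * ?K z)"
      unfolding set_lebesgue_integral_def eq using K by simp
    also have "\<dots> = (LINT z|lborel. U z * ?K z - U w * ?K z)"
      by (rule Bochner_Integration.integral_diff[symmetric]) (use UK K in auto)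
    also have "\<bar>\<dots>\<bar> \<le> (LINT z|lborel. \<bar>U z * ?K z - U w * ?K z\<bar>)"
      using integral_norm_bound[of lborel "\<lambda>z. U z * ?K z - U w * ?K z"] by simp
    also have "\<dots> \<le> (LINT z|lborel. s' * ?K z)"
    proof (rule integral_mono)
      show "integrable lborel (\<lambda>z. \<bar>U z * ?K z - U w * ?K z\<bar>)" using UK K by auto
      show "integrable lborel (\<lambda>z. s' * ?K z)" using K by simp
      fix z :: complex
      show "\<bar>U z * ?K z - U w * ?K z\<bar> \<le> s' * ?K z"
      proof (cases "cmod (z - w) < d")
        case True
        then have "\<bar>U z - U w\<bar> * \<bar>?K z\<bar> \<le> s' * ?K z"
          using d(2)[OF True] log_kernel_nonneg[of "e n" w z] by (simp add: mult_right_mono)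
        then show ?thesis by (simp add: abs_mult [symmetric] algebra_simps)
      next
        case False
        then have "?K z = 0" using en by (intro log_kernel_outside e) auto
        then show ?thesis by simp
      qed
    qed
    also have "\<dots> = s / 2" using K by (simp add: s'_def)
    also have "\<dots> < s" using s by simp
    finally show "norm ((LINT z:ball w r|lborel. U z * ?K z) - 2 * pi * U w) < s" by simp
  qed
qed

lemma log_profile_continuous:
  assumes "d > 0"
  shows "continuous_on UNIV (\<lambda>z::complex. log_profile d ((cmod (z - w))\<^sup>2))"
proof -
  have "continuous_on UNIV (log_profile d)"
    using log_profile_deriv[OF assms] by (auto simp: continuous_on_eq_continuous_at intro: DERIV_isCont)
  then show ?thesis by (rule continuous_on_compose2) (auto intro!: continuous_intros)
qed

lemma integral_log_profile_dyadic:
  fixes F :: "complex \<Rightarrow> real"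
  assumes d: "d > 0" and F: "set_integrable lborel (ball w r) F"
    and M: "AE z in lborel. z \<in> ball w r \<longrightarrow> \<bar>F z\<bar> \<le> M" and M0: "0 \<le> M"
  shows "\<bar>LINT z:ball w r|lborel. F z *
      (log_profile d ((cmod (z - w))\<^sup>2) - log_profile (d / 2 ^ n) ((cmod (z - w))\<^sup>2))\<bar> \<le> 4 * pi * M * d\<^sup>2"
proof -
  define P where "P z = log_profile d ((cmod (z - w))\<^sup>2) - log_profile (d / 2 ^ n) ((cmod (z - w))\<^sup>2)" for z
  have cont: "continuous_on UNIV P"
    unfolding P_def using d by (intro continuous_intros log_profile_continuous) auto
  have FP: "set_integrable lborel (ball w r) (\<lambda>z. F z * P z)"
    by (rule set_integrable_mult_continuous[OF F cont]) simp
  have Pb: "\<bar>P z\<bar> \<le> (\<Sum>j<n. 2 * indicator (ball w (d / 2 ^ j)) z)" for z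
  proof -
    have "\<bar>P z\<bar> \<le> (\<Sum>j<n. if (cmod (z - w))\<^sup>2 < (d / 2 ^ j)\<^sup>2 then 2 else 0)"
      unfolding P_def by (rule log_profile_dyadic[OF d]) simp
    also have "\<dots> = (\<Sum>j<n. 2 * indicator (ball w (d / 2 ^ j)) z)"
    proof (rule sum.cong[OF refl])
      fix j
      have iff: "(cmod (z - w))\<^sup>2 < (d / 2 ^ j)\<^sup>2 \<longleftrightarrow> cmod (z - w) < d / 2 ^ j"
        using d by (intro power2_less_iff_nonneg) auto
      show "(if (cmod (z - w))\<^sup>2 < (d / 2 ^ j)\<^sup>2 then 2 else (0::real)) = 2 * indicator (ball w (d / 2 ^ j)) z"
        unfolding iff by (simp add: indicator_def dist_norm norm_minus_commute)
    qed
    finally show ?thesis .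
  qed
  have pw: "(2 ^ j)\<^sup>2 = (4::real) ^ j" for j :: nat
    by (simp add: power2_eq_square flip: power_mult_distrib)
  have ind: "integrable lborel (\<lambda>z. indicator (ball w e) z :: real)"
    "0 < e \<Longrightarrow> (LINT z|lborel. indicator (ball w e) z :: real) = pi * e\<^sup>2" for e
    using emeasure_lborel_ball_finite[of w e] content_ball[of e w] by (auto simp: unit_ball_vol_2)
  have "\<bar>LINT z:ball w r|lborel. F z * P z\<bar> \<le> (LINT z|lborel. \<bar>indicator (ball w r) z *\<^sub>R (F z * P z)\<bar>)"
    unfolding set_lebesgue_integral_def using integral_norm_bound[of lborel "\<lambda>z. indicator (ball w r) z *\<^sub>R (F z * P z)"] by simp
  also have "\<dots> \<le> (LINT z|lborel. M * (\<Sum>j<n. 2 * indicator (ball w (d / 2 ^ j)) z))"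
  proof (rule integral_mono_AE)
    show "integrable lborel (\<lambda>z. \<bar>indicator (ball w r) z *\<^sub>R (F z * P z)\<bar>)"
      using FP unfolding set_integrable_def by (rule integrable_abs)
    show "integrable lborel (\<lambda>z. M * (\<Sum>j<n. 2 * indicator (ball w (d / 2 ^ j)) z))"
      using ind by (intro integrable_mult_right Bochner_Integration.integrable_sum) auto
    show "AE z in lborel. \<bar>indicator (ball w r) z *\<^sub>R (F z * P z)\<bar> \<le> M * (\<Sum>j<n. 2 * indicator (ball w (d / 2 ^ j)) z)"
      using M
    proof eventually_elim
      case (elim z)
      show ?case
      proof (cases "z \<in> ball w r")
        case True
        then have "\<bar>F z\<bar> * \<bar>P z\<bar> \<le> M * (\<Sum>j<n. 2 * indicator (ball w (d / 2 ^ j)) z)"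
          using elim Pb[of z] M0 by (intro mult_mono) auto
        then show ?thesis using True by (simp add: abs_mult)
      next
        case False
        then show ?thesis using M0 by (simp add: sum_nonneg)
      qed
    qed
  qed
  also have "\<dots> = M * (LINT z|lborel. (\<Sum>j<n. 2 * indicator (ball w (d / 2 ^ j)) z))"
    by (rule integral_mult_right_zero)
  also have "(LINT z|lborel. (\<Sum>j<n. 2 * indicator (ball w (d / 2 ^ j)) z :: real))
      = (\<Sum>j<n. LINT z|lborel. 2 * indicator (ball w (d / 2 ^ j)) z)"
    by (rule Bochner_Integration.integral_sum) (intro integrable_mult_right ind)
  also have "\<dots> = (\<Sum>j<n. 2 * (pi * (d / 2 ^ j)\<^sup>2))"
    by (intro sum.cong refl, subst integral_mult_right_zero, subst ind(2)) (use d in auto)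
  also have "(\<Sum>j<n. 2 * (pi * (d / 2 ^ j)\<^sup>2)) = (\<Sum>j<n. 2 * (pi * (d\<^sup>2 / 4 ^ j)))"
    using pw by (simp add: power_divide)
  also have "(\<Sum>j<n. 2 * (pi * (d\<^sup>2 / 4 ^ j))) = 2 * pi * d\<^sup>2 * (\<Sum>j<n. (1 / 4) ^ j)"
    by (simp add: sum_distrib_left power_divide mult_ac)
  also have "(\<Sum>j<n. (1 / 4 :: real) ^ j) = (1 - (1 / 4) ^ n) * (4 / 3)"
    by (subst sum_gp_strict) simp
  also have "M * (2 * pi * d\<^sup>2 * ((1 - (1 / 4) ^ n) * (4 / 3))) \<le> M * (2 * pi * d\<^sup>2 * 2)"
  proof (intro mult_left_mono)
    have "(0::real) \<le> (1 / 4) ^ n" by simp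
    then show "(1 - (1 / 4 :: real) ^ n) * (4 / 3) \<le> 2" by argo
  qed (use M0 in auto)
  finally show ?thesis unfolding P_def by (simp add: mult_ac)
qed

lemma small_ball_injective:
  assumes "Im \<tau> > 0" "2 * R \<le> min 1 (Im \<tau>)" "z \<in> ball v R" "l \<in> lattice \<tau>" "z + l \<in> ball v R"
  shows "l = 0"
proof (rule ccontr)
  assume "l \<noteq> 0"
  then have "min 1 (Im \<tau>) \<le> cmod l" using lattice_norm_ge[OF assms(1,4)] by simp
  moreover have "cmod l \<le> cmod (z + l - v) + cmod (z - v)"
    using norm_triangle_ineq4[of "z + l - v" "z - v"] by simp
  moreover have "cmod (z + l - v) < R" "cmod (z - v) < R"
    using assms(3,5) by (auto simp: dist_norm norm_minus_commute)
  ultimately show False using assms(2) by linarith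
qed

lemma periodize_mass:
  assumes tau: "Im \<tau> > 0" and d: "0 < d" "d \<le> min 1 (Im \<tau>) / 8"
    and supp: "\<And>t. d\<^sup>2 \<le> t \<Longrightarrow> \<Phi> t = 0"
    and avoid: "\<And>q c l. (q, c) \<in> set ps \<Longrightarrow> q - p \<notin> lattice \<tau> \<Longrightarrow> l \<in> lattice \<tau> \<Longrightarrow> 2 * d \<le> cmod (q - p - l)"
    and w: "cmod (w - p) < d"
  shows "(\<Sum>(q, c)\<leftarrow>ps. c * periodize \<tau> w d \<Phi> q) = mass_at \<tau> ps p * \<Phi> ((cmod (w - p))\<^sup>2)"
proof -
  have d4: "d \<le> min 1 (Im \<tau>) / 4" using d by linarith
  have "c * periodize \<tau> w d \<Phi> q = (if p - q \<in> lattice \<tau> then c else 0) * \<Phi> ((cmod (w - p))\<^sup>2)"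
    if qc: "(q, c) \<in> set ps" for q c
  proof (cases "q - p \<in> lattice \<tau>")
    case True
    have "q - w - (q - p) = p - w" by simp
    then have "periodize \<tau> w d \<Phi> q = \<Phi> ((cmod (p - w))\<^sup>2)"
      using periodize_near[OF tau d(1) d4 supp True, where z = q and w = w] w d by (simp add: norm_minus_commute)
    then show ?thesis using True lattice_diff_commute[of q p \<tau>] by (simp add: norm_minus_commute)
  next
    case False
    have "periodize \<tau> w d \<Phi> q = 0"
    proof (rule periodize_far[OF tau d(1) d4 supp])
      fix l assume l: "l \<in> lattice \<tau>"
      have "cmod (q - p - l) \<le> cmod (q - w - l) + cmod (w - p)"
        using norm_triangle_ineq[of "q - w - l" "w - p"] by (simp add: algebra_simps)
      then show "d \<le> cmod (q - w - l)" using avoid[OF qc False l] w by linarith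
    qed
    then show ?thesis using False lattice_diff_commute[of q p \<tau>] by simp
  qed
  then have "(\<Sum>(q, c)\<leftarrow>ps. c * periodize \<tau> w d \<Phi> q)
    = (\<Sum>(q, c)\<leftarrow>ps. (if p - q \<in> lattice \<tau> then c else 0) * \<Phi> ((cmod (w - p))\<^sup>2))"
    by (intro arg_cong[where f = sum_list] map_cong) auto
  also have "\<dots> = mass_at \<tau> ps p * \<Phi> ((cmod (w - p))\<^sup>2)"
    unfolding mass_at_def by (subst sum_list_mult_const[symmetric]) (simp add: case_prod_beta' if_distrib)
  finally show ?thesis .
qed

text \<open>
  The equation tested with the periodised difference of the regularised logarithms of radii \<open>d\<close>
  and \<open>e\<close> centred at \<open>w\<close>. The radius \<open>d\<close> is so small that the support of the test function, modulo
  the lattice, contains no other point mass than the one at \<open>p\<close>.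
\<close>
lemma distributional_test_identity:
  fixes U F :: "complex \<Rightarrow> real"
  assumes tau: "Im \<tau> > 0"
    and perU: "doubly_periodic \<tau> U" and perF: "doubly_periodic \<tau> F"
    and U: "set_integrable lborel (cell \<tau>) U" and F: "set_integrable lborel (cell \<tau>) F"
    and weak: "\<And>\<phi>. test_function \<tau> \<phi> \<Longrightarrow>
      (LINT z:cell \<tau>|lborel. U z * laplacian \<phi> z + F z * \<phi> z) = (\<Sum>(q, c)\<leftarrow>ps. c * \<phi> q)"
    and d: "0 < d" "d \<le> min 1 (Im \<tau>) / 8" and e: "0 < e" "e \<le> d"
    and avoid: "\<And>q c l. (q, c) \<in> set ps \<Longrightarrow> q - p \<notin> lattice \<tau> \<Longrightarrow> l \<in> lattice \<tau> \<Longrightarrow> 2 * d \<le> cmod (q - p - l)"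
    and w: "cmod (w - p) < d"
  shows "(LINT z:ball w (2 * d)|lborel. U z * log_kernel d w z)
       - (LINT z:ball w (2 * d)|lborel. U z * log_kernel e w z)
       + (LINT z:ball w (2 * d)|lborel. F z * (log_profile d ((cmod (z - w))\<^sup>2) - log_profile e ((cmod (z - w))\<^sup>2)))
       = mass_at \<tau> ps p * (log_profile d ((cmod (w - p))\<^sup>2) - log_profile e ((cmod (w - p))\<^sup>2))"
proof -
  define \<Phi> where "\<Phi> t = log_profile d t - log_profile e t" for t
  define \<Phi>' where "\<Phi>' t = log_profile' d t - log_profile' e t" for t
  define \<Phi>'' where "\<Phi>'' t = log_profile'' d t - log_profile'' e t" for t
  have d1: "(\<Phi> has_real_derivative \<Phi>' t) (at t)" for t
    unfolding \<Phi>_def \<Phi>'_def using d e by (intro DERIV_diff log_profile_deriv)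
  have d2: "(\<Phi>' has_real_derivative \<Phi>'' t) (at t)" for t
    unfolding \<Phi>'_def \<Phi>''_def using d e by (intro DERIV_diff log_profile'_deriv)
  have c2: "continuous_on UNIV \<Phi>''"
    unfolding \<Phi>''_def using d e by (intro continuous_on_diff continuous_on_log_profile'')
  have supp: "\<Phi> t = 0" if "d\<^sup>2 \<le> t" for t
  proof -
    have "e\<^sup>2 \<le> d\<^sup>2" using e by (intro power_mono) auto
    then have "e\<^sup>2 \<le> t" using that by linarith
    then show ?thesis using that d e by (simp add: \<Phi>_def log_profile_outer)
  qed
  have d4: "d \<le> min 1 (Im \<tau>) / 4" and d2': "2 * d < min 1 (Im \<tau>) / 2"
    using d tau by linarith+
  define \<phi> where "\<phi> = periodize \<tau> w d \<Phi>"
  define B where "B = ball w (2 * d)"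
  have test: "test_function \<tau> \<phi>" unfolding \<phi>_def
    by (rule periodize_test_function[OF tau d(1) d4 supp d1 d2 c2])
  then have per\<phi>: "doubly_periodic \<tau> \<phi>" and C2\<phi>: "C2 \<phi>" by (auto simp: test_function_def)
  define H where "H z = U z * laplacian \<phi> z + F z * \<phi> z" for z
  have perH: "doubly_periodic \<tau> H"
    using perU perF per\<phi> doubly_periodic_laplacian[OF per\<phi>] by (simp add: doubly_periodic_def H_def)
  have bcell: "bounded (cell \<tau>)" using cell_bounded by (auto simp: bounded_iff)
  have intH: "set_integrable lborel (cell \<tau>) H"
    unfolding H_def
    using set_integrable_mult_continuous[OF U continuous_on_laplacian[OF C2\<phi>] bcell]
      set_integrable_mult_continuous[OF F continuous_on_C2[OF C2\<phi>] bcell] by simp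
  have "2 * (2 * d) \<le> min 1 (Im \<tau>)" using d tau by linarith
  then have inj: "l = 0" if "z \<in> B" "l \<in> lattice \<tau>" "z + l \<in> B" for z l
    using small_ball_injective[OF tau] that unfolding B_def by blast
  have HB: "(LINT z:cell \<tau>|lborel. H z) = (LINT z:B|lborel. H z)"
  proof (rule doubly_periodic_integral_unfold(2)[OF tau perH intH])
    fix z assume Hz: "H z \<noteq> 0"
    show "\<exists>l\<in>lattice \<tau>. z + l \<in> B"
    proof (rule ccontr)
      assume *: "\<not> (\<exists>l\<in>lattice \<tau>. z + l \<in> B)"
      have far: "d < cmod (z - w - l)" if "l \<in> lattice \<tau>" for l
      proof -
        have "z + - l \<notin> B" using * that by blast
        then have "2 * d \<le> cmod (z - w - l)"
          by (simp add: B_def dist_norm norm_minus_commute algebra_simps)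
        then show ?thesis using d by linarith
      qed
      have "laplacian \<phi> z = 0" unfolding \<phi>_def
        by (rule laplacian_periodize_far[OF tau d(1) d4 supp d1 d2 c2 far])
      moreover have "\<phi> z = 0" unfolding \<phi>_def
        by (rule periodize_far[OF tau d(1) d4 supp]) (use far in \<open>auto intro: less_imp_le\<close>)
      ultimately show False using Hz by (simp add: H_def)
    qed
  qed (use inj in \<open>auto simp: B_def\<close>)
  have BU: "set_integrable lborel B U"
    by (rule doubly_periodic_integral_unfold(1)[OF tau perU U]) (use inj in \<open>auto simp: B_def\<close>)
  have BF: "set_integrable lborel B F"
    by (rule doubly_periodic_integral_unfold(1)[OF tau perF F]) (use inj in \<open>auto simp: B_def\<close>)
  have bB: "bounded B" by (simp add: B_def)
  note I1 = set_integrable_mult_continuous[OF BU log_kernel_continuous[of d w] bB]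
  note I2 = set_integrable_mult_continuous[OF BU log_kernel_continuous[of e w] bB]
  have I3: "set_integrable lborel B (\<lambda>z. F z * \<Phi> ((cmod (z - w))\<^sup>2))"
    unfolding \<Phi>_def using d e
    by (intro set_integrable_mult_continuous[OF BF _ bB] continuous_on_diff log_profile_continuous) auto
  have near: "H z = U z * log_kernel d w z - U z * log_kernel e w z + F z * \<Phi> ((cmod (z - w))\<^sup>2)" if "z \<in> B" for z
  proof -
    have z: "cmod (z - w) < min 1 (Im \<tau>) / 2"
      using that d2' by (simp add: B_def dist_norm norm_minus_commute)
    have "laplacian \<phi> z = 4 * ((cmod (z - w))\<^sup>2 * \<Phi>'' ((cmod (z - w))\<^sup>2) + \<Phi>' ((cmod (z - w))\<^sup>2))"
      unfolding \<phi>_def by (rule laplacian_periodize_near[OF tau d(1) d4 supp d1 d2 c2 z])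
    also have "\<dots> = log_kernel d w z - log_kernel e w z"
      unfolding \<Phi>'_def \<Phi>''_def log_kernel_def
      using log_profile_laplacian[OF d(1), of "(cmod (z - w))\<^sup>2"] log_profile_laplacian[OF e(1), of "(cmod (z - w))\<^sup>2"]
      by (simp add: algebra_simps)
    finally have "laplacian \<phi> z = log_kernel d w z - log_kernel e w z" .
    moreover have "\<phi> z = \<Phi> ((cmod (z - w))\<^sup>2)"
      using periodize_near[OF tau d(1) d4 supp lattice_0, where z = z and w = w] z by (simp add: \<phi>_def)
    ultimately show ?thesis by (simp only: H_def right_diff_distrib)
  qed
  have "(LINT z:B|lborel. H z)
    = (LINT z:B|lborel. (U z * log_kernel d w z - U z * log_kernel e w z) + F z * \<Phi> ((cmod (z - w))\<^sup>2))"
    by (rule set_lebesgue_integral_cong) (use near in \<open>auto simp: B_def\<close>)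
  also have "\<dots> = (LINT z:B|lborel. U z * log_kernel d w z) - (LINT z:B|lborel. U z * log_kernel e w z)
    + (LINT z:B|lborel. F z * \<Phi> ((cmod (z - w))\<^sup>2))"
    using I1 I2 I3 by (simp add: set_integral_add set_integral_diff)
  finally have "(LINT z:B|lborel. H z) = (LINT z:B|lborel. U z * log_kernel d w z) - (LINT z:B|lborel. U z * log_kernel e w z)
    + (LINT z:B|lborel. F z * \<Phi> ((cmod (z - w))\<^sup>2))" .
  moreover have "(LINT z:B|lborel. H z) = mass_at \<tau> ps p * \<Phi> ((cmod (w - p))\<^sup>2)"
    using weak[OF test] HB periodize_mass[OF tau d supp avoid w] by (simp add: H_def \<phi>_def)
  ultimately show ?thesis by (simp add: B_def \<Phi>_def)
qed

text \<open>
  In the test identity let the inner radius tend to \<open>0\<close> along \<open>d / 2\<^sup>n\<close>. The inner average tends to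
  \<open>2\<pi> U(w)\<close>; the outer average is bounded because \<open>U\<close> is integrable; the term with \<open>F\<close> is bounded
  uniformly in \<open>n\<close>; and the point mass at \<open>p\<close> sees the value of the test function there, which
  is \<open>- log |w - p|\<close> up to a bounded amount as soon as the inner radius is below \<open>|w - p|\<close>.
\<close>
theorem distributional_log_asymptotics:
  fixes U F :: "complex \<Rightarrow> real"
  assumes tau: "Im \<tau> > 0"
    and perU: "doubly_periodic \<tau> U" and perF: "doubly_periodic \<tau> F"
    and U: "set_integrable lborel (cell \<tau>) U" and F: "set_integrable lborel (cell \<tau>) F"
    and weak: "\<And>\<phi>. test_function \<tau> \<phi> \<Longrightarrow>
      (LINT z:cell \<tau>|lborel. U z * laplacian \<phi> z + F z * \<phi> z) = (\<Sum>(q, c)\<leftarrow>ps. c * \<phi> q)"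
    and cont: "\<forall>\<^sub>F z in at p. isCont U z"
    and bounded: "\<forall>\<^sub>F z in at p. \<bar>F z\<bar> \<le> M"
  shows "\<exists>C. \<forall>\<^sub>F w in at p. \<bar>2 * pi * U w - mass_at \<tau> ps p * ln (cmod (w - p))\<bar> \<le> C"
proof -
  obtain r where r: "r > 0" "\<And>z. z \<noteq> p \<Longrightarrow> cmod (z - p) < r \<Longrightarrow> isCont U z \<and> \<bar>F z\<bar> \<le> M"
    using eventually_conj[OF cont bounded] unfolding eventually_at by (auto simp: dist_norm)
  obtain r' where r': "r' > 0"
    "\<And>q l. q \<in> (\<lambda>(q, c). q - p) ` set ps \<Longrightarrow> q \<notin> lattice \<tau> \<Longrightarrow> l \<in> lattice \<tau> \<Longrightarrow> r' \<le> cmod (q - l)"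
    using avoid_translates[OF tau, of "(\<lambda>(q, c). q - p) ` set ps"] by auto
  \<comment> \<open>Three times \<open>d\<close> must fit into the punctured disc around \<open>p\<close>, since discs of radius \<open>2 d\<close> around points \<open>w\<close> with \<open>|w - p| < d\<close> occur.\<close>
  define d where "d = min (min 1 (Im \<tau>) / 8) (min (r' / 2) (r / 3))"
  have d: "0 < d" "d \<le> min 1 (Im \<tau>) / 8" "2 * d \<le> r'" "3 * d \<le> r"
    using tau r r' by (auto simp: d_def)
  have M0: "0 \<le> M"
  proof -
    have "p + of_real (r / 2) \<noteq> p" "cmod (p + of_real (r / 2) - p) < r" using r(1) by auto
    from r(2)[OF this] show ?thesis by linarith
  qed
  have avoid: "2 * d \<le> cmod (q - p - l)"
    if "(q, c) \<in> set ps" "q - p \<notin> lattice \<tau>" "l \<in> lattice \<tau>" for q c l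
    using r'(2)[of "q - p" l] that d(3) by force
  have "2 * (3 * d) \<le> min 1 (Im \<tau>)" using d tau by linarith
  then have inj: "l = 0" if "z \<in> ball v (3 * d)" "l \<in> lattice \<tau>" "z + l \<in> ball v (3 * d)" for z l v
    using small_ball_injective[OF tau] that by blast
  have U3: "set_integrable lborel (ball v (3 * d)) U" for v
    by (rule doubly_periodic_integral_unfold(1)[OF tau perU U]) (use inj in auto)
  have F3: "set_integrable lborel (ball v (3 * d)) F" for v
    by (rule doubly_periodic_integral_unfold(1)[OF tau perF F]) (use inj in auto)
  have U2: "set_integrable lborel (ball v (2 * d)) U" for v
    by (rule set_integrable_subset[OF U3[of v]]) (use d in auto)
  have F2: "set_integrable lborel (ball v (2 * d)) F" for v
    by (rule set_integrable_subset[OF F3[of v]]) (use d in auto)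
  define X where "X = 4 / d\<^sup>2 * (LINT z:ball p (3 * d)|lborel. \<bar>U z\<bar>)"
  define C where "C = X + 4 * pi * M * d\<^sup>2 + \<bar>mass_at \<tau> ps p\<bar> * (\<bar>ln d\<bar> + 1)"
  have main: "\<bar>2 * pi * U w - mass_at \<tau> ps p * ln (cmod (w - p))\<bar> \<le> C"
    if w: "w \<noteq> p" "cmod (w - p) < d" for w
  proof -
    have sub: "ball w (2 * d) \<subseteq> ball p (3 * d)"
    proof
      fix z assume "z \<in> ball w (2 * d)"
      then show "z \<in> ball p (3 * d)"
        using w norm_triangle_ineq[of "p - w" "w - z"] by (simp add: dist_norm norm_minus_commute)
    qed
    have sub': "isCont U z \<and> \<bar>F z\<bar> \<le> M" if "z \<in> ball w (2 * d)" "z \<noteq> p" for z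
      using r(2)[of z] that sub d by (force simp: dist_norm norm_minus_commute)
    define T where "T n = (LINT z:ball w (2 * d)|lborel. U z * log_kernel (d / 2 ^ n) w z)" for n
    define Y where "Y n = (LINT z:ball w (2 * d)|lborel. F z *
      (log_profile d ((cmod (z - w))\<^sup>2) - log_profile (d / 2 ^ n) ((cmod (z - w))\<^sup>2)))" for n
    have T0: "\<bar>T 0\<bar> \<le> X"
    proof -
      have "\<bar>T 0\<bar> \<le> (LINT z|lborel. \<bar>indicator (ball w (2 * d)) z *\<^sub>R (U z * log_kernel d w z)\<bar>)"
        unfolding T_def set_lebesgue_integral_def
        using integral_norm_bound[of lborel "\<lambda>z. indicator (ball w (2 * d)) z *\<^sub>R (U z * log_kernel d w z)"] by simp
      also have "\<dots> \<le> (LINT z|lborel. 4 / d\<^sup>2 * (indicator (ball p (3 * d)) z *\<^sub>R \<bar>U z\<bar>))"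
      proof (rule integral_mono)
        show "integrable lborel (\<lambda>z. \<bar>indicator (ball w (2 * d)) z *\<^sub>R (U z * log_kernel d w z)\<bar>)"
          using set_integrable_mult_continuous[OF U2 log_kernel_continuous]
          unfolding set_integrable_def by (intro integrable_abs) auto
        show "integrable lborel (\<lambda>z. 4 / d\<^sup>2 * (indicator (ball p (3 * d)) z *\<^sub>R \<bar>U z\<bar>))"
          using set_integrable_abs[OF U3] unfolding set_integrable_def by (intro integrable_mult_right)
        fix z
        show "\<bar>indicator (ball w (2 * d)) z *\<^sub>R (U z * log_kernel d w z)\<bar>
          \<le> 4 / d\<^sup>2 * (indicator (ball p (3 * d)) z *\<^sub>R \<bar>U z\<bar>)"
        proof (cases "z \<in> ball w (2 * d)")
          case True
          then have "z \<in> ball p (3 * d)" using sub by blast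
          moreover have "\<bar>U z\<bar> * log_kernel d w z \<le> \<bar>U z\<bar> * (4 / d\<^sup>2)"
            by (intro mult_left_mono log_kernel_le) simp
          ultimately show ?thesis using True log_kernel_nonneg[of d w z]
            by (simp add: abs_mult mult.commute del: mem_ball)
        qed simp
      qed
      also have "\<dots> = X" by (simp add: X_def set_lebesgue_integral_def)
      finally show ?thesis .
    qed
    have Yb: "\<bar>Y n\<bar> \<le> 4 * pi * M * d\<^sup>2" for n
      unfolding Y_def
    proof (rule integral_log_profile_dyadic[OF d(1) F2 _ M0])
      show "AE z in lborel. z \<in> ball w (2 * d) \<longrightarrow> \<bar>F z\<bar> \<le> M"
        using AE_lborel_singleton[of p] by eventually_elim (use sub' in blast)
    qed
    have id: "T 0 - T n + Y n = mass_at \<tau> ps p *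
        (log_profile d ((cmod (w - p))\<^sup>2) - log_profile (d / 2 ^ n) ((cmod (w - p))\<^sup>2))" for n
      using distributional_test_identity[OF tau perU perF U F weak d(1,2) _ _ avoid w(2), of "d / 2 ^ n"] d(1)
      by (simp add: T_def Y_def field_simps)
    have e0: "(\<lambda>n. d / 2 ^ n) \<longlonglongrightarrow> 0"
      by (rule LIMSEQ_divide_realpow_zero) simp
    have Tlim: "T \<longlonglongrightarrow> 2 * pi * U w"
      unfolding T_def
      by (rule log_kernel_average_tendsto[OF U2]) (use sub'[of w] w d e0 in auto)
    have ld: "\<bar>log_profile d ((cmod (w - p))\<^sup>2)\<bar> \<le> \<bar>ln d\<bar> + 1"
    proof -
      have "(cmod (w - p))\<^sup>2 \<le> d\<^sup>2" using w by (intro power_mono) auto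
      then show ?thesis using log_profile_inner_bounds[OF d(1), of "(cmod (w - p))\<^sup>2"] by auto
    qed
    have "\<forall>\<^sub>F n in sequentially. d / 2 ^ n < cmod (w - p)"
      using order_tendstoD(2)[OF e0, of "cmod (w - p)"] w by simp
    then have "\<forall>\<^sub>F n in sequentially. \<bar>T n - mass_at \<tau> ps p * ln (cmod (w - p))\<bar> \<le> C"
    proof eventually_elim
      case (elim n)
      have "(d / 2 ^ n)\<^sup>2 \<le> (cmod (w - p))\<^sup>2" using elim d by (intro power_mono) auto
      then have lo: "log_profile (d / 2 ^ n) ((cmod (w - p))\<^sup>2) = ln (cmod (w - p))"
        using log_profile_outer[of "d / 2 ^ n" "(cmod (w - p))\<^sup>2"] d w by (simp add: ln_realpow)
      have "T n - mass_at \<tau> ps p * ln (cmod (w - p)) =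
          T 0 + Y n - mass_at \<tau> ps p * log_profile d ((cmod (w - p))\<^sup>2)"
        using id[of n] unfolding lo by (simp add: algebra_simps)
      also have "\<bar>\<dots>\<bar> \<le> \<bar>T 0\<bar> + \<bar>Y n\<bar> + \<bar>mass_at \<tau> ps p * log_profile d ((cmod (w - p))\<^sup>2)\<bar>"
        by linarith
      also have "\<bar>mass_at \<tau> ps p * log_profile d ((cmod (w - p))\<^sup>2)\<bar> \<le> \<bar>mass_at \<tau> ps p\<bar> * (\<bar>ln d\<bar> + 1)"
        unfolding abs_mult by (rule mult_left_mono[OF ld]) simp
      finally show ?case using T0 Yb[of n] by (simp add: C_def)
    qed
    moreover have "(\<lambda>n. \<bar>T n - mass_at \<tau> ps p * ln (cmod (w - p))\<bar>)
        \<longlonglongrightarrow> \<bar>2 * pi * U w - mass_at \<tau> ps p * ln (cmod (w - p))\<bar>"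
      by (intro tendsto_intros Tlim)
    ultimately show ?thesis by (intro tendsto_upperbound) auto
  qed
  show ?thesis
    by (rule exI[of _ C]) (use main d(1) in \<open>auto simp: eventually_at dist_norm intro!: exI[of _ d]\<close>)
qed

section \<open>Elliptic functions with few poles\<close>

lemma tendsto_imp_not_pole:
  fixes f :: "complex \<Rightarrow> complex"
  assumes "f \<midarrow>z\<rightarrow> l"
  shows "\<not> is_pole f z"
  using not_tendsto_and_filterlim_at_infinity[of "at z" f l] assms at_neq_bot[of z]
  unfolding is_pole_def by blast

lemma nicely_meromorphic_not_pole:
  assumes "h nicely_meromorphic_on UNIV" "h z \<noteq> 0"
  shows "\<not> is_pole h z"
proof -
  have "is_pole h z \<and> h z = 0 \<or> h \<midarrow>z\<rightarrow> h z"
    using assms(1) by (simp add: nicely_meromorphic_on_def)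
  then have "h \<midarrow>z\<rightarrow> h z" using assms(2) by simp
  then show ?thesis by (rule tendsto_imp_not_pole)
qed

lemma analytic_imp_has_deriv: "h analytic_on {z} \<Longrightarrow> (h has_field_derivative deriv h z) (at z)"
  using analytic_on_imp_differentiable_at[of h "{z}" z] by (simp add: DERIV_deriv_iff_field_differentiable)

lemma doubly_periodic_tendsto_shift:
  fixes F :: "complex \<Rightarrow> 'a::topological_space"
  assumes "doubly_periodic \<tau> F" "l \<in> lattice \<tau>" "F \<midarrow>z\<rightarrow> c"
  shows "F \<midarrow>z + l\<rightarrow> c"
  using LIM_offset[OF assms(3), of "- l"] doubly_periodic_lattice_diff[OF assms(1,2)] by simp

lemma doubly_periodic_tendsto_lattice:
  fixes F :: "complex \<Rightarrow> 'a::topological_space"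
  assumes "doubly_periodic \<tau> F" "z - w \<in> lattice \<tau>" "F \<midarrow>w\<rightarrow> c"
  shows "F \<midarrow>z\<rightarrow> c"
  using doubly_periodic_tendsto_shift[OF assms] by simp

lemma meromorphic_limits_imp_entire:
  assumes "F meromorphic_on UNIV" and lim: "\<And>z. \<exists>l. F \<midarrow>z\<rightarrow> l"
  shows "remove_sings F holomorphic_on UNIV" "F \<midarrow>z\<rightarrow> remove_sings F z"
proof -
  have "\<not> is_pole (remove_sings F) z" for z
  proof -
    obtain l where "F \<midarrow>z\<rightarrow> l" using lim by blast
    then have "remove_sings F \<midarrow>z\<rightarrow> l"
      using tendsto_remove_sings_iff meromorphic_on_isolated_singularity assms(1) meromorphic_on_subset
      by (metis UNIV_I meromorphic_onE)
    then show ?thesis by (rule tendsto_imp_not_pole)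
  qed
  then show "remove_sings F holomorphic_on UNIV"
    using nicely_meromorphic_without_singularities[OF remove_sings_nicely_meromorphic[OF assms(1)]]
    by (auto intro: analytic_imp_holomorphic)
  show "F \<midarrow>z\<rightarrow> remove_sings F z"
    using lim[of z] remove_sings_eqI by metis
qed

text \<open>
  Liouville's theorem. Periodicity is required of the modulus only, which makes the lemma
  applicable to functions with unimodular multipliers such as \<open>f / h\<^sup>2\<close> and \<open>h(z) h(-z)\<close>.
\<close>
lemma elliptic_without_poles_constant:
  assumes tau: "Im \<tau> > 0" and F: "F meromorphic_on UNIV" and lim: "\<And>z. \<exists>l. F \<midarrow>z\<rightarrow> l"
    and per: "doubly_periodic \<tau> (\<lambda>z. cmod (F z))"
  shows "\<exists>C. \<forall>z. F \<midarrow>z\<rightarrow> C"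
proof -
  define R where "R = remove_sings F"
  have hol: "R holomorphic_on UNIV" and FR: "\<And>z. F \<midarrow>z\<rightarrow> R z"
    using meromorphic_limits_imp_entire[OF F lim] by (auto simp: R_def)
  have perR: "cmod (R (z + l)) = cmod (R z)" if "l \<in> lattice \<tau>" for z l
  proof -
    have "(\<lambda>z. cmod (F z)) \<midarrow>z + l\<rightarrow> cmod (R z)"
      by (rule doubly_periodic_tendsto_shift[OF per that tendsto_norm[OF FR]])
    moreover have "(\<lambda>z. cmod (F z)) \<midarrow>z + l\<rightarrow> cmod (R (z + l))" by (rule tendsto_norm[OF FR])
    ultimately show ?thesis using LIM_unique by blast
  qed
  have "compact (R ` cball 0 (1 + cmod \<tau>))"
    using hol by (intro compact_continuous_image)
      (auto intro: holomorphic_on_imp_continuous_on holomorphic_on_subset)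
  then obtain B where B: "\<And>z. cmod z \<le> 1 + cmod \<tau> \<Longrightarrow> cmod (R z) \<le> B"
    using compact_imp_bounded by (fastforce simp: bounded_iff)
  have "cmod (R z) \<le> B" for z
  proof -
    obtain l where "l \<in> lattice \<tau>" "z - l \<in> cell \<tau>" using ex_cell_translate[OF tau] by blast
    then show ?thesis using perR[of l "z - l"] B[OF cell_bounded[of "z - l" \<tau>]] by simp
  qed
  then have "bounded (range R)" by (auto simp: bounded_iff)
  from Liouville_theorem[OF hol this] obtain C where "\<And>z. R z = C" by (auto simp: constant_on_def)
  then show ?thesis using FR by metis
qed

lemma small_not_in_lattice:
  assumes "Im \<tau> > 0"
  shows "of_real (min 1 (Im \<tau>) / 2) \<notin> lattice \<tau>"
proof
  assume "of_real (min 1 (Im \<tau>) / 2) \<in> lattice \<tau>"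
  then have "min 1 (Im \<tau>) \<le> cmod (of_real (min 1 (Im \<tau>) / 2))"
    by (rule lattice_norm_ge[OF assms]) (use assms in auto)
  then show False using assms by (simp add: min_def split: if_splits)
qed

text \<open>
  The contradictory hypothesis that an elliptic function has a single simple pole modulo the
  lattice. Such a \<open>G\<close> would be an isomorphism from the torus to the sphere, so each translation of
  the torus would become a Moebius transformation without fixed point. The derivation of the
  contradiction uses Liouville's theorem and the identity theorem, but no contour integrals.
\<close>
locale simple_pole_elliptic =
  fixes \<tau> :: complex and G :: "complex \<Rightarrow> complex" and L :: complex
  assumes tau: "Im \<tau> > 0" and G: "G nicely_meromorphic_on UNIV"
    and per: "doubly_periodic \<tau> G"
    and analytic: "\<And>z. z \<notin> lattice \<tau> \<Longrightarrow> G analytic_on {z}"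
    and simple: "(\<lambda>z. z * G z) \<midarrow>0\<rightarrow> L" and L: "L \<noteq> 0"
begin

lemma continuous: "z \<notin> lattice \<tau> \<Longrightarrow> isCont G z"
  using analytic analytic_at_imp_isCont by blast

lemma simple_lattice:
  assumes "l \<in> lattice \<tau>"
  shows "(\<lambda>z. (z - l) * G z) \<midarrow>l\<rightarrow> L"
  using LIM_offset[OF simple, of "- l"] doubly_periodic_lattice_diff[OF per assms] by simp

lemma pole:
  assumes "l \<in> lattice \<tau>"
  shows "filterlim G at_infinity (at l)"
proof -
  have "filterlim (\<lambda>z. (z - l) * G z / (z - l)) at_infinity (at l)"
    by (rule filterlim_divide_at_infinity[OF simple_lattice[OF assms] _ L])
       (auto intro!: filterlim_atI tendsto_eq_intros simp: eventually_at_filter)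
  then show ?thesis
    by (rule filterlim_mono_eventually) (auto simp: eventually_at_filter)
qed

lemma not_constant: "\<not> (\<exists>c. \<forall>z. G z = c)"
proof
  assume "\<exists>c. \<forall>z. G z = c"
  then have "G = (\<lambda>_. G 0)" by metis
  then have "filterlim (\<lambda>_. G 0) at_infinity (at (0::complex))" using pole[of 0] by simp
  then show False
    using not_tendsto_and_filterlim_at_infinity[of "at (0::complex)" "\<lambda>_. G 0" "G 0"] by simp
qed

text \<open>
  The poles of each factor are simple and are cancelled by the zeros of the other. If the constant
  were \<open>0\<close>, then \<open>G(z - p) = G(-p)\<close> near \<open>z = 0\<close>, where the first factor is large, and \<open>G\<close>
  would be constant.
\<close>
lemma shifted_product_constant:
  assumes p: "p \<notin> lattice \<tau>"
  shows "\<exists>C. C \<noteq> 0 \<and> (\<forall>z. z \<notin> lattice \<tau> \<longrightarrow> z - p \<notin> lattice \<tau> \<longrightarrow>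
    (G z - G p) * (G (z - p) - G (- p)) = C)"
proof -
  define F where "F z = (G z - G p) * (G (z - p) - G (- p))" for z
  have mp: "- p \<notin> lattice \<tau>" using p by simp
  have slope: "((\<lambda>z. (G z - G q) / (z - q)) \<longlongrightarrow> deriv G q) (at q)" if "q \<notin> lattice \<tau>" for q
    using analytic_imp_has_deriv[OF analytic[OF that]] by (simp add: has_field_derivative_iff)
  have Gm: "G meromorphic_on UNIV" using G by (simp add: nicely_meromorphic_on_def)
  have "(G \<circ> (\<lambda>z. z - p)) meromorphic_on UNIV"
    unfolding o_def by (rule meromorphic_on_compose[OF Gm]) (auto intro!: analytic_intros)
  then have Fm: "F meromorphic_on UNIV"
    unfolding F_def o_def using Gm by (intro meromorphic_intros)
  have cont: "F \<midarrow>z\<rightarrow> F z" if "z \<notin> lattice \<tau>" "z - p \<notin> lattice \<tau>" for z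
  proof -
    have "isCont (\<lambda>z. G (z - p)) z"
      using isCont_o2[of z "\<lambda>z. z - p" G] continuous[OF that(2)] by simp
    then have "isCont F z" unfolding F_def using continuous[OF that(1)] by (intro continuous_intros)
    then show ?thesis by (simp add: isCont_def)
  qed
  have lim: "\<exists>c. F \<midarrow>z0\<rightarrow> c" for z0
  proof -
    consider "z0 \<notin> lattice \<tau>" "z0 - p \<notin> lattice \<tau>" | "z0 \<in> lattice \<tau>" | "z0 - p \<in> lattice \<tau>" by blast
    then show ?thesis
    proof cases
      case 1
      then show ?thesis using cont by blast
    next
      case 2
      have G0: "G (z0 - p) = G (- p)" using doubly_periodic_lattice[OF per 2, of "- p"] by (simp add: add.commute)
      have "z0 - p \<notin> lattice \<tau>" using lattice_add_cancel[OF 2, of "- p"] mp by simp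
      from LIM_offset[OF slope[OF this], of "- p"]
      have A: "((\<lambda>z. (G (z - p) - G (- p)) / (z - z0)) \<longlongrightarrow> deriv G (z0 - p)) (at z0)"
        by (simp add: G0 diff_diff_eq2)
      have "((\<lambda>z. (z - z0) * G z - (z - z0) * G p) \<longlongrightarrow> L - (z0 - z0) * G p) (at z0)"
        by (intro tendsto_intros simple_lattice[OF 2])
      from tendsto_mult[OF this A]
      have "((\<lambda>z. ((z - z0) * G z - (z - z0) * G p) * ((G (z - p) - G (- p)) / (z - z0)))
        \<longlongrightarrow> L * deriv G (z0 - p)) (at z0)" by simp
      then have "F \<midarrow>z0\<rightarrow> L * deriv G (z0 - p)"
        by (rule Lim_transform_eventually) (auto simp: eventually_at_filter F_def field_simps)
      then show ?thesis by blast
    next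
      case 3
      have G0: "G z0 = G p" using doubly_periodic_lattice[OF per 3, of p] by simp
      have z0: "z0 \<notin> lattice \<tau>" using lattice_add_cancel[OF 3, of p] p by simp
      note A = slope[OF z0]
      have "((\<lambda>z. (z - z0) * G (z - p)) \<longlongrightarrow> L) (at z0)"
        using LIM_offset[OF simple_lattice[OF 3], of "- p"] by (simp add: diff_diff_eq2)
      then have "((\<lambda>z. (z - z0) * G (z - p) - (z - z0) * G (- p)) \<longlongrightarrow> L - (z0 - z0) * G (- p)) (at z0)"
        by (intro tendsto_intros)
      from tendsto_mult[OF A this]
      have "((\<lambda>z. ((G z - G z0) / (z - z0)) * ((z - z0) * G (z - p) - (z - z0) * G (- p)))
        \<longlongrightarrow> deriv G z0 * L) (at z0)" by simp
      then have "F \<midarrow>z0\<rightarrow> deriv G z0 * L"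
        by (rule Lim_transform_eventually) (auto simp: eventually_at_filter F_def G0 field_simps)
      then show ?thesis by blast
    qed
  qed
  have "doubly_periodic \<tau> (\<lambda>z. cmod (F z))"
    using per by (simp add: doubly_periodic_def F_def diff_add_eq[symmetric])
  from elliptic_without_poles_constant[OF tau Fm lim this] obtain C where C: "\<And>z. F \<midarrow>z\<rightarrow> C" by blast
  have FC: "F z = C" if "z \<notin> lattice \<tau>" "z - p \<notin> lattice \<tau>" for z
    using LIM_unique[OF cont[OF that] C] .
  have "C \<noteq> 0"
  proof
    assume C0: "C = 0"
    have "\<forall>\<^sub>F z in at 0. cmod (G p) + 1 \<le> cmod (G z)"
    proof -
      have "0 < cmod (G p) + 1" by (simp add: add_nonneg_pos)
      then show ?thesis using pole[of 0] unfolding filterlim_at_infinity[OF order_refl] by simp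
    qed
    moreover have "\<forall>\<^sub>F z in at 0. z \<notin> lattice \<tau>"
    proof -
      have "\<forall>\<^sub>F z in at (0::complex). z \<noteq> 0 \<and> cmod z < min 1 (Im \<tau>)"
        using tau by (auto simp: eventually_at dist_norm intro!: exI[of _ "min 1 (Im \<tau>)"])
      then show ?thesis
        by (rule eventually_mono) (use lattice_norm_ge[OF tau] not_le in meson)
    qed
    moreover have "\<forall>\<^sub>F z in at 0. z - p \<notin> lattice \<tau>"
    proof -
      obtain r where r: "r > 0" "\<And>l. l \<in> lattice \<tau> \<Longrightarrow> r \<le> cmod (- p - l)"
        using not_in_lattice_distance[OF tau mp] by blast
      have "z - p \<notin> lattice \<tau>" if "cmod z < r" for z using r(2)[of "z - p"] that by auto
      then show ?thesis using r(1) by (auto simp: eventually_at dist_norm intro!: exI[of _ r])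
    qed
    ultimately have "\<forall>\<^sub>F z in at 0. G (z - p) = G (- p)"
    proof eventually_elim
      case (elim z)
      then have "G z \<noteq> G p" by auto
      then show ?case using FC[of z] elim C0 by (simp add: F_def)
    qed
    then have "\<forall>\<^sub>F z in at (- p). G z = G (- p)"
      by (simp add: at_to_0[of "- p"] eventually_filtermap)
    then have "\<exists>\<^sub>F z in at (- p). G z = G (- p)"
      by (intro eventually_frequently) auto
    from frequently_eq_meromorphic_imp_constant[OF this G open_UNIV connected_UNIV UNIV_I UNIV_I] have "\<forall>z. G z = G (- p)" by simp
    then show False using not_constant by blast
  qed
  then show ?thesis using FC unfolding F_def by blast
qed

lemma injective_mod_lattice:
  assumes "p \<notin> lattice \<tau>" "z \<notin> lattice \<tau>" "G z = G p"
  shows "z - p \<in> lattice \<tau>"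
  using shifted_product_constant[OF assms(1)] assms by auto

text \<open>
  Otherwise \<open>1 / (G - w)\<close> is elliptic without poles, hence constant, and it tends to \<open>0\<close> at the
  poles of \<open>G\<close>.
\<close>
lemma attains_every_value: "\<exists>z. z \<notin> lattice \<tau> \<and> G z = w"
proof (rule ccontr)
  assume neg: "\<not> ?thesis"
  define E where "E z = 1 / (G z - w)" for z
  have "E meromorphic_on UNIV"
    unfolding E_def using G by (intro meromorphic_intros) (simp add: nicely_meromorphic_on_def)
  moreover have at_lat: "E \<midarrow>l\<rightarrow> 0" if "l \<in> lattice \<tau>" for l
  proof -
    have "filterlim (\<lambda>z. G z + (- w)) at_infinity (at l)"
      by (rule tendsto_add_filterlim_at_infinity'[OF pole[OF that] tendsto_const])
    then show ?thesis unfolding E_def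
      using tendsto_inverse_0 filterlim_compose[OF tendsto_inverse_0] by (simp add: divide_inverse)
  qed
  moreover have reg: "E \<midarrow>z\<rightarrow> E z" if "z \<notin> lattice \<tau>" for z
    using continuous[OF that] neg that unfolding E_def by (auto intro!: tendsto_intros simp: isCont_def)
  moreover have "doubly_periodic \<tau> (\<lambda>z. cmod (E z))"
    using per by (simp add: doubly_periodic_def E_def)
  ultimately obtain C where C: "\<And>z. E \<midarrow>z\<rightarrow> C"
    using elliptic_without_poles_constant[OF tau, of E] by blast
  have "C = 0" using LIM_unique[OF C at_lat[of 0]] by simp
  define p where "p = complex_of_real (min 1 (Im \<tau>) / 2)"
  have p: "p \<notin> lattice \<tau>" unfolding p_def by (rule small_not_in_lattice[OF tau])
  have "E p = 0" using LIM_unique[OF C reg[OF p]] \<open>C = 0\<close> by simp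
  then show False using neg p by (auto simp: E_def)
qed

text \<open>
  By the product formula, translation by \<open>-p\<close> acts on the values of \<open>G\<close> as the map
  \<open>w \<mapsto> B + C / (w - A)\<close>. A fixed point of this map is a root of \<open>(w - A) (w - B) = C\<close>; it is a value
  of \<open>G\<close>, and injectivity would make \<open>p\<close> a lattice point.
\<close>
lemma inconsistent: False
proof -
  define p where "p = complex_of_real (min 1 (Im \<tau>) / 2)"
  have p: "p \<notin> lattice \<tau>" unfolding p_def by (rule small_not_in_lattice[OF tau])
  obtain C where C: "C \<noteq> 0"
    "\<And>z. z \<notin> lattice \<tau> \<Longrightarrow> z - p \<notin> lattice \<tau> \<Longrightarrow> (G z - G p) * (G (z - p) - G (- p)) = C"
    using shifted_product_constant[OF p] by blast
  define A where "A = G p"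
  define B where "B = G (- p)"
  define w where "w = (A + B) / 2 + csqrt (((A - B) / 2)\<^sup>2 + C)"
  have w: "(w - A) * (w - B) = C"
  proof -
    have "(w - A) * (w - B) = (csqrt (((A - B) / 2)\<^sup>2 + C))\<^sup>2 - ((A - B) / 2)\<^sup>2"
      unfolding w_def by (simp add: field_simps power2_eq_square)
    then show ?thesis by simp
  qed
  obtain z where z: "z \<notin> lattice \<tau>" "G z = w" using attains_every_value by blast
  have zp: "z - p \<notin> lattice \<tau>"
  proof
    assume "z - p \<in> lattice \<tau>"
    then have "G z = G p" using doubly_periodic_lattice[OF per, of "z - p" p] by simp
    then show False using z w C(1) by (simp add: A_def)
  qed
  have "(w - A) * (G (z - p) - B) = (w - A) * (w - B)"
    using C(2)[OF z(1) zp] w z by (simp add: A_def B_def)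
  moreover have "w \<noteq> A" using w C(1) by auto
  ultimately have "G (z - p) = G z" using z by simp
  from injective_mod_lattice[OF z(1) zp this] show False using p by simp
qed

end

lemma elliptic_simple_pole_impossible:
  assumes tau: "Im \<tau> > 0" and g: "g meromorphic_on UNIV" and per: "doubly_periodic \<tau> g"
    and lim: "\<And>z. z \<notin> lattice \<tau> \<Longrightarrow> \<exists>l. g \<midarrow>z\<rightarrow> l"
    and simple: "(\<lambda>z. z * g z) \<midarrow>0\<rightarrow> L"
  shows "L = 0"
proof (rule ccontr)
  assume L: "L \<noteq> 0"
  define G where "G = remove_sings g"
  have iso: "isolated_singularity_at g z" for z
    using g meromorphic_on_isolated_singularity meromorphic_on_subset by blast
  have nice: "G nicely_meromorphic_on UNIV" unfolding G_def by (rule remove_sings_nicely_meromorphic[OF g])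
  have "G (z + l) = G z" if "\<And>z. g (z + l) = g z" for z l
  proof -
    have "remove_sings (g \<circ> (\<lambda>z. z + l)) z = remove_sings g (z + l)"
      by (rule remove_sings_compose) (simp add: filtermap_at_shift[of "- l" z, simplified])
    then show ?thesis using that by (simp add: G_def o_def)
  qed
  then have "doubly_periodic \<tau> G" using per by (simp add: doubly_periodic_def)
  moreover have "G analytic_on {z}" if z: "z \<notin> lattice \<tau>" for z
  proof (rule nicely_meromorphic_on_imp_analytic_at[OF nice])
    obtain c where "g \<midarrow>z\<rightarrow> c" using lim[OF z] by blast
    then have "G \<midarrow>z\<rightarrow> c" unfolding G_def using tendsto_remove_sings_iff[OF iso] by blast
    then show "\<not> is_pole G z" by (rule tendsto_imp_not_pole)
  qed simp
  moreover have "(\<lambda>z. z * G z) \<midarrow>0\<rightarrow> L"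
    by (rule Lim_transform_eventually[OF simple])
       (use eventually_remove_sings_eq_at[OF iso, of 0] in \<open>auto simp: G_def elim!: eventually_mono\<close>)
  ultimately interpret simple_pole_elliptic \<tau> G L
    by unfold_locales (use tau nice L in auto)
  show False by (rule inconsistent)
qed

text \<open>
  A meromorphic function tending to \<open>0\<close> extends analytically with a zero, so it may be divided by
  \<open>z - z\<^sub>0\<close>. Used twice, this lowers the order of a pole which is less than double.
\<close>
lemma meromorphic_vanishing_divide:
  assumes f: "f meromorphic_on {z0}" and lim: "f \<midarrow>z0\<rightarrow> 0"
  shows "\<exists>c. (\<lambda>z. f z / (z - z0)) \<midarrow>z0\<rightarrow> c"
proof -
  have iso: "isolated_singularity_at f z0" using f by (simp add: meromorphic_at_iff)
  define A where "A = (\<lambda>z. if z = z0 then 0 else f z)"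
  have "A analytic_on {z0}" unfolding A_def by (rule removable_singularity'[OF iso lim])
  then have "((\<lambda>z. (A z - A z0) / (z - z0)) \<longlongrightarrow> deriv A z0) (at z0)"
    using analytic_imp_has_deriv[of A z0] by (simp add: has_field_derivative_iff)
  then have "((\<lambda>z. f z / (z - z0)) \<longlongrightarrow> deriv A z0) (at z0)"
    by (rule Lim_transform_eventually) (auto simp: eventually_at_filter A_def)
  then show ?thesis by blast
qed

lemma elliptic_at_most_simple_pole_constant:
  assumes tau: "Im \<tau> > 0" and D: "D meromorphic_on UNIV" and per: "doubly_periodic \<tau> D"
    and lim: "\<And>z. z \<notin> lattice \<tau> \<Longrightarrow> \<exists>l. D \<midarrow>z\<rightarrow> l"
    and zero: "(\<lambda>z. z\<^sup>2 * D z) \<midarrow>0\<rightarrow> 0"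
  shows "\<exists>C. \<forall>z. D \<midarrow>z\<rightarrow> C"
proof -
  have D0: "D meromorphic_on {0}" using D meromorphic_on_subset by blast
  have "(\<lambda>z. z\<^sup>2 * D z) meromorphic_on {0}" using D0 by (intro meromorphic_intros)
  from meromorphic_vanishing_divide[OF this zero] obtain L where
    "(\<lambda>z. z\<^sup>2 * D z / (z - 0)) \<midarrow>0\<rightarrow> L" by blast
  then have simple: "(\<lambda>z. z * D z) \<midarrow>0\<rightarrow> L"
    by (rule Lim_transform_eventually) (auto simp: eventually_at_filter power2_eq_square)
  have L: "L = 0" by (rule elliptic_simple_pole_impossible[OF tau D per lim simple])
  have "(\<lambda>z. z * D z) meromorphic_on {0}" using D0 by (intro meromorphic_intros)
  from meromorphic_vanishing_divide[OF this simple[unfolded L]] obtain c where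
    "(\<lambda>z. z * D z / (z - 0)) \<midarrow>0\<rightarrow> c" by blast
  then have c: "D \<midarrow>0\<rightarrow> c"
    by (rule Lim_transform_eventually) (auto simp: eventually_at_filter)
  have "\<exists>l. D \<midarrow>z\<rightarrow> l" for z
    using lim[of z] doubly_periodic_tendsto_lattice[OF per, of z 0, OF _ c] by auto
  moreover have "doubly_periodic \<tau> (\<lambda>z. cmod (D z))" using per by (simp add: doubly_periodic_def)
  ultimately show ?thesis by (rule elliptic_without_poles_constant[OF tau D])
qed

text \<open>
  The combination in which the double poles cancel has at most a simple pole; it is therefore
  constant, and the common zero \<open>a\<close> shows that it vanishes.
\<close>
lemma elliptic_double_pole_proportional:
  assumes tau: "Im \<tau> > 0" and k: "k1 meromorphic_on UNIV" "k2 meromorphic_on UNIV"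
    and per: "doubly_periodic \<tau> k1" "doubly_periodic \<tau> k2"
    and lim: "\<And>z. z \<notin> lattice \<tau> \<Longrightarrow> \<exists>l. k1 \<midarrow>z\<rightarrow> l" "\<And>z. z \<notin> lattice \<tau> \<Longrightarrow> \<exists>l. k2 \<midarrow>z\<rightarrow> l"
    and lead: "(\<lambda>z. z\<^sup>2 * k1 z) \<midarrow>0\<rightarrow> \<alpha>1" "(\<lambda>z. z\<^sup>2 * k2 z) \<midarrow>0\<rightarrow> \<alpha>2"
    and zero: "k1 \<midarrow>a\<rightarrow> 0" "k2 \<midarrow>a\<rightarrow> 0"
  shows "\<forall>\<^sub>\<approx>z\<in>UNIV. \<alpha>2 * k1 z = \<alpha>1 * k2 z"
proof -
  define D where "D z = \<alpha>2 * k1 z - \<alpha>1 * k2 z" for z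
  have Dm: "D meromorphic_on UNIV" unfolding D_def using k by (intro meromorphic_intros)
  have "\<exists>C. \<forall>z. D \<midarrow>z\<rightarrow> C"
  proof (rule elliptic_at_most_simple_pole_constant[OF tau Dm])
    show "doubly_periodic \<tau> D" using per by (simp add: doubly_periodic_def D_def)
    show "\<exists>l. D \<midarrow>z\<rightarrow> l" if z: "z \<notin> lattice \<tau>" for z
    proof -
      obtain l1 l2 where "k1 \<midarrow>z\<rightarrow> l1" "k2 \<midarrow>z\<rightarrow> l2"
        using lim(1)[OF z] lim(2)[OF z] by blast
      then have "D \<midarrow>z\<rightarrow> \<alpha>2 * l1 - \<alpha>1 * l2" unfolding D_def by (intro tendsto_intros)
      then show ?thesis by blast
    qed
    have "(\<lambda>z. \<alpha>2 * (z\<^sup>2 * k1 z) - \<alpha>1 * (z\<^sup>2 * k2 z)) \<midarrow>0\<rightarrow> \<alpha>2 * \<alpha>1 - \<alpha>1 * \<alpha>2"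
      by (intro tendsto_intros lead)
    then show "(\<lambda>z. z\<^sup>2 * D z) \<midarrow>0\<rightarrow> 0" by (simp add: D_def algebra_simps)
  qed
  then obtain C where C: "\<And>z. D \<midarrow>z\<rightarrow> C" by blast
  have "D \<midarrow>a\<rightarrow> \<alpha>2 * 0 - \<alpha>1 * 0" unfolding D_def by (intro tendsto_intros zero)
  then have "C = 0" using LIM_unique[OF C] by simp
  then have "remove_sings D z = 0" for z using remove_sings_eqI[OF C] by simp
  then have "\<forall>\<^sub>\<approx>z\<in>UNIV. D z = 0" using eventually_remove_sings_eq[OF Dm] by (auto elim!: eventually_mono)
  then show ?thesis by (rule eventually_mono) (simp add: D_def)
qed

section \<open>Local form and spherical density of a meromorphic function\<close>

text \<open>
  Near \<open>p\<close> the function \<open>h\<close> takes the value \<open>c\<close> with multiplicity \<open>k\<close>. The factor \<open>g1\<close> of the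
  derivative is carried along because all that follows depends on \<open>h\<close> and \<open>h'\<close> together.
\<close>
definition branch_value ::
  "(complex \<Rightarrow> complex) \<Rightarrow> complex \<Rightarrow> nat \<Rightarrow> complex \<Rightarrow> (complex \<Rightarrow> complex) \<Rightarrow> (complex \<Rightarrow> complex) \<Rightarrow> bool" where
  "branch_value h p k c g g1 \<longleftrightarrow> 0 < k \<and> g \<midarrow>p\<rightarrow> g p \<and> g1 \<midarrow>p\<rightarrow> of_nat k * g p \<and> g p \<noteq> 0 \<and>
     (\<forall>\<^sub>F z in at p. h z = c + (z - p) ^ k * g z \<and> deriv h z = (z - p) ^ (k - 1) * g1 z)"

definition branch_pole ::
  "(complex \<Rightarrow> complex) \<Rightarrow> complex \<Rightarrow> nat \<Rightarrow> (complex \<Rightarrow> complex) \<Rightarrow> (complex \<Rightarrow> complex) \<Rightarrow> bool" where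
  "branch_pole h p k g g1 \<longleftrightarrow> 0 < k \<and> g \<midarrow>p\<rightarrow> g p \<and> g1 \<midarrow>p\<rightarrow> - (of_nat k * g p) \<and> g p \<noteq> 0 \<and>
     (\<forall>\<^sub>F z in at p. h z = g z / (z - p) ^ k \<and> deriv h z = g1 z / (z - p) ^ (k + 1))"

lemma branch_value_exists:
  assumes h: "h analytic_on {p}" and nc: "\<not> (\<forall>\<^sub>F z in at p. h z = h p)"
  shows "\<exists>k g g1. branch_value h p k (h p) g g1"
proof -
  obtain r where r: "r > 0" "h holomorphic_on ball p r" using h by (auto simp: analytic_on_def)
  define F where "F z = h z - h p" for z
  have F: "F holomorphic_on ball p r" unfolding F_def using r by (intro holomorphic_intros)
  have "\<exists>w\<in>ball p r. F w \<noteq> 0"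
  proof (rule ccontr)
    assume *: "\<not> ?thesis"
    have "\<forall>\<^sub>F z in at p. z \<in> ball p r" using r(1) by (intro eventually_at_in_open') auto
    then have "\<forall>\<^sub>F z in at p. h z = h p"
    proof (rule eventually_mono)
      fix z assume "z \<in> ball p r"
      then have "F z = 0" using * by blast
      then show "h z = h p" by (simp add: F_def)
    qed
    with nc show False by blast
  qed
  note ne = this
  have F0: "F p = 0" and pr: "p \<in> ball p r" using r(1) by (auto simp: F_def)
  from zorder_exist_zero[OF F open_ball connected_ball pr ne]
  have pos: "zorder F p > 0"
    and "\<exists>s>0. cball p s \<subseteq> ball p r \<and> zor_poly F p holomorphic_on cball p s \<and>
      (\<forall>w\<in>cball p s. F w = zor_poly F p w * (w - p) ^ nat (zorder F p) \<and> zor_poly F p w \<noteq> 0)"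
    using F0 by auto
  then obtain s where s0: "s > 0" "cball p s \<subseteq> ball p r" "zor_poly F p holomorphic_on cball p s"
    "\<forall>w\<in>cball p s. F w = zor_poly F p w * (w - p) ^ nat (zorder F p) \<and> zor_poly F p w \<noteq> 0"
    by blast
  have "p \<in> cball p s" using s0(1) by simp
  then have s: "zorder F p > 0" "s > 0" "cball p s \<subseteq> ball p r" "zor_poly F p holomorphic_on cball p s"
    "\<And>w. w \<in> cball p s \<Longrightarrow> F w = zor_poly F p w * (w - p) ^ nat (zorder F p)" "zor_poly F p p \<noteq> 0"
    using pos s0 by blast+
  define k where "k = nat (zorder F p)"
  define g where "g = zor_poly F p"
  define g1 where "g1 z = of_nat k * g z + (z - p) * deriv g z" for z
  have k: "0 < k" using s by (simp add: k_def)
  have gh: "g holomorphic_on ball p s"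
    using s(4) unfolding g_def by (rule holomorphic_on_subset) auto
  have eq: "h w = h p + (w - p) ^ k * g w" if "w \<in> ball p s" for w
    using s(5)[of w] that by (simp add: F_def k_def g_def algebra_simps)
  have der: "deriv h w = (w - p) ^ (k - 1) * g1 w" if w: "w \<in> ball p s" for w
  proof -
    have "(g has_field_derivative deriv g w) (at w)"
      using gh w by (intro holomorphic_derivI[of g "ball p s"]) auto
    then have "((\<lambda>w. h p + (w - p) ^ k * g w) has_field_derivative
        of_nat k * (w - p) ^ (k - 1) * g w + (w - p) ^ k * deriv g w) (at w)"
      by (auto intro!: derivative_eq_intros)
    moreover have "(w - p) ^ k = (w - p) ^ (k - 1) * (w - p)" using power_minus_mult[OF k, of "w - p"] by simp
    ultimately have "((\<lambda>w. h p + (w - p) ^ k * g w) has_field_derivative (w - p) ^ (k - 1) * g1 w) (at w)"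
      by (simp add: g1_def algebra_simps)
    then have "(h has_field_derivative (w - p) ^ (k - 1) * g1 w) (at w)"
      by (rule has_field_derivative_transform_within_open[of _ _ _ "ball p s"]) (use w eq in auto)
    then show ?thesis by (rule DERIV_imp_deriv)
  qed
  have pin: "p \<in> ball p s" using s(2) by simp
  have "continuous_on (ball p s) g" "continuous_on (ball p s) (deriv g)"
    using gh by (auto intro: holomorphic_on_imp_continuous_on holomorphic_deriv)
  then have c: "g \<midarrow>p\<rightarrow> g p" "deriv g \<midarrow>p\<rightarrow> deriv g p"
    using pin by (auto simp: continuous_on_eq_continuous_at isCont_def)
  have "g1 \<midarrow>p\<rightarrow> of_nat k * g p + (p - p) * deriv g p" unfolding g1_def by (intro tendsto_intros c)
  then have c1: "g1 \<midarrow>p\<rightarrow> of_nat k * g p" by simp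
  have "\<forall>\<^sub>F z in at p. z \<in> ball p s" using s(2) by (intro eventually_at_in_open') auto
  then have "\<forall>\<^sub>F z in at p. h z = h p + (z - p) ^ k * g z \<and> deriv h z = (z - p) ^ (k - 1) * g1 z"
    by eventually_elim (use eq der in blast)
  then show ?thesis using k c c1 s(6) unfolding branch_value_def g_def by blast
qed

lemma branch_pole_exists:
  assumes h: "h meromorphic_on {p}" and pole: "is_pole h p"
  shows "\<exists>k g g1. branch_pole h p k g g1"
proof -
  have "isolated_singularity_at h p" using h by (simp add: meromorphic_at_iff)
  then obtain r where r: "r > 0" "h analytic_on ball p r - {p}" by (auto simp: isolated_singularity_at_def)
  have hol: "h holomorphic_on ball p r - {p}" using r(2) by (rule analytic_imp_holomorphic)
  have pr: "p \<in> ball p r" using r(1) by simp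
  from zorder_exist_pole[OF hol open_ball pr pole]
  obtain s where s: "zorder h p < 0" "s > 0" "cball p s \<subseteq> ball p r" "zor_poly h p holomorphic_on cball p s"
    "\<And>w. w \<in> cball p s - {p} \<Longrightarrow> h w = zor_poly h p w / (w - p) ^ nat (- zorder h p)" "zor_poly h p p \<noteq> 0"
    by auto
  define k where "k = nat (- zorder h p)"
  define g where "g = zor_poly h p"
  define g1 where "g1 z = (z - p) * deriv g z - of_nat k * g z" for z
  have k: "0 < k" using s by (simp add: k_def)
  have gh: "g holomorphic_on ball p s"
    using s(4) unfolding g_def by (rule holomorphic_on_subset) auto
  have eq: "h w = g w / (w - p) ^ k" if "w \<in> ball p s - {p}" for w
    using s(5)[of w] that by (simp add: k_def g_def)
  have der: "deriv h w = g1 w / (w - p) ^ (k + 1)" if w: "w \<in> ball p s - {p}" for w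
  proof -
    have wp: "w - p \<noteq> 0" using w by auto
    have "(g has_field_derivative deriv g w) (at w)"
      using gh w by (intro holomorphic_derivI[of g "ball p s"]) auto
    then have "((\<lambda>w. g w / (w - p) ^ k) has_field_derivative
        (deriv g w * (w - p) ^ k - g w * (of_nat k * (w - p) ^ (k - 1))) / ((w - p) ^ k * (w - p) ^ k)) (at w)"
      using wp by (auto intro!: derivative_eq_intros)
    moreover have kk: "(w - p) ^ k = (w - p) ^ (k - 1) * (w - p)" using power_minus_mult[OF k, of "w - p"] by simp
    have "(deriv g w * (w - p) ^ k - g w * (of_nat k * (w - p) ^ (k - 1))) / ((w - p) ^ k * (w - p) ^ k)
      = g1 w / (w - p) ^ (k + 1)"
      using wp unfolding power_add kk by (simp add: g1_def divide_simps) (simp add: algebra_simps)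
    ultimately have "((\<lambda>w. g w / (w - p) ^ k) has_field_derivative g1 w / (w - p) ^ (k + 1)) (at w)"
      by simp
    then have "(h has_field_derivative g1 w / (w - p) ^ (k + 1)) (at w)"
      by (rule has_field_derivative_transform_within_open[of _ _ _ "ball p s - {p}"]) (use w eq in auto)
    then show ?thesis by (rule DERIV_imp_deriv)
  qed
  have pin: "p \<in> ball p s" using s(2) by simp
  have "continuous_on (ball p s) g" "continuous_on (ball p s) (deriv g)"
    using gh by (auto intro: holomorphic_on_imp_continuous_on holomorphic_deriv)
  then have c: "g \<midarrow>p\<rightarrow> g p" "deriv g \<midarrow>p\<rightarrow> deriv g p"
    using pin by (auto simp: continuous_on_eq_continuous_at isCont_def)
  have "g1 \<midarrow>p\<rightarrow> (p - p) * deriv g p - of_nat k * g p" unfolding g1_def by (intro tendsto_intros c)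
  then have c1: "g1 \<midarrow>p\<rightarrow> - (of_nat k * g p)" by simp
  have "\<forall>\<^sub>F z in at p. z \<in> ball p s - {p}" using s(2) by (intro eventually_at_in_open) auto
  then have "\<forall>\<^sub>F z in at p. h z = g z / (z - p) ^ k \<and> deriv h z = g1 z / (z - p) ^ (k + 1)"
    by eventually_elim (use eq der in blast)
  then show ?thesis using k c c1 s(6) unfolding branch_pole_def g_def by blast
qed

lemma branch_cases:
  assumes h: "h nicely_meromorphic_on UNIV" and nc: "\<not> (\<exists>c. \<forall>z. h z = c)"
  obtains k g g1 where "\<not> is_pole h p" "branch_value h p k (h p) g g1"
  | k g g1 where "is_pole h p" "branch_pole h p k g g1"
proof (cases "is_pole h p")
  case True
  have "h meromorphic_on {p}" using h meromorphic_on_subset by (auto simp: nicely_meromorphic_on_def)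
  from branch_pole_exists[OF this True] that(2) True show ?thesis by blast
next
  case False
  have an: "h analytic_on {p}" by (rule nicely_meromorphic_on_imp_analytic_at[OF h _ False]) simp
  have "\<not> (\<forall>\<^sub>F z in at p. h z = h p)"
  proof
    assume "\<forall>\<^sub>F z in at p. h z = h p"
    then have "\<exists>\<^sub>F z in at p. h z = h p" by (intro eventually_frequently) auto
    from frequently_eq_meromorphic_imp_constant[OF this h open_UNIV connected_UNIV UNIV_I UNIV_I] nc
    show False by blast
  qed
  from branch_value_exists[OF an this] that(1) False show ?thesis by blast
qed

definition spherical_density :: "(complex \<Rightarrow> complex) \<Rightarrow> real \<Rightarrow> complex \<Rightarrow> real" where
  "spherical_density h \<beta> z = 8 * exp (2 * \<beta>) * (cmod (deriv h z))\<^sup>2 / (1 + exp (2 * \<beta>) * (cmod (h z))\<^sup>2)\<^sup>2"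

text \<open>
  Positivity of the limit \<open>Q0\<close> makes the order exact and allows passing to logarithms.
\<close>
definition has_order :: "(complex \<Rightarrow> real) \<Rightarrow> complex \<Rightarrow> nat \<Rightarrow> bool" where
  "has_order D p n \<longleftrightarrow> (\<exists>Q Q0. 0 < Q0 \<and> (Q \<longlongrightarrow> Q0) (at p) \<and> (\<forall>\<^sub>F z in at p. D z = cmod (z - p) ^ n * Q z))"

lemma has_order_ln_bounds:
  assumes "has_order D p n"
  shows "\<exists>C. \<forall>\<^sub>F z in at p. 0 < D z \<and> \<bar>ln (D z) - real n * ln (cmod (z - p))\<bar> \<le> C"
proof -
  obtain Q Q0 where Q: "0 < Q0" "(Q \<longlongrightarrow> Q0) (at p)" "\<forall>\<^sub>F z in at p. D z = cmod (z - p) ^ n * Q z"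
    using assms unfolding has_order_def by blast
  have "((\<lambda>z. \<bar>ln (Q z)\<bar>) \<longlongrightarrow> \<bar>ln Q0\<bar>) (at p)" using Q by (intro tendsto_intros) auto
  then have "\<forall>\<^sub>F z in at p. \<bar>ln (Q z)\<bar> < \<bar>ln Q0\<bar> + 1" by (rule order_tendstoD) simp
  moreover have "\<forall>\<^sub>F z in at p. 0 < Q z" using order_tendstoD(1)[OF Q(2) Q(1)] .
  moreover have "\<forall>\<^sub>F z in at p. z \<noteq> p" by (simp add: eventually_at_filter)
  ultimately have "\<forall>\<^sub>F z in at p. 0 < D z \<and> \<bar>ln (D z) - real n * ln (cmod (z - p))\<bar> \<le> \<bar>ln Q0\<bar> + 1"
    using Q(3)
  proof eventually_elim
    case (elim z)
    then have pos: "0 < cmod (z - p) ^ n" by simp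
    have "ln (D z) = real n * ln (cmod (z - p)) + ln (Q z)"
      using elim pos by (simp add: ln_mult ln_realpow)
    then show ?case using elim pos by simp
  qed
  then show ?thesis by blast
qed

lemma has_order_bounded:
  assumes "has_order D p n"
  shows "\<exists>M. \<forall>\<^sub>F z in at p. \<bar>D z\<bar> \<le> M"
proof -
  obtain Q Q0 where Q: "(Q \<longlongrightarrow> Q0) (at p)" "\<forall>\<^sub>F z in at p. D z = cmod (z - p) ^ n * Q z"
    using assms unfolding has_order_def by blast
  have "((\<lambda>z. \<bar>cmod (z - p) ^ n * Q z\<bar>) \<longlongrightarrow> \<bar>cmod (p - p) ^ n * Q0\<bar>) (at p)"
    by (intro tendsto_intros Q)
  then have "\<forall>\<^sub>F z in at p. \<bar>cmod (z - p) ^ n * Q z\<bar> < \<bar>cmod (p - p) ^ n * Q0\<bar> + 1"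
    by (rule order_tendstoD) simp
  with Q(2) have "\<forall>\<^sub>F z in at p. \<bar>D z\<bar> \<le> \<bar>cmod (p - p) ^ n * Q0\<bar> + 1"
    by eventually_elim simp
  then show ?thesis by blast
qed

lemma branch_value_deriv_order:
  assumes "branch_value h p k c g g1"
  shows "has_order (\<lambda>z. 8 * (cmod (deriv h z))\<^sup>2) p (2 * (k - 1))"
proof -
  have g1: "g1 \<midarrow>p\<rightarrow> of_nat k * g p" and nz: "0 < k" "g p \<noteq> 0"
    and ev: "\<forall>\<^sub>F z in at p. h z = c + (z - p) ^ k * g z \<and> deriv h z = (z - p) ^ (k - 1) * g1 z"
    using assms by (auto simp: branch_value_def)
  have "((\<lambda>z. 8 * (cmod (g1 z))\<^sup>2) \<longlongrightarrow> 8 * (cmod (of_nat k * g p))\<^sup>2) (at p)"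
    by (intro tendsto_intros g1)
  moreover from ev have "\<forall>\<^sub>F z in at p. 8 * (cmod (deriv h z))\<^sup>2 = cmod (z - p) ^ (2 * (k - 1)) * (8 * (cmod (g1 z))\<^sup>2)"
    by eventually_elim (simp add: norm_mult norm_power power_mult_distrib power_even_eq)
  moreover have "0 < 8 * (cmod (of_nat k * g p))\<^sup>2" using nz by simp
  ultimately show ?thesis unfolding has_order_def by blast
qed

lemma branch_value_limit:
  assumes "branch_value h p k c g g1"
  shows "h \<midarrow>p\<rightarrow> c"
proof -
  have g: "g \<midarrow>p\<rightarrow> g p" and nz: "0 < k"
    and ev: "\<forall>\<^sub>F z in at p. h z = c + (z - p) ^ k * g z \<and> deriv h z = (z - p) ^ (k - 1) * g1 z"
    using assms by (auto simp: branch_value_def)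
  have "(\<lambda>z. c + (z - p) ^ k * g z) \<midarrow>p\<rightarrow> c + (p - p) ^ k * g p" by (intro tendsto_intros g)
  then have "(\<lambda>z. c + (z - p) ^ k * g z) \<midarrow>p\<rightarrow> c" using nz by (simp add: zero_power)
  then show ?thesis
  proof (rule Lim_transform_eventually)
    show "\<forall>\<^sub>F z in at p. c + (z - p) ^ k * g z = h z" using ev by eventually_elim simp
  qed
qed

lemma has_order_mult:
  assumes "has_order D p n" "(E \<longlongrightarrow> E0) (at p)" "0 < E0"
  shows "has_order (\<lambda>z. D z * E z) p n"
proof -
  obtain Q Q0 where Q: "0 < Q0" "(Q \<longlongrightarrow> Q0) (at p)" "\<forall>\<^sub>F z in at p. D z = cmod (z - p) ^ n * Q z"
    using assms(1) unfolding has_order_def by blast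
  have "((\<lambda>z. Q z * E z) \<longlongrightarrow> Q0 * E0) (at p)" by (intro tendsto_intros Q assms)
  moreover from Q(3) have "\<forall>\<^sub>F z in at p. D z * E z = cmod (z - p) ^ n * (Q z * E z)"
    by eventually_elim simp
  moreover have "0 < Q0 * E0" using Q assms by simp
  ultimately show ?thesis unfolding has_order_def by blast
qed

lemma branch_value_density_order:
  assumes "branch_value h p k c g g1"
  shows "has_order (spherical_density h \<beta>) p (2 * (k - 1))"
proof -
  have den: "0 < 1 + exp (2 * \<beta>) * (cmod c)\<^sup>2" by (intro add_pos_nonneg) auto
  then have "((\<lambda>z. exp (2 * \<beta>) / (1 + exp (2 * \<beta>) * (cmod (h z))\<^sup>2)\<^sup>2)
     \<longlongrightarrow> exp (2 * \<beta>) / (1 + exp (2 * \<beta>) * (cmod c)\<^sup>2)\<^sup>2) (at p)"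
    by (intro tendsto_intros branch_value_limit[OF assms]) simp
  moreover have "0 < exp (2 * \<beta>) / (1 + exp (2 * \<beta>) * (cmod c)\<^sup>2)\<^sup>2"
    using den by (intro divide_pos_pos zero_less_power) auto
  ultimately have "has_order (\<lambda>z. 8 * (cmod (deriv h z))\<^sup>2 * (exp (2 * \<beta>) / (1 + exp (2 * \<beta>) * (cmod (h z))\<^sup>2)\<^sup>2)) p (2 * (k - 1))"
    by (rule has_order_mult[OF branch_value_deriv_order[OF assms]])
  then show ?thesis by (simp add: spherical_density_def[abs_def] mult_ac)
qed

text \<open>
  The function \<open>8 |h'|\<^sup>2 / |h|\<^sup>4\<close> dominates the spherical densities for all \<open>\<beta> \<ge> 0\<close>. Away from the
  zeros of \<open>h\<close> it has the same order as each of them, which rules out blow-up for \<open>\<beta> \<longrightarrow> \<infinity>\<close>.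
\<close>
lemma branch_value_upper_order:
  assumes "branch_value h p k c g g1" "c \<noteq> 0"
  shows "has_order (\<lambda>z. 8 * (cmod (deriv h z))\<^sup>2 / (cmod (h z)) ^ 4) p (2 * (k - 1))"
proof -
  have "((\<lambda>z. 1 / (cmod (h z)) ^ 4) \<longlongrightarrow> 1 / (cmod c) ^ 4) (at p)"
    using assms(2) by (intro tendsto_intros branch_value_limit[OF assms(1)]) auto
  from has_order_mult[OF branch_value_deriv_order[OF assms(1)] this] assms(2)
  show ?thesis by simp
qed

text \<open>
  The spherical metric does not distinguish \<open>\<infinity>\<close> from other values: a pole of order \<open>k\<close> contributes
  the same order as a finite value of multiplicity \<open>k\<close>.
\<close>
lemma branch_pole_density_order:
  assumes "branch_pole h p k g g1"
  shows "has_order (spherical_density h \<beta>) p (2 * (k - 1))"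
    and "has_order (\<lambda>z. 8 * (cmod (deriv h z))\<^sup>2 / (cmod (h z)) ^ 4) p (2 * (k - 1))"
proof -
  have g: "g \<midarrow>p\<rightarrow> g p" and g1: "g1 \<midarrow>p\<rightarrow> - (of_nat k * g p)" and k: "0 < k" and nz: "g p \<noteq> 0"
    and ev: "\<forall>\<^sub>F z in at p. h z = g z / (z - p) ^ k \<and> deriv h z = g1 z / (z - p) ^ (k + 1)"
    using assms by (auto simp: branch_pole_def)
  have ne: "\<forall>\<^sub>F z in at p. z \<noteq> p" by (simp add: eventually_at_filter)
  have gne: "\<forall>\<^sub>F z in at p. g z \<noteq> 0" using tendsto_imp_eventually_ne[OF g nz] .
  have den: "0 < (cmod (p - p) ^ k)\<^sup>2 + exp (2 * \<beta>) * (cmod (g p))\<^sup>2"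
    by (intro add_nonneg_pos mult_pos_pos) (use nz in auto)
  have pos: "0 < 8 * exp (2 * \<beta>) * (cmod (- (of_nat k * g p)))\<^sup>2 / ((cmod (p - p) ^ k)\<^sup>2 + exp (2 * \<beta>) * (cmod (g p))\<^sup>2)\<^sup>2"
    using k nz den by (intro divide_pos_pos zero_less_power) auto
  have lim: "((\<lambda>z. 8 * exp (2 * \<beta>) * (cmod (g1 z))\<^sup>2 / ((cmod (z - p) ^ k)\<^sup>2 + exp (2 * \<beta>) * (cmod (g z))\<^sup>2)\<^sup>2)
     \<longlongrightarrow> 8 * exp (2 * \<beta>) * (cmod (- (of_nat k * g p)))\<^sup>2 / ((cmod (p - p) ^ k)\<^sup>2 + exp (2 * \<beta>) * (cmod (g p))\<^sup>2)\<^sup>2) (at p)"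
    by (intro tendsto_intros g g1) (use den in simp)
  have "\<forall>\<^sub>F z in at p. spherical_density h \<beta> z = cmod (z - p) ^ (2 * (k - 1)) *
     (8 * exp (2 * \<beta>) * (cmod (g1 z))\<^sup>2 / ((cmod (z - p) ^ k)\<^sup>2 + exp (2 * \<beta>) * (cmod (g z))\<^sup>2)\<^sup>2)"
    using ev ne gne
  proof eventually_elim
    case (elim z)
    define x where "x = cmod (z - p)"
    have x: "x > 0" using elim by (simp add: x_def)
    define y where "y = exp (2 * \<beta>) * (cmod (g z))\<^sup>2"
    have y: "y > 0" using elim by (simp add: y_def)
    have E: "1 + exp (2 * \<beta>) * (cmod (h z))\<^sup>2 = ((x ^ k)\<^sup>2 + y) / (x ^ k)\<^sup>2"
      using x elim by (simp add: norm_divide norm_power x_def[symmetric] y_def power_divide add_divide_distrib)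
    have "x ^ (2 * (k - 1)) * (x ^ (k + 1))\<^sup>2 = ((x ^ k)\<^sup>2)\<^sup>2"
      unfolding power_mult[symmetric] power_add[symmetric]
      by (rule arg_cong[of _ _ "\<lambda>n. x ^ n"]) (use k in simp)
    then have X: "((x ^ k)\<^sup>2)\<^sup>2 / (x ^ (k + 1))\<^sup>2 = x ^ (2 * (k - 1))" using x by (simp add: field_simps)
    have "spherical_density h \<beta> z = 8 * exp (2 * \<beta>) * ((cmod (g1 z))\<^sup>2 / (x ^ (k + 1))\<^sup>2) / (((x ^ k)\<^sup>2 + y) / (x ^ k)\<^sup>2)\<^sup>2"
      unfolding spherical_density_def E using elim by (simp only: norm_divide norm_power x_def power_divide)
    also have "\<dots> = ((x ^ k)\<^sup>2)\<^sup>2 / (x ^ (k + 1))\<^sup>2 * (8 * exp (2 * \<beta>) * (cmod (g1 z))\<^sup>2 / ((x ^ k)\<^sup>2 + y)\<^sup>2)"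
      by (simp only: power_divide) simp
    finally show ?case unfolding X by (simp only: x_def y_def)
  qed
  then show "has_order (spherical_density h \<beta>) p (2 * (k - 1))"
    using lim pos unfolding has_order_def by blast
  have lim2: "((\<lambda>z. 8 * (cmod (g1 z))\<^sup>2 / cmod (g z) ^ 4) \<longlongrightarrow> 8 * (cmod (- (of_nat k * g p)))\<^sup>2 / cmod (g p) ^ 4) (at p)"
    by (intro tendsto_intros g g1) (use nz in auto)
  have pos2: "0 < 8 * (cmod (- (of_nat k * g p)))\<^sup>2 / cmod (g p) ^ 4" using k nz by simp
  have "\<forall>\<^sub>F z in at p. 8 * (cmod (deriv h z))\<^sup>2 / (cmod (h z)) ^ 4 = cmod (z - p) ^ (2 * (k - 1)) *
     (8 * (cmod (g1 z))\<^sup>2 / cmod (g z) ^ 4)"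
    using ev ne gne
  proof eventually_elim
    case (elim z)
    define x where "x = cmod (z - p)"
    have x: "x > 0" using elim by (simp add: x_def)
    have "x ^ (2 * (k - 1)) * (x ^ (k + 1))\<^sup>2 = (x ^ k) ^ 4"
      unfolding power_mult[symmetric] power_add[symmetric]
      by (rule arg_cong[of _ _ "\<lambda>n. x ^ n"]) (use k in simp)
    then have X: "(x ^ k) ^ 4 / (x ^ (k + 1))\<^sup>2 = x ^ (2 * (k - 1))" using x by (simp add: field_simps)
    have "8 * (cmod (deriv h z))\<^sup>2 / (cmod (h z)) ^ 4 = 8 * ((cmod (g1 z))\<^sup>2 / (x ^ (k + 1))\<^sup>2) / (cmod (g z) ^ 4 / (x ^ k) ^ 4)"
      using elim by (simp only: norm_divide norm_power x_def power_divide)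
    also have "\<dots> = (x ^ k) ^ 4 / (x ^ (k + 1))\<^sup>2 * (8 * (cmod (g1 z))\<^sup>2 / cmod (g z) ^ 4)" by simp
    finally show ?case unfolding X by (simp only: x_def)
  qed
  then show "has_order (\<lambda>z. 8 * (cmod (deriv h z))\<^sup>2 / (cmod (h z)) ^ 4) p (2 * (k - 1))"
    using lim2 pos2 unfolding has_order_def by blast
qed

section \<open>Masses and blow-up\<close>

lemma eventually_not_in_lattice:
  assumes "Im \<tau> > 0"
  shows "\<forall>\<^sub>F z in at x. z - q \<notin> lattice \<tau>"
proof (cases "x - q \<in> lattice \<tau>")
  case True
  have "\<forall>\<^sub>F z in at x. z \<noteq> x \<and> cmod (z - x) < min 1 (Im \<tau>)"
    using assms by (auto simp: eventually_at dist_norm intro!: exI[of _ "min 1 (Im \<tau>)"])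
  then show ?thesis
  proof (rule eventually_mono)
    fix z assume z: "z \<noteq> x \<and> cmod (z - x) < min 1 (Im \<tau>)"
    show "z - q \<notin> lattice \<tau>"
    proof
      assume "z - q \<in> lattice \<tau>"
      then have "z - x \<in> lattice \<tau>" using lattice_diff[OF _ True, of "z - q"] by simp
      then show False using lattice_norm_ge[OF assms, of "z - x"] z by simp
    qed
  qed
next
  case False
  obtain r where r: "r > 0" "\<And>l. l \<in> lattice \<tau> \<Longrightarrow> r \<le> cmod (x - q - l)"
    using not_in_lattice_distance[OF assms False] by blast
  have "\<forall>\<^sub>F z in at x. cmod (z - x) < r"
    using r(1) by (auto simp: eventually_at dist_norm intro!: exI[of _ r])
  then show ?thesis
  proof (rule eventually_mono)
    fix z assume z: "cmod (z - x) < r"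
    show "z - q \<notin> lattice \<tau>"
    proof
      assume "z - q \<in> lattice \<tau>"
      from r(2)[OF this] z show False by (simp add: norm_minus_commute)
    qed
  qed
qed

lemma eventually_not_singular:
  assumes "Im \<tau> > 0"
  shows "\<forall>\<^sub>F z in at x. z \<notin> singular_set \<tau> ps"
proof -
  have "\<forall>\<^sub>F z in at x. \<forall>(q, c) \<in> set ps. z - q \<notin> lattice \<tau>"
    using eventually_not_in_lattice[OF assms] by (intro eventually_ball_finite) auto
  then show ?thesis by (rule eventually_mono) (auto simp: singular_set_def)
qed

lemma open_nonsingular:
  assumes "Im \<tau> > 0"
  shows "open (- singular_set \<tau> ps)"
proof (subst open_subopen, intro ballI)
  fix x assume x: "x \<in> - singular_set \<tau> ps"
  have "\<forall>\<^sub>F z in nhds x. z \<noteq> x \<longrightarrow> z \<notin> singular_set \<tau> ps"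
    using eventually_not_singular[OF assms, where x = x and ps = ps] by (simp add: eventually_at_filter)
  then have "\<forall>\<^sub>F z in nhds x. z \<in> - singular_set \<tau> ps"
    by (rule eventually_mono) (use x in blast)
  then show "\<exists>T. open T \<and> x \<in> T \<and> T \<subseteq> - singular_set \<tau> ps"
    unfolding eventually_nhds by blast
qed

lemma singular_set_mass:
  assumes "q \<notin> singular_set \<tau> ps"
  shows "mass_at \<tau> ps q = 0"
proof -
  have "(\<Sum>(p, c)\<leftarrow>ps. if q - p \<in> lattice \<tau> then c else 0) = (\<Sum>x\<leftarrow>ps. 0)"
    by (intro arg_cong[where f = sum_list] map_cong) (use assms in \<open>auto simp: singular_set_def\<close>)
  then show ?thesis by (simp add: mass_at_def)
qed

lemma ln_bounded_coefficient_zero: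
  assumes "\<forall>\<^sub>F w in at p. \<bar>c * ln (cmod (w - p))\<bar> \<le> C"
  shows "c = (0::real)"
proof (rule ccontr)
  assume c: "c \<noteq> 0"
  have "((\<lambda>w. cmod (w - p)) \<longlongrightarrow> cmod (p - p)) (at p)" by (intro tendsto_intros)
  then have "filterlim (\<lambda>w. cmod (w - p)) (at_right 0) (at p)"
    by (simp add: filterlim_at eventually_at_filter)
  then have "filterlim (\<lambda>w. ln (cmod (w - p))) at_bot (at p)"
    by (rule filterlim_compose[OF ln_at_0])
  then have "\<forall>\<^sub>F w in at p. ln (cmod (w - p)) < - (\<bar>C\<bar> / \<bar>c\<bar>)"
    by (simp add: filterlim_at_bot_dense)
  with assms have "\<forall>\<^sub>F w in at p. False"
  proof eventually_elim
    case (elim w)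
    then have "\<bar>C\<bar> / \<bar>c\<bar> < \<bar>ln (cmod (w - p))\<bar>" by linarith
    then have "\<bar>C\<bar> < \<bar>c\<bar> * \<bar>ln (cmod (w - p))\<bar>" using c by (simp add: field_simps)
    then show ?case using elim by (simp add: abs_mult)
  qed
  then show False by simp
qed

lemma solution_log_asymptotics:
  assumes tau: "Im \<tau> > 0" and u: "solution \<tau> ps u" and bd: "\<forall>\<^sub>F z in at p. \<bar>exp (u z)\<bar> \<le> M"
  shows "\<exists>C. \<forall>\<^sub>F w in at p. \<bar>2 * pi * u w - mass_at \<tau> ps p * ln (cmod (w - p))\<bar> \<le> C"
proof (rule distributional_log_asymptotics[OF tau _ _ _ _ _ _ bd])
  show "doubly_periodic \<tau> u" "doubly_periodic \<tau> (\<lambda>z. exp (u z))"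
    using u by (auto simp: solution_def doubly_periodic_def)
  show "\<forall>\<^sub>F z in at p. isCont u z"
    using eventually_not_singular[OF tau, where x = p and ps = ps]
  proof (rule eventually_mono)
    fix z assume "z \<notin> singular_set \<tau> ps"
    then show "isCont u z"
      using u open_nonsingular[OF tau, of ps] by (auto simp: solution_def continuous_on_eq_continuous_at)
  qed
qed (use u in \<open>auto simp: solution_def\<close>)

text \<open>
  The equation of the Green function is that of a unit negative mass at \<open>0\<close> with the constant
  inhomogeneity \<open>- 1 / |E|\<close>.
\<close>
lemma green_function_asymptotics:
  assumes tau: "Im \<tau> > 0" and G: "green_function \<tau> G"
  shows "\<exists>C. \<forall>\<^sub>F w in at 0. \<bar>2 * pi * G w + ln (cmod w)\<bar> \<le> C"
proof -
  define F where "F = (\<lambda>z::complex. - 1 / measure lborel (cell \<tau>))"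
  have bcell: "bounded (cell \<tau>)" using cell_bounded by (auto simp: bounded_iff)
  have fin: "emeasure lborel (cell \<tau>) < \<infinity>"
    using emeasure_bounded_finite[OF bcell] by simp
  have Fint: "set_integrable lborel (cell \<tau>) F"
    unfolding set_integrable_def F_def
    by (intro integrable_scaleR_left) (use fin cell_borel[OF tau] in simp)
  have GI: "set_integrable lborel (cell \<tau>) G" using G by (simp add: green_function_def)
  have "\<exists>C. \<forall>\<^sub>F w in at 0. \<bar>2 * pi * G w - mass_at \<tau> [(0, - 1)] 0 * ln (cmod (w - 0))\<bar> \<le> C"
  proof (rule distributional_log_asymptotics[OF tau, where F = F and M = "\<bar>F 0\<bar>"])
    show "doubly_periodic \<tau> G" using G by (simp add: green_function_def)
    show "doubly_periodic \<tau> F" by (simp add: F_def doubly_periodic_def)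
    show "\<forall>\<^sub>F z in at 0. isCont G z"
      using eventually_not_singular[OF tau, where x = 0 and ps = "[(0, 1)]"]
    proof (rule eventually_mono)
      fix z assume z: "z \<notin> singular_set \<tau> [(0, 1)]"
      have "- singular_set \<tau> [(0, 1)] = - lattice \<tau>" by (auto simp: singular_set_def)
      then show "isCont G z"
        using G z open_nonsingular[OF tau, of "[(0, 1)]"]
        by (auto simp: green_function_def continuous_on_eq_continuous_at singular_set_def)
    qed
    fix \<phi> assume \<phi>: "test_function \<tau> \<phi>"
    then have C2: "C2 \<phi>" by (simp add: test_function_def)
    have "set_integrable lborel (cell \<tau>) (\<lambda>z. F z * \<phi> z)"
      by (rule set_integrable_mult_continuous[OF Fint continuous_on_C2[OF C2] bcell])
    moreover have "set_integrable lborel (cell \<tau>) (\<lambda>z. G z * laplacian \<phi> z)"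
      by (rule set_integrable_mult_continuous[OF GI continuous_on_laplacian[OF C2] bcell])
    ultimately have "(LINT z:cell \<tau>|lborel. G z * laplacian \<phi> z + F z * \<phi> z) =
      (LINT z:cell \<tau>|lborel. G z * laplacian \<phi> z) + (LINT z:cell \<tau>|lborel. F z * \<phi> z)"
      by (intro set_integral_add)
    moreover have "(LINT z:cell \<tau>|lborel. F z * \<phi> z) = - (LINT z:cell \<tau>|lborel. \<phi> z) / measure lborel (cell \<tau>)"
      unfolding F_def by (subst set_integral_mult_right) simp
    moreover have "- (LINT z:cell \<tau>|lborel. G z * laplacian \<phi> z) =
        \<phi> 0 - (LINT z:cell \<tau>|lborel. \<phi> z) / measure lborel (cell \<tau>)"
      using G \<phi> by (simp add: green_function_def)
    ultimately show "(LINT z:cell \<tau>|lborel. G z * laplacian \<phi> z + F z * \<phi> z) = (\<Sum>(q, c)\<leftarrow>[(0, - 1)]. c * \<phi> q)"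
      by simp
  qed (use GI Fint in \<open>auto simp: F_def\<close>)
  then show ?thesis by (simp add: mass_at_def)
qed

text \<open>
  The neighbourhood does not depend on \<open>\<beta>\<close>, since the excluded points are the singular points
  and the poles of \<open>h\<close>.
\<close>
lemma family_formula_ev:
  assumes tau: "Im \<tau> > 0" and fam: "solution_family \<tau> ps h u"
  shows "\<forall>\<^sub>F z in at p. \<forall>\<beta>. u \<beta> z = ln (spherical_density h \<beta> z)"
proof -
  have "h meromorphic_on UNIV"
    using fam by (simp add: solution_family_def type_II_def nicely_meromorphic_on_def)
  then have "\<forall>\<^sub>F z in at p. \<not> is_pole h z"
    using meromorphic_on_imp_not_pole_cosparse eventually_cosparse_imp_eventually_at by blast
  with eventually_not_singular[OF tau, where x = p and ps = ps] show ?thesis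
    by eventually_elim (use fam in \<open>auto simp: solution_family_def spherical_density_def\<close>)
qed

text \<open>
  For constant \<open>h\<close> the derivative vanishes and the logarithm of \<open>0\<close>, which is \<open>0\<close>
  by convention, gives \<open>u 0 = 0\<close> near \<open>p\<close>. This function has no logarithmic singularity.
\<close>
lemma family_not_constant:
  assumes tau: "Im \<tau> > 0" and fam: "solution_family \<tau> ps h u" and mass: "mass_at \<tau> ps p \<noteq> 0"
  shows "\<not> (\<exists>c. \<forall>z. h z = c)"
proof
  assume "\<exists>c. \<forall>z. h z = c"
  then obtain c where "h = (\<lambda>_. c)" by blast
  then have u0: "\<forall>\<^sub>F z in at p. u 0 z = 0"
    using family_formula_ev[OF tau fam, of p] by (auto simp: spherical_density_def elim!: eventually_mono)
  have sol: "solution \<tau> ps (u 0)" using fam by (simp add: solution_family_def)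
  have "\<forall>\<^sub>F z in at p. \<bar>exp (u 0 z)\<bar> \<le> 1" using u0 by eventually_elim simp
  from solution_log_asymptotics[OF tau sol this] obtain C where
    "\<forall>\<^sub>F w in at p. \<bar>2 * pi * u 0 w - mass_at \<tau> ps p * ln (cmod (w - p))\<bar> \<le> C" by blast
  with u0 have "\<forall>\<^sub>F w in at p. \<bar>mass_at \<tau> ps p * ln (cmod (w - p))\<bar> \<le> C"
    by eventually_elim simp
  from ln_bounded_coefficient_zero[OF this] mass show False by simp
qed

text \<open>
  Both the mass and the order of the density determine the coefficient of \<open>log |z - p|\<close> in \<open>u 0\<close>.
  Finite order also bounds \<open>exp u\<close> near \<open>p\<close>, as the asymptotics of the solution require.
\<close>
lemma density_order_mass:
  assumes tau: "Im \<tau> > 0" and fam: "solution_family \<tau> ps h u"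
    and ord: "has_order (spherical_density h 0) p n"
  shows "mass_at \<tau> ps p = 2 * pi * real n"
proof -
  have sol: "solution \<tau> ps (u 0)" using fam by (simp add: solution_family_def)
  obtain C1 where C1: "\<forall>\<^sub>F z in at p. 0 < spherical_density h 0 z \<and>
      \<bar>ln (spherical_density h 0 z) - real n * ln (cmod (z - p))\<bar> \<le> C1"
    using has_order_ln_bounds[OF ord] by blast
  obtain M where M: "\<forall>\<^sub>F z in at p. \<bar>spherical_density h 0 z\<bar> \<le> M"
    using has_order_bounded[OF ord] by blast
  have form: "\<forall>\<^sub>F z in at p. u 0 z = ln (spherical_density h 0 z)"
    using family_formula_ev[OF tau fam, of p] by eventually_elim simp
  have "\<forall>\<^sub>F z in at p. \<bar>exp (u 0 z)\<bar> \<le> M"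
    using C1 M form by eventually_elim simp
  from solution_log_asymptotics[OF tau sol this] obtain C where
    C: "\<forall>\<^sub>F w in at p. \<bar>2 * pi * u 0 w - mass_at \<tau> ps p * ln (cmod (w - p))\<bar> \<le> C" by blast
  have "\<forall>\<^sub>F w in at p. \<bar>(2 * pi * real n - mass_at \<tau> ps p) * ln (cmod (w - p))\<bar> \<le> C + 2 * pi * C1"
    using C C1 form
  proof eventually_elim
    case (elim w)
    let ?l = "ln (cmod (w - p))"
    have "2 * pi * \<bar>u 0 w - real n * ?l\<bar> \<le> 2 * pi * C1" using elim by (intro mult_left_mono) auto
    then have "\<bar>2 * pi * (u 0 w - real n * ?l)\<bar> \<le> 2 * pi * C1" by (simp add: abs_mult)
    moreover have "(2 * pi * real n - mass_at \<tau> ps p) * ?l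
      = (2 * pi * u 0 w - mass_at \<tau> ps p * ?l) - 2 * pi * (u 0 w - real n * ?l)"
      by (simp add: algebra_simps)
    ultimately show ?case using elim by linarith
  qed
  from ln_bounded_coefficient_zero[OF this] show ?thesis by simp
qed

text \<open>
  The bound \<open>D\<close>, uniform in \<open>\<beta>\<close>, gives \<open>u \<beta> z \<le> m/(2\<pi>) log |z - q| + O(1)\<close> with \<open>m\<close> the mass at \<open>q\<close>,
  while \<open>m G(z - q) \<le> - m/(2\<pi>) log |z - q| + O(1)\<close> because \<open>m \<ge> 0\<close>. The logarithms cancel.
\<close>
lemma no_blow_up:
  assumes tau: "Im \<tau> > 0" and G: "green_function \<tau> G" and fam: "solution_family \<tau> ps h u"
    and F: "F \<noteq> bot"
    and pos: "\<forall>\<^sub>F z in at q. deriv h z \<noteq> 0"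
    and ord: "has_order D q n" and mass: "mass_at \<tau> ps q = 2 * pi * real n"
    and bound: "\<forall>\<^sub>F \<beta> in F. \<beta> \<in> B" "\<forall>\<^sub>F z in at q. \<forall>\<beta>\<in>B. spherical_density h \<beta> z \<le> D z"
  shows "\<not> blows_up_at \<tau> G ps u q F"
proof
  assume "blows_up_at \<tau> G ps u q F"
  then obtain \<zeta> where z: "(\<zeta> \<longlongrightarrow> q) F" "\<forall>\<^sub>F \<beta> in F. \<zeta> \<beta> \<notin> singular_set \<tau> ps"
    "filterlim (\<lambda>\<beta>. u \<beta> (\<zeta> \<beta>) + mass_at \<tau> ps q * G (\<zeta> \<beta> - q)) at_top F"
    unfolding blows_up_at_def by blast
  obtain C1 where C1: "\<forall>\<^sub>F z in at q. 0 < D z \<and> \<bar>ln (D z) - real n * ln (cmod (z - q))\<bar> \<le> C1"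
    using has_order_ln_bounds[OF ord] by blast
  obtain C2 where "\<forall>\<^sub>F w in at 0. \<bar>2 * pi * G w + ln (cmod w)\<bar> \<le> C2"
    using green_function_asymptotics[OF tau G] by blast
  then have C2: "\<forall>\<^sub>F z in at q. \<bar>2 * pi * G (z - q) + ln (cmod (z - q))\<bar> \<le> C2"
    by (simp add: at_to_0[of q] eventually_filtermap)
  have ub: "\<forall>\<^sub>F z in at q. \<forall>\<beta>\<in>B. u \<beta> z \<le> real n * ln (cmod (z - q)) + C1"
    using family_formula_ev[OF tau fam, of q] pos C1 bound(2)
  proof eventually_elim
    case (elim z)
    show ?case
    proof
      fix \<beta> assume b: "\<beta> \<in> B"
      have "0 < spherical_density h \<beta> z"
        using elim by (auto simp: spherical_density_def intro!: divide_pos_pos zero_less_power add_pos_nonneg)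
      then have "u \<beta> z \<le> ln (D z)" using elim b by simp
      then show "u \<beta> z \<le> real n * ln (cmod (z - q)) + C1" using elim by linarith
    qed
  qed
  define C where "C = C1 + real n * \<bar>C2\<bar>"
  have ub2: "\<forall>\<^sub>F z in at q. \<forall>\<beta>\<in>B. u \<beta> z + mass_at \<tau> ps q * G (z - q) \<le> C"
    using ub C2
  proof eventually_elim
    case (elim z)
    have "real n * (2 * pi * G (z - q) + ln (cmod (z - q))) \<le> real n * \<bar>C2\<bar>"
      using elim by (intro mult_left_mono) auto
    then have "mass_at \<tau> ps q * G (z - q) + real n * ln (cmod (z - q)) \<le> real n * \<bar>C2\<bar>"
      by (simp add: mass algebra_simps)
    then show ?case using elim by (fastforce simp: C_def)
  qed
  \<comment> \<open>The blow-up sequence may pass through \<open>q\<close> itself if \<open>q\<close> is a regular point; there the bound follows by continuity.\<close>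
  have center: "u \<beta> q + mass_at \<tau> ps q * G (q - q) \<le> C" if b: "\<beta> \<in> B" and q: "q \<notin> singular_set \<tau> ps" for \<beta>
  proof -
    have m0: "mass_at \<tau> ps q = 0" by (rule singular_set_mass[OF q])
    have "solution \<tau> ps (u \<beta>)" using fam by (simp add: solution_family_def)
    then have "isCont (u \<beta>) q"
      using q open_nonsingular[OF tau, of ps] by (auto simp: solution_def continuous_on_eq_continuous_at)
    then have "(u \<beta> \<longlongrightarrow> u \<beta> q) (at q)" by (simp add: isCont_def)
    moreover have "\<forall>\<^sub>F z in at q. u \<beta> z \<le> C" using ub2 by eventually_elim (use b m0 in auto)
    ultimately have "u \<beta> q \<le> C" by (intro tendsto_upperbound) auto
    then show ?thesis by (simp add: m0)
  qed
  have "\<forall>\<^sub>F z in nhds q. z \<noteq> q \<longrightarrow> (\<forall>\<beta>\<in>B. u \<beta> z + mass_at \<tau> ps q * G (z - q) \<le> C)"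
    using ub2 by (simp add: eventually_at_filter)
  then have "\<forall>\<^sub>F \<beta> in F. \<zeta> \<beta> \<noteq> q \<longrightarrow> (\<forall>\<beta>'\<in>B. u \<beta>' (\<zeta> \<beta>) + mass_at \<tau> ps q * G (\<zeta> \<beta> - q) \<le> C)"
    using z(1) unfolding filterlim_def le_filter_def eventually_filtermap by blast
  moreover have "\<forall>\<^sub>F \<beta> in F. C < u \<beta> (\<zeta> \<beta>) + mass_at \<tau> ps q * G (\<zeta> \<beta> - q)"
    using z(3) by (simp add: filterlim_at_top_dense)
  ultimately have "\<forall>\<^sub>F \<beta> in F. False"
    using z(2) bound(1)
  proof eventually_elim
    case (elim \<beta>)
    show ?case
    proof (cases "\<zeta> \<beta> = q")
      case True
      then show ?thesis using elim center[of \<beta>] by simp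
    next
      case False
      then have "u \<beta> (\<zeta> \<beta>) + mass_at \<tau> ps q * G (\<zeta> \<beta> - q) \<le> C" using elim by blast
      then show ?thesis using elim by linarith
    qed
  qed
  then show False using F by (simp add: eventually_False)
qed

lemma branch_value_nonzero:
  assumes "branch_value h p k c g g1"
  shows "\<forall>\<^sub>F z in at p. deriv h z \<noteq> 0" "c \<noteq> 0 \<Longrightarrow> \<forall>\<^sub>F z in at p. h z \<noteq> 0"
proof -
  have k: "0 < k" and g1: "g1 \<midarrow>p\<rightarrow> of_nat k * g p" and nz: "of_nat k * g p \<noteq> 0"
    and ev: "\<forall>\<^sub>F z in at p. h z = c + (z - p) ^ k * g z \<and> deriv h z = (z - p) ^ (k - 1) * g1 z"
    using assms by (auto simp: branch_value_def)
  have ne: "\<forall>\<^sub>F z in at p. z \<noteq> p" by (simp add: eventually_at_filter)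
  show "\<forall>\<^sub>F z in at p. deriv h z \<noteq> 0"
    using ev ne tendsto_imp_eventually_ne[OF g1 nz] by eventually_elim simp
  show "\<forall>\<^sub>F z in at p. h z \<noteq> 0" if "c \<noteq> 0"
    using tendsto_imp_eventually_ne[OF branch_value_limit[OF assms] that] .
qed

lemma branch_pole_nonzero:
  assumes "branch_pole h p k g g1"
  shows "\<forall>\<^sub>F z in at p. deriv h z \<noteq> 0" "\<forall>\<^sub>F z in at p. h z \<noteq> 0"
proof -
  have k: "0 < k" and g: "g \<midarrow>p\<rightarrow> g p" "g p \<noteq> 0" and g1: "g1 \<midarrow>p\<rightarrow> - (of_nat k * g p)"
    and nz: "- (of_nat k * g p) \<noteq> 0"
    and ev: "\<forall>\<^sub>F z in at p. h z = g z / (z - p) ^ k \<and> deriv h z = g1 z / (z - p) ^ (k + 1)"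
    using assms by (auto simp: branch_pole_def)
  have ne: "\<forall>\<^sub>F z in at p. z \<noteq> p" by (simp add: eventually_at_filter)
  show "\<forall>\<^sub>F z in at p. deriv h z \<noteq> 0"
    using ev ne tendsto_imp_eventually_ne[OF g1 nz] by eventually_elim simp
  show "\<forall>\<^sub>F z in at p. h z \<noteq> 0"
    using ev ne tendsto_imp_eventually_ne[OF g] by eventually_elim simp
qed

lemma cosparse_UNIV_iff: "(\<forall>\<^sub>\<approx>z\<in>UNIV. P z) \<longleftrightarrow> (\<forall>p. \<forall>\<^sub>F z in at p. P z)"
  for P :: "complex \<Rightarrow> bool"
  by (simp add: eventually_cosparse_open_eq)

lemma eventually_at_uminus:
  fixes P :: "complex \<Rightarrow> bool"
  assumes "\<forall>\<^sub>F z in at (- p). P z"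
  shows "\<forall>\<^sub>F z in at p. P (- z)"
  using assms by (simp add: filtermap_at_minus[symmetric] eventually_filtermap)

lemma eventually_analytic_at:
  assumes "h meromorphic_on UNIV"
  shows "\<forall>\<^sub>F z in at p. h analytic_on {z}"
  using meromorphic_on_imp_analytic_cosparse[OF assms] by (simp add: cosparse_UNIV_iff)

lemma eventually_nonzero:
  assumes h: "h nicely_meromorphic_on UNIV" and nc: "\<not> (\<exists>c. \<forall>z. h z = c)"
  shows "\<forall>\<^sub>F z in at p. h z \<noteq> 0"
proof -
  have "\<not> (\<forall>z\<in>UNIV. h z = 0)" using nc by blast
  then have "\<forall>\<^sub>\<approx>z\<in>UNIV. h z \<noteq> 0"
    using nicely_meromorphic_imp_constant_or_avoid[OF h open_UNIV connected_UNIV, of 0] by blast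
  then show ?thesis by (simp add: cosparse_UNIV_iff)
qed

lemma eventually_deriv_nonzero:
  assumes h: "h nicely_meromorphic_on UNIV" and nc: "\<not> (\<exists>c. \<forall>z. h z = c)"
  shows "\<forall>\<^sub>F z in at p. deriv h z \<noteq> 0"
  by (cases rule: branch_cases[OF h nc, of p])
     (use branch_value_nonzero(1) branch_pole_nonzero(1) in blast)+

lemma spherical_density_le_top:
  assumes "0 \<le> \<beta>" "h z \<noteq> 0"
  shows "spherical_density h \<beta> z \<le> 8 * (cmod (deriv h z))\<^sup>2 / (cmod (h z)) ^ 4"
proof -
  define b where "b = (cmod (h z))\<^sup>2"
  define E where "E = exp (2 * \<beta>)"
  have b: "0 < b" "(cmod (h z)) ^ 4 = b\<^sup>2" using assms by (auto simp: b_def power_mult[symmetric])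
  have E: "1 \<le> E" using assms by (simp add: E_def)
  have "E * b\<^sup>2 \<le> (E * b)\<^sup>2" using E b by (simp add: power2_eq_square mult_mono)
  also have "\<dots> \<le> (1 + E * b)\<^sup>2" using E b by (intro power_mono) auto
  finally have "E / (1 + E * b)\<^sup>2 \<le> 1 / b\<^sup>2"
    using E b by (simp add: divide_simps add_pos_nonneg)
  then have "8 * (cmod (deriv h z))\<^sup>2 * (E / (1 + E * b)\<^sup>2) \<le> 8 * (cmod (deriv h z))\<^sup>2 * (1 / b\<^sup>2)"
    by (intro mult_left_mono) auto
  then show ?thesis unfolding spherical_density_def b(2) by (simp add: b_def E_def mult_ac)
qed

lemma spherical_density_le_bot:
  assumes "\<beta> \<le> 0"
  shows "spherical_density h \<beta> z \<le> 8 * (cmod (deriv h z))\<^sup>2"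
proof -
  define E where "E = exp (2 * \<beta>)"
  have E: "0 < E" "E \<le> 1" using assms by (auto simp: E_def)
  have "1 \<le> (1 + E * (cmod (h z))\<^sup>2)\<^sup>2" using E by (intro one_le_power) simp
  then have "E \<le> (1 + E * (cmod (h z))\<^sup>2)\<^sup>2" "0 < (1 + E * (cmod (h z))\<^sup>2)\<^sup>2"
    using E by linarith+
  then have "E / (1 + E * (cmod (h z))\<^sup>2)\<^sup>2 \<le> 1"
    by (simp only: divide_le_eq_1_pos)
  then have "8 * (cmod (deriv h z))\<^sup>2 * (E / (1 + E * (cmod (h z))\<^sup>2)\<^sup>2) \<le> 8 * (cmod (deriv h z))\<^sup>2 * 1"
    by (intro mult_left_mono) auto
  then show ?thesis unfolding spherical_density_def by (simp add: E_def mult_ac)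
qed

lemma family_branch_mass:
  assumes tau: "Im \<tau> > 0" and fam: "solution_family \<tau> ps h u"
  shows "branch_value h p k c g g1 \<Longrightarrow> mass_at \<tau> ps p = 2 * pi * real (2 * (k - 1))"
    and "branch_pole h p k g g1 \<Longrightarrow> mass_at \<tau> ps p = 2 * pi * real (2 * (k - 1))"
  using density_order_mass[OF tau fam] branch_value_density_order branch_pole_density_order(1) by blast+

text \<open>
  Near any other point the densities for \<open>\<beta> \<ge> 0\<close> have the common bound \<open>8 |h'|\<^sup>2 / |h|\<^sup>4\<close>.
\<close>
lemma blow_up_top_imp_zero:
  assumes tau: "Im \<tau> > 0" and G: "green_function \<tau> G" and fam: "solution_family \<tau> ps h u"
    and nc: "\<not> (\<exists>c. \<forall>z. h z = c)" and blow: "blows_up_at \<tau> G ps u q at_top"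
  shows "\<exists>k g g1. branch_value h q k 0 g g1"
proof -
  have nice: "h nicely_meromorphic_on UNIV" using fam by (simp add: solution_family_def type_II_def)
  have ev: "\<forall>\<^sub>F \<beta>::real in at_top. \<beta> \<in> {0..}" using eventually_ge_at_top[of 0] by simp
  show ?thesis
  proof (cases rule: branch_cases[OF nice nc, of q])
    case (1 k g g1)
    show ?thesis
    proof (cases "h q = 0")
      case True
      then show ?thesis using 1 by metis
    next
      case False
      have "\<forall>\<^sub>F z in at q. \<forall>\<beta>\<in>{0..}. spherical_density h \<beta> z \<le> 8 * (cmod (deriv h z))\<^sup>2 / (cmod (h z)) ^ 4"
        using branch_value_nonzero(2)[OF 1(2) False] by eventually_elim (use spherical_density_le_top in auto)
      from no_blow_up[OF tau G fam _ branch_value_nonzero(1)[OF 1(2)] branch_value_upper_order[OF 1(2) False]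
          family_branch_mass(1)[OF tau fam 1(2)] ev this] blow
      show ?thesis by simp
    qed
  next
    case (2 k g g1)
    have "\<forall>\<^sub>F z in at q. \<forall>\<beta>\<in>{0..}. spherical_density h \<beta> z \<le> 8 * (cmod (deriv h z))\<^sup>2 / (cmod (h z)) ^ 4"
      using branch_pole_nonzero(2)[OF 2(2)] by eventually_elim (use spherical_density_le_top in auto)
    from no_blow_up[OF tau G fam _ branch_pole_nonzero(1)[OF 2(2)] branch_pole_density_order(2)[OF 2(2)]
        family_branch_mass(2)[OF tau fam 2(2)] ev this] blow
    show ?thesis by simp
  qed
qed

text \<open>
  Near a point where \<open>h\<close> is finite the densities for \<open>\<beta> \<le> 0\<close> have the common bound \<open>8 |h'|\<^sup>2\<close>.
\<close>
lemma blow_up_bot_imp_pole: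
  assumes tau: "Im \<tau> > 0" and G: "green_function \<tau> G" and fam: "solution_family \<tau> ps h u"
    and nc: "\<not> (\<exists>c. \<forall>z. h z = c)" and blow: "blows_up_at \<tau> G ps u q at_bot"
  shows "\<exists>k g g1. branch_pole h q k g g1"
proof -
  have nice: "h nicely_meromorphic_on UNIV" using fam by (simp add: solution_family_def type_II_def)
  have ev: "\<forall>\<^sub>F \<beta>::real in at_bot. \<beta> \<in> {..0}" using eventually_le_at_bot[of 0] by simp
  show ?thesis
  proof (cases rule: branch_cases[OF nice nc, of q])
    case (1 k g g1)
    have "\<forall>\<^sub>F z in at q. \<forall>\<beta>\<in>{..0}. spherical_density h \<beta> z \<le> 8 * (cmod (deriv h z))\<^sup>2"
      using spherical_density_le_bot by (intro always_eventually) auto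
    from no_blow_up[OF tau G fam _ branch_value_nonzero(1)[OF 1(2)] branch_value_deriv_order[OF 1(2)]
        family_branch_mass(1)[OF tau fam 1(2)] ev this] blow
    show ?thesis by simp
  next
    case (2 k g g1)
    then show ?thesis by blast
  qed
qed

section \<open>The quotient of a developing map by its derivative\<close>

text \<open>
  The reciprocal of the logarithmic derivative. It has the advantage of vanishing at the zeros and
  poles of \<open>h\<close>, so that its only poles are ramification points over other values.
\<close>
definition newton_quotient :: "(complex \<Rightarrow> complex) \<Rightarrow> complex \<Rightarrow> complex" where
  "newton_quotient h z = h z / deriv h z"

lemma newton_quotient_meromorphic:
  "h meromorphic_on A \<Longrightarrow> newton_quotient h meromorphic_on A"
  unfolding newton_quotient_def[abs_def] by (intro meromorphic_intros)

lemma deriv_multiplicative_shift: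
  assumes shift: "\<And>z. h (z + l) = c * h z" and d: "h field_differentiable (at z)"
  shows "deriv h (z + l) = c * deriv h z"
proof -
  have "((\<lambda>w. h (w - l)) has_field_derivative deriv h z) (at (z + l))"
    using DERIV_shift[of h "deriv h z" "z + l" "- l"] d
    by (simp add: DERIV_deriv_iff_field_differentiable)
  then have "((\<lambda>w. c * h (w - l)) has_field_derivative c * deriv h z) (at (z + l))"
    by (rule DERIV_cmult)
  moreover have "(\<lambda>w. c * h (w - l)) = h"
  proof
    fix w show "c * h (w - l) = h w" using shift[of "w - l"] by simp
  qed
  ultimately show ?thesis using DERIV_imp_deriv by metis
qed

text \<open>
  Replacing \<open>h\<close> by \<open>c h\<close> leaves the density at a point unchanged only if \<open>|c| = 1\<close> or
  \<open>exp (2 \<beta>) |c| |h(z)|\<^sup>2 = 1\<close>, and the latter cannot hold for \<open>\<beta> = 0\<close> and \<open>\<beta> = 1\<close> at the same point.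
\<close>
lemma family_multiplier_unimodular:
  assumes tau: "Im \<tau> > 0" and fam: "solution_family \<tau> ps h u" and nc: "\<not> (\<exists>c. \<forall>z. h z = c)"
    and shift: "\<And>z. h (z + l) = c * h z" and c: "c \<noteq> 0" and per: "\<And>z. u 0 (z + l) = u 0 z" "\<And>z. u 1 (z + l) = u 1 z"
  shows "cmod c = 1"
proof (rule ccontr)
  assume c1: "cmod c \<noteq> 1"
  have nice: "h nicely_meromorphic_on UNIV" using fam by (simp add: solution_family_def type_II_def)
  have an: "\<forall>\<^sub>F z in at 0. h analytic_on {z}"
    using nice by (intro eventually_analytic_at) (simp add: nicely_meromorphic_on_def)
  have "\<forall>\<^sub>F z in at l. \<forall>\<beta>. u \<beta> z = ln (spherical_density h \<beta> z)" by (rule family_formula_ev[OF tau fam])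
  then have fl: "\<forall>\<^sub>F z in at 0. \<forall>\<beta>. u \<beta> (z + l) = ln (spherical_density h \<beta> (z + l))"
    by (simp add: at_to_0[of l] eventually_filtermap)
  have "\<forall>\<^sub>F z in at (0::complex). False"
    using eventually_deriv_nonzero[OF nice nc, of 0] an fl family_formula_ev[OF tau fam, of 0]
  proof eventually_elim
    case (elim z)
    define x where "x = (cmod (h z))\<^sup>2"
    define D where "D = (cmod (deriv h z))\<^sup>2"
    define m where "m = cmod c"
    have pos: "x \<ge> 0" "D > 0" "m > 0" using elim c by (auto simp: x_def D_def m_def)
    have "h field_differentiable (at z)"
      using elim analytic_on_imp_differentiable_at[of h "{z}" z] by simp
    then have dl: "deriv h (z + l) = c * deriv h z" by (rule deriv_multiplicative_shift[where h = h and c = c and l = l, OF shift])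
    have key: "exp (2 * \<beta>) * m * x = 1" if "u \<beta> (z + l) = u \<beta> z" for \<beta>
    proof -
      define E where "E = exp (2 * \<beta>)"
      have E: "E > 0" by (simp add: E_def)
      have den: "0 < 1 + E * (m\<^sup>2 * x)" "0 < 1 + E * x"
        using E pos by (auto intro!: add_pos_nonneg mult_nonneg_nonneg)
      have "ln (8 * E * (m\<^sup>2 * D) / (1 + E * (m\<^sup>2 * x))\<^sup>2) = ln (8 * E * D / (1 + E * x)\<^sup>2)"
        using that elim
        by (simp add: spherical_density_def dl shift E_def m_def x_def D_def norm_mult power_mult_distrib)
      moreover have "0 < 8 * E * (m\<^sup>2 * D) / (1 + E * (m\<^sup>2 * x))\<^sup>2" "0 < 8 * E * D / (1 + E * x)\<^sup>2"
        using E pos den by (auto intro!: divide_pos_pos mult_pos_pos zero_less_power)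
      ultimately have eq: "8 * E * (m\<^sup>2 * D) / (1 + E * (m\<^sup>2 * x))\<^sup>2 = 8 * E * D / (1 + E * x)\<^sup>2" by simp
      define X where "X = (1 + E * x)\<^sup>2"
      define Y where "Y = (1 + E * (m\<^sup>2 * x))\<^sup>2"
      have "X \<noteq> 0" "Y \<noteq> 0" using den by (auto simp: X_def Y_def)
      then have "(8 * E * D) * (m\<^sup>2 * X) = (8 * E * D) * Y"
        using eq unfolding X_def[symmetric] Y_def[symmetric] by (simp add: frac_eq_eq mult_ac)
      then have "m\<^sup>2 * X = Y" using E pos by simp
      then have "(m * (1 + E * x))\<^sup>2 = (1 + E * (m\<^sup>2 * x))\<^sup>2"
        by (simp only: power_mult_distrib X_def Y_def)
      then have "m * (1 + E * x) = 1 + E * (m\<^sup>2 * x)"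
        by (rule power2_eq_imp_eq) (use den pos in simp_all)
      then have "(m - 1) * (1 - E * m * x) = 0" by (simp add: algebra_simps power2_eq_square)
      then show ?thesis using c1 by (simp add: E_def m_def)
    qed
    from key[of 0] key[of 1] per have "m * x = 1" "exp 2 * m * x = 1" by auto
    then have "exp (2::real) = 1" by (simp add: mult.assoc)
    then show ?case by simp
  qed
  then show False by simp
qed

lemma family_norm_periodic:
  assumes tau: "Im \<tau> > 0" and fam: "solution_family \<tau> ps h u" and nc: "\<not> (\<exists>c. \<forall>z. h z = c)"
  shows "doubly_periodic \<tau> (\<lambda>z. cmod (h z))"
proof -
  obtain A B where per: "\<And>z. h (z + 1) = A * h z" "\<And>z. h (z + \<tau>) = B * h z" "A \<noteq> 0" "B \<noteq> 0"
    using fam unfolding solution_family_def type_II_def by (metis exp_not_eq_zero)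
  have "\<And>\<beta> z. u \<beta> (z + 1) = u \<beta> z \<and> u \<beta> (z + \<tau>) = u \<beta> z"
    using fam by (auto simp: solution_family_def solution_def doubly_periodic_def)
  then have "cmod A = 1" "cmod B = 1"
    using family_multiplier_unimodular[OF tau fam nc] per by blast+
  then show ?thesis using per by (simp add: doubly_periodic_def norm_mult)
qed

lemma newton_quotient_periodic:
  assumes "type_II \<tau> h"
  shows "doubly_periodic \<tau> (newton_quotient h)"
proof -
  have nice: "h nicely_meromorphic_on UNIV" using assms by (simp add: type_II_def)
  obtain A B where per: "\<And>z. h (z + 1) = A * h z" "\<And>z. h (z + \<tau>) = B * h z" "A \<noteq> 0" "B \<noteq> 0"
    using assms unfolding type_II_def by (metis exp_not_eq_zero)
  have "newton_quotient h (z + l) = newton_quotient h z"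
    if shift: "\<And>z. h (z + l) = c * h z" and c: "c \<noteq> 0" for l c z
  proof (cases "h z = 0")
    case True
    then show ?thesis using shift[of z] by (simp add: newton_quotient_def)
  next
    case False
    then have "\<not> is_pole h z" by (rule nicely_meromorphic_not_pole[OF nice])
    then have "h analytic_on {z}" by (intro nicely_meromorphic_on_imp_analytic_at[OF nice]) auto
    then have "h field_differentiable (at z)"
      using analytic_on_imp_differentiable_at[of h "{z}" z] by simp
    from deriv_multiplicative_shift[where h = h and c = c and l = l, OF shift this]
    show ?thesis using shift[of z] c by (simp add: newton_quotient_def)
  qed
  from this[OF per(1,3)] this[OF per(2,4)] show ?thesis by (simp add: doubly_periodic_def)
qed

text \<open>
  At a zero of multiplicity \<open>k\<close> the slope \<open>1 / k\<close> records the multiplicity; at another value the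
  quotient has a pole of order \<open>k - 1\<close>.
\<close>
lemma newton_quotient_value:
  assumes "branch_value h p k c g g1"
  shows "(\<lambda>z. (z - p) ^ (k - 1) * newton_quotient h z) \<midarrow>p\<rightarrow> c / (of_nat k * g p)"
    and "c = 0 \<Longrightarrow> (\<lambda>z. newton_quotient h z / (z - p)) \<midarrow>p\<rightarrow> 1 / of_nat k"
proof -
  have k: "0 < k" and g: "g \<midarrow>p\<rightarrow> g p" and g1: "g1 \<midarrow>p\<rightarrow> of_nat k * g p" and gp: "g p \<noteq> 0"
    and nz: "of_nat k * g p \<noteq> 0"
    and ev: "\<forall>\<^sub>F z in at p. h z = c + (z - p) ^ k * g z \<and> deriv h z = (z - p) ^ (k - 1) * g1 z"
    using assms by (auto simp: branch_value_def)
  have ne: "\<forall>\<^sub>F z in at p. z \<noteq> p" by (simp add: eventually_at_filter)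
  have "(\<lambda>z. h z / g1 z) \<midarrow>p\<rightarrow> c / (of_nat k * g p)"
    by (intro tendsto_intros branch_value_limit[OF assms] g1 nz)
  then show "(\<lambda>z. (z - p) ^ (k - 1) * newton_quotient h z) \<midarrow>p\<rightarrow> c / (of_nat k * g p)"
  proof (rule Lim_transform_eventually)
    show "\<forall>\<^sub>F z in at p. h z / g1 z = (z - p) ^ (k - 1) * newton_quotient h z"
      using ev ne by eventually_elim (simp add: newton_quotient_def)
  qed
  show "(\<lambda>z. newton_quotient h z / (z - p)) \<midarrow>p\<rightarrow> 1 / of_nat k" if c: "c = 0"
  proof -
    have "(\<lambda>z. g z / g1 z) \<midarrow>p\<rightarrow> g p / (of_nat k * g p)" by (intro tendsto_intros g g1 nz)
    then have "(\<lambda>z. g z / g1 z) \<midarrow>p\<rightarrow> 1 / of_nat k" using gp by simp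
    then show ?thesis
    proof (rule Lim_transform_eventually)
      have pk: "(z - p) ^ k = (z - p) ^ (k - 1) * (z - p)" for z using power_minus_mult[OF k, of "z - p"] by simp
      show "\<forall>\<^sub>F z in at p. g z / g1 z = newton_quotient h z / (z - p)"
        using ev ne by eventually_elim (simp add: newton_quotient_def c pk)
    qed
  qed
qed

lemma newton_quotient_pole:
  assumes "branch_pole h p k g g1"
  shows "(\<lambda>z. newton_quotient h z / (z - p)) \<midarrow>p\<rightarrow> - 1 / of_nat k"
proof -
  have k: "0 < k" and g: "g \<midarrow>p\<rightarrow> g p" and g1: "g1 \<midarrow>p\<rightarrow> - (of_nat k * g p)" and gp: "g p \<noteq> 0"
    and nz: "- (of_nat k * g p) \<noteq> 0"
    and ev: "\<forall>\<^sub>F z in at p. h z = g z / (z - p) ^ k \<and> deriv h z = g1 z / (z - p) ^ (k + 1)"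
    using assms by (auto simp: branch_pole_def)
  have ne: "\<forall>\<^sub>F z in at p. z \<noteq> p" by (simp add: eventually_at_filter)
  have "(\<lambda>z. g z / g1 z) \<midarrow>p\<rightarrow> g p / - (of_nat k * g p)" by (intro tendsto_intros g g1 nz)
  then have "(\<lambda>z. g z / g1 z) \<midarrow>p\<rightarrow> - 1 / of_nat k" using gp by simp
  then show ?thesis
  proof (rule Lim_transform_eventually)
    show "\<forall>\<^sub>F z in at p. g z / g1 z = newton_quotient h z / (z - p)"
      using ev ne by eventually_elim (simp add: newton_quotient_def)
  qed
qed

lemma tendsto_0_from_quotient:
  fixes K :: "complex \<Rightarrow> complex"
  assumes "(\<lambda>z. K z / (z - p)) \<midarrow>p\<rightarrow> c"
  shows "K \<midarrow>p\<rightarrow> 0"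
proof -
  have "(\<lambda>z. (z - p) * (K z / (z - p))) \<midarrow>p\<rightarrow> (p - p) * c" by (intro tendsto_intros assms)
  then have "(\<lambda>z. (z - p) * (K z / (z - p))) \<midarrow>p\<rightarrow> 0" by simp
  then show ?thesis
    by (rule Lim_transform_eventually) (auto simp: eventually_at_filter)
qed

lemma newton_quotient_limit_regular:
  assumes tau: "Im \<tau> > 0" and fam: "solution_family \<tau> ps h u" and nc: "\<not> (\<exists>c. \<forall>z. h z = c)"
    and mass: "mass_at \<tau> ps p = 0"
  shows "\<exists>l. newton_quotient h \<midarrow>p\<rightarrow> l"
proof -
  have nice: "h nicely_meromorphic_on UNIV" using fam by (simp add: solution_family_def type_II_def)
  show ?thesis
  proof (cases rule: branch_cases[OF nice nc, of p])
    case (1 k g g1)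
    have "k - 1 = 0" using family_branch_mass(1)[OF tau fam 1(2)] mass by simp
    then show ?thesis using newton_quotient_value(1)[OF 1(2)] by auto
  next
    case (2 k g g1)
    show ?thesis using tendsto_0_from_quotient[OF newton_quotient_pole[OF 2(2)]] by blast
  qed
qed

lemma newton_quotient_double_pole:
  assumes tau: "Im \<tau> > 0" and fam: "solution_family \<tau> ps h u" and nc: "\<not> (\<exists>c. \<forall>z. h z = c)"
    and mass: "mass_at \<tau> ps 0 = 8 * pi"
  shows "\<exists>\<alpha>. (\<lambda>z. z\<^sup>2 * newton_quotient h z) \<midarrow>0\<rightarrow> \<alpha>"
proof -
  have nice: "h nicely_meromorphic_on UNIV" using fam by (simp add: solution_family_def type_II_def)
  show ?thesis
  proof (cases rule: branch_cases[OF nice nc, of 0])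
    case (1 k g g1)
    have "k - 1 = 2" using family_branch_mass(1)[OF tau fam 1(2)] mass by simp
    then show ?thesis using newton_quotient_value(1)[OF 1(2)] by auto
  next
    case (2 k g g1)
    have "(\<lambda>z. z\<^sup>2 * newton_quotient h z) \<midarrow>0\<rightarrow> 0\<^sup>2 * 0"
      by (intro tendsto_intros tendsto_0_from_quotient[OF newton_quotient_pole[OF 2(2)]])
    then show ?thesis by blast
  qed
qed

lemma meromorphic_deriv_zero_limit:
  assumes W: "W meromorphic_on UNIV" and d: "\<forall>\<^sub>F z in at p. deriv W z = 0"
  shows "\<exists>c. W \<midarrow>p\<rightarrow> c"
proof -
  have "isolated_singularity_at W p" using W meromorphic_on_isolated_singularity meromorphic_on_subset by blast
  then obtain r where r: "r > 0" "W analytic_on ball p r - {p}" by (auto simp: isolated_singularity_at_def)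
  obtain r' where r': "r' > 0" "\<And>z. z \<noteq> p \<Longrightarrow> dist z p < r' \<Longrightarrow> deriv W z = 0"
    using d unfolding eventually_at by blast
  define S where "S = ball p (min r r') - {p}"
  have S: "open S" "connected S" unfolding S_def by (auto intro: connected_open_delete)
  have der: "(W has_field_derivative 0) (at z)" if "z \<in> S" for z
  proof -
    have "W analytic_on {z}" by (rule analytic_on_subset[OF r(2)]) (use that in \<open>auto simp: S_def\<close>)
    then have "(W has_field_derivative deriv W z) (at z)" by (rule analytic_imp_has_deriv)
    then show ?thesis using r'(2)[of z] that by (simp add: S_def dist_commute)
  qed
  then have "continuous_on S W" by (meson DERIV_isCont continuous_at_imp_continuous_on)
  with S der obtain c where c: "\<And>z. z \<in> S \<Longrightarrow> W z = c"
    using DERIV_zero_connected_constant[of S "{}" W] by auto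
  have "\<forall>\<^sub>F z in at p. z \<in> S" unfolding S_def using r(1) r'(1) by (intro eventually_at_in_open) auto
  then have "\<forall>\<^sub>F z in at p. W z = c" by eventually_elim (rule c)
  then have "W \<midarrow>p\<rightarrow> c" by (rule tendsto_eventually)
  then show ?thesis by blast
qed

lemma meromorphic_deriv_zero_constant:
  assumes tau: "Im \<tau> > 0" and W: "W meromorphic_on UNIV"
    and d: "\<And>p. \<forall>\<^sub>F z in at p. deriv W z = 0" and per: "doubly_periodic \<tau> (\<lambda>z. cmod (W z))"
  shows "\<exists>C. \<forall>p. \<forall>\<^sub>F z in at p. W z = C"
proof -
  obtain C where C: "\<And>p. W \<midarrow>p\<rightarrow> C"
    using elliptic_without_poles_constant[OF tau W meromorphic_deriv_zero_limit[OF W d] per] by blast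
  have "\<forall>\<^sub>F z in at p. W z = C" for p
  proof -
    have "\<forall>\<^sub>F z in at p. remove_sings W z = W z"
      using W meromorphic_on_isolated_singularity meromorphic_on_subset
      by (blast intro: eventually_remove_sings_eq_at)
    then show ?thesis by eventually_elim (use remove_sings_eqI[OF C] in simp)
  qed
  then show ?thesis by blast
qed

section \<open>Evenness and the square relation\<close>

text \<open>
  With \<open>x = |h(z)|\<^sup>2\<close> and \<open>\<kappa> = |K|\<close>, equality of the densities at \<open>z\<close> and \<open>-z\<close> amounts to
  \<open>(1 - \<kappa>) (x - \<kappa>) = 0\<close>. If \<open>\<kappa> \<noteq> 1\<close>, then \<open>|h|\<^sup>2\<close> is the positive constant \<open>\<kappa>\<close> near \<open>a\<close>,
  although \<open>h\<close> tends to \<open>0\<close> there.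
\<close>
lemma even_family_constant_norm:
  assumes tau: "Im \<tau> > 0" and fam: "even_family \<tau> ps h u"
    and nc: "\<not> (\<exists>c. \<forall>z. h z = c)" and zero: "branch_value h a k 0 g g1"
    and prod: "\<forall>\<^sub>F z in at a. h z * h (- z) = K" and K: "K \<noteq> 0"
    and logder: "\<forall>\<^sub>F z in at a. newton_quotient h (- z) = newton_quotient h z"
  shows "cmod K = 1"
proof (rule ccontr)
  assume K1: "cmod K \<noteq> 1"
  have sf: "solution_family \<tau> ps h u" using fam by (simp add: even_family_def)
  have nice: "h nicely_meromorphic_on UNIV" using sf by (simp add: solution_family_def type_II_def)
  define \<kappa> where "\<kappa> = cmod K"
  have \<kappa>: "\<kappa> > 0" "\<kappa> \<noteq> 1" using K K1 by (auto simp: \<kappa>_def)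
  have "\<forall>\<^sub>F z in at a. (cmod (h z))\<^sup>2 = \<kappa>"
    using family_formula_ev[OF tau sf, of a] eventually_at_uminus[OF family_formula_ev[OF tau sf, of "- a"]]
      eventually_not_singular[OF tau, where x = a and ps = ps]
      eventually_at_uminus[OF eventually_not_singular[OF tau, where x = "- a" and ps = ps]]
      branch_value_nonzero(1)[OF zero] eventually_at_uminus[OF eventually_deriv_nonzero[OF nice nc, of "- a"]] prod logder
  proof eventually_elim
    case (elim z)
    define x where "x = (cmod (h z))\<^sup>2"
    define D where "D = (cmod (deriv h z))\<^sup>2"
    define x' where "x' = (cmod (h (- z)))\<^sup>2"
    define D' where "D' = (cmod (deriv h (- z)))\<^sup>2"
    have hz: "h z \<noteq> 0" "h (- z) \<noteq> 0" using elim K by auto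
    have pos: "x > 0" "D > 0" "x' > 0" "D' > 0" using hz elim by (auto simp: x_def D_def x'_def D'_def)
    have xx: "x * x' = \<kappa>\<^sup>2"
      using elim by (simp add: x_def x'_def \<kappa>_def power_mult_distrib[symmetric] norm_mult[symmetric])
    have "h (- z) * deriv h z = h z * deriv h (- z)"
      using elim by (simp add: newton_quotient_def field_simps)
    then have "cmod (h (- z) * deriv h z) = cmod (h z * deriv h (- z))" by simp
    then have DD: "x' * D = x * D'"
      by (simp add: norm_mult x_def x'_def D_def D'_def flip: power_mult_distrib)
    have "u 0 (- z) = u 0 z" using fam elim(3,4) unfolding even_family_def by blast
    then have "ln (8 * D' / (1 + x')\<^sup>2) = ln (8 * D / (1 + x)\<^sup>2)"
      using elim by (simp add: spherical_density_def x_def x'_def D_def D'_def)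
    moreover have "0 < 8 * D' / (1 + x')\<^sup>2" "0 < 8 * D / (1 + x)\<^sup>2" using pos by auto
    ultimately have "8 * D' / (1 + x')\<^sup>2 = 8 * D / (1 + x)\<^sup>2" by simp
    then have "D' * (1 + x)\<^sup>2 = D * (1 + x')\<^sup>2" using pos by (simp add: field_simps)
    then have "x * D' * (1 + x)\<^sup>2 = D * (x * (1 + x')\<^sup>2)" by (simp add: mult.assoc mult.left_commute)
    then have "x' * (1 + x)\<^sup>2 = x * (1 + x')\<^sup>2"
      unfolding DD[symmetric] using pos by (simp add: mult.commute mult.left_commute)
    then have "x * (x' * (1 + x)\<^sup>2) = x * (x * (1 + x')\<^sup>2)" by simp
    also have "\<dots> = (x + x * x')\<^sup>2" by (simp add: power2_eq_square algebra_simps)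
    finally have "x * (x' * (1 + x)\<^sup>2) = (x + x * x')\<^sup>2" .
    \<comment> \<open>The relation \<open>x x' = \<kappa>\<^sup>2\<close> eliminates \<open>x'\<close>.\<close>
    then have "(\<kappa> * (1 + x))\<^sup>2 = (x + \<kappa>\<^sup>2)\<^sup>2"
      unfolding mult.assoc[symmetric] xx by (simp add: power_mult_distrib)
    then have "\<kappa> * (1 + x) = x + \<kappa>\<^sup>2"
      by (rule power2_eq_imp_eq) (use pos \<kappa> in simp_all)
    then have "(1 - \<kappa>) * (x - \<kappa>) = 0" by (simp add: algebra_simps power2_eq_square)
    then show ?case using \<kappa> by (simp add: x_def)
  qed
  then have "((\<lambda>z. (cmod (h z))\<^sup>2) \<longlongrightarrow> \<kappa>) (at a)" by (rule tendsto_eventually)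
  moreover have "((\<lambda>z. (cmod (h z))\<^sup>2) \<longlongrightarrow> (cmod 0)\<^sup>2) (at a)"
    by (intro tendsto_intros branch_value_limit[OF zero])
  ultimately have "\<kappa> = (cmod (0::complex))\<^sup>2" using LIM_unique by blast
  then show False using \<kappa> by simp
qed

text \<open>
  The hypothesis says \<open>h f' = 2 f h'\<close>, that is, \<open>(f / h\<^sup>2)' = 0\<close>. The identity extends to the
  poles because both functions take the value \<open>0\<close> there.
\<close>
lemma newton_quotient_half_imp_square:
  assumes tau: "Im \<tau> > 0"
    and f: "f nicely_meromorphic_on UNIV" "\<not> (\<exists>c. \<forall>z. f z = c)" "doubly_periodic \<tau> (\<lambda>z. cmod (f z))"
    and h: "h nicely_meromorphic_on UNIV" "\<not> (\<exists>c. \<forall>z. h z = c)" "doubly_periodic \<tau> (\<lambda>z. cmod (h z))"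
    and eq: "\<And>p. \<forall>\<^sub>F z in at p. newton_quotient h z = 2 * newton_quotient f z"
  shows "\<exists>C. C \<noteq> 0 \<and> (\<forall>z. f z = C * (h z)\<^sup>2)"
proof -
  define W where "W z = f z / (h z)\<^sup>2" for z
  have fm: "f meromorphic_on UNIV" and hm: "h meromorphic_on UNIV"
    using f h by (auto simp: nicely_meromorphic_on_def)
  have Wm: "W meromorphic_on UNIV" unfolding W_def using fm hm by (intro meromorphic_intros)
  have "\<forall>\<^sub>F z in at p. deriv W z = 0" for p
    using eventually_analytic_at[OF fm, of p] eventually_analytic_at[OF hm, of p]
      eventually_nonzero[OF h(1,2), of p] eventually_deriv_nonzero[OF h(1,2), of p]
      eventually_deriv_nonzero[OF f(1,2), of p] eq[of p]
  proof eventually_elim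
    case (elim z)
    have rel: "h z * deriv f z = 2 * f z * deriv h z"
      using elim by (simp add: newton_quotient_def field_simps)
    have "(W has_field_derivative
        (deriv f z * (h z)\<^sup>2 - f z * (2 * h z * deriv h z)) / ((h z)\<^sup>2 * (h z)\<^sup>2)) (at z)"
      unfolding W_def using elim analytic_imp_has_deriv[of f z] analytic_imp_has_deriv[of h z]
      by (auto intro!: derivative_eq_intros simp: power2_eq_square)
    moreover have "deriv f z * (h z)\<^sup>2 - f z * (2 * h z * deriv h z)
      = h z * (h z * deriv f z - 2 * f z * deriv h z)"
      by (simp add: power2_eq_square algebra_simps)
    ultimately have "(W has_field_derivative 0) (at z)" by (simp add: rel)
    then show ?case by (rule DERIV_imp_deriv)
  qed
  moreover have "doubly_periodic \<tau> (\<lambda>z. cmod (W z))"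
    using f(3) h(3) by (simp add: doubly_periodic_def W_def norm_divide norm_power)
  ultimately obtain C where C: "\<And>p. \<forall>\<^sub>F z in at p. W z = C"
    using meromorphic_deriv_zero_constant[OF tau Wm] by blast
  have ev: "\<forall>\<^sub>F z in at p. f z = C * (h z)\<^sup>2" for p
    using C[of p] eventually_nonzero[OF h(1,2), of p] by eventually_elim (auto simp: W_def)
  have C0: "C \<noteq> 0"
  proof
    assume C: "C = 0"
    have "\<forall>\<^sub>F z in at (0::complex). False"
      using ev[of 0] eventually_nonzero[OF f(1,2), of 0] by eventually_elim (simp add: C)
    then show False by simp
  qed
  have "f z = C * (h z)\<^sup>2" for z
  proof (cases "is_pole h z")
    case True
    have "h z = 0" using nicely_meromorphic_not_pole[OF h(1)] True by blast
    have "filterlim (\<lambda>z. (h z)\<^sup>2) at_infinity (at z)"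
      using True unfolding is_pole_def power2_eq_square by (intro filterlim_at_infinity_times)
    then have "is_pole (\<lambda>z. C * (h z)\<^sup>2) z"
      unfolding is_pole_def by (rule tendsto_mult_filterlim_at_infinity[OF tendsto_const C0])
    moreover have "is_pole (\<lambda>z. C * (h z)\<^sup>2) z \<longleftrightarrow> is_pole f z"
      by (rule is_pole_cong) (use ev[of z] in \<open>auto elim!: eventually_mono\<close>)
    ultimately have "f z = 0" using nicely_meromorphic_not_pole[OF f(1)] by blast
    then show ?thesis using \<open>h z = 0\<close> by simp
  next
    case False
    then have "h \<midarrow>z\<rightarrow> h z" using h(1) by (auto simp: nicely_meromorphic_on_def)
    then have "(\<lambda>z. C * (h z)\<^sup>2) \<midarrow>z\<rightarrow> C * (h z)\<^sup>2" by (intro tendsto_intros)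
    then have lim: "f \<midarrow>z\<rightarrow> C * (h z)\<^sup>2"
      by (rule Lim_transform_eventually) (use ev[of z] in \<open>auto elim!: eventually_mono\<close>)
    then have "\<not> is_pole f z" by (rule tendsto_imp_not_pole)
    then have "f \<midarrow>z\<rightarrow> f z" using f(1) by (auto simp: nicely_meromorphic_on_def)
    then show ?thesis using LIM_unique lim by blast
  qed
  then show ?thesis using C0 by blast
qed

text \<open>
  The hypothesis says that the derivative \<open>h'(z) h(-z) - h(z) h'(-z)\<close> of \<open>h(z) h(-z)\<close> vanishes.
\<close>
lemma even_newton_quotient_imp_product_constant:
  assumes tau: "Im \<tau> > 0"
    and h: "h nicely_meromorphic_on UNIV" "\<not> (\<exists>c. \<forall>z. h z = c)" "doubly_periodic \<tau> (\<lambda>z. cmod (h z))"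
    and eq: "\<And>p. \<forall>\<^sub>F z in at p. newton_quotient h (- z) = newton_quotient h z"
  shows "\<exists>K. K \<noteq> 0 \<and> (\<forall>p. \<forall>\<^sub>F z in at p. h z * h (- z) = K)"
proof -
  define V where "V z = h z * h (- z)" for z
  have hm: "h meromorphic_on UNIV" using h by (auto simp: nicely_meromorphic_on_def)
  have "(\<lambda>z. h (- z)) meromorphic_on UNIV"
    by (rule meromorphic_on_compose[OF hm]) (auto intro!: analytic_intros)
  then have Vm: "V meromorphic_on UNIV" unfolding V_def using hm by (intro meromorphic_intros)
  have "\<forall>\<^sub>F z in at p. deriv V z = 0" for p
    using eventually_analytic_at[OF hm, of p] eventually_at_uminus[OF eventually_analytic_at[OF hm, of "- p"]]
      eventually_deriv_nonzero[OF h(1,2), of p] eventually_at_uminus[OF eventually_deriv_nonzero[OF h(1,2), of "- p"]]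
      eq[of p]
  proof eventually_elim
    case (elim z)
    have rel: "h (- z) * deriv h z = h z * deriv h (- z)"
      using elim by (simp add: newton_quotient_def field_simps)
    have um: "(uminus has_field_derivative - 1) (at z)" by (auto intro!: derivative_eq_intros)
    have "(h has_field_derivative deriv h (- z)) (at (- z))"
      by (rule analytic_imp_has_deriv) (rule elim(2))
    from DERIV_chain2[OF this um]
    have "((\<lambda>z. h (- z)) has_field_derivative deriv h (- z) * (- 1)) (at z)" .
    then have "(V has_field_derivative deriv h z * h (- z) + (deriv h (- z) * (- 1)) * h z) (at z)"
      unfolding V_def using analytic_imp_has_deriv[of h z] elim by (intro DERIV_mult) auto
    then have "(V has_field_derivative 0) (at z)" using rel by (simp add: mult.commute)
    then show ?case by (rule DERIV_imp_deriv)
  qed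
  moreover have "doubly_periodic \<tau> (\<lambda>z. cmod (V z))"
  proof -
    have "cmod (h (- z - l)) = cmod (h (- z))" if "l \<in> lattice \<tau>" for z l
      using doubly_periodic_lattice_diff[OF h(3) that, of "- z"] .
    then show ?thesis using h(3) by (simp add: doubly_periodic_def V_def norm_mult)
  qed
  ultimately obtain K where K: "\<And>p. \<forall>\<^sub>F z in at p. V z = K"
    using meromorphic_deriv_zero_constant[OF tau Vm] by blast
  have "K \<noteq> 0"
  proof
    assume K0: "K = 0"
    have "\<forall>\<^sub>F z in at (0::complex). False"
      using K[of 0] eventually_nonzero[OF h(1,2), of 0] eventually_at_uminus[OF eventually_nonzero[OF h(1,2), of "- 0"]]
      by eventually_elim (simp add: V_def K0)
    then show False by simp
  qed
  then show ?thesis using K unfolding V_def by blast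
qed

theorem theorem1p4:
  fixes \<tau> a :: complex and r s :: real
    and G :: "complex \<Rightarrow> real"
    and u v :: "real \<Rightarrow> complex \<Rightarrow> real"
    and f h :: "complex \<Rightarrow> complex"
  assumes "Im \<tau> > 0"
    and "green_function \<tau> G"
    and "nontrivial_critical_point \<tau> G a" "nontrivial_critical_point \<tau> G (- a)"
    and "a = of_real r + of_real s * \<tau>"
    and "0 \<le> r" "r \<le> 1/2" "0 \<le> s" "s \<le> 1" "\<not> (2 * r \<in> \<int> \<and> 2 * s \<in> \<int>)"
    and "even_family \<tau> [(0, 8 * pi), (a, 4 * pi), (- a, 4 * pi)] f u"
    and "blows_up_at \<tau> G [(0, 8 * pi), (a, 4 * pi), (- a, 4 * pi)] u a at_top"
    and "blows_up_at \<tau> G [(0, 8 * pi), (a, 4 * pi), (- a, 4 * pi)] u (- a) at_bot"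
    and "even_family \<tau> [(0, 8 * pi)] h v"
    and "blows_up_at \<tau> G [(0, 8 * pi)] v a at_top"
    and "blows_up_at \<tau> G [(0, 8 * pi)] v (- a) at_bot"
  shows "\<exists>c d :: complex. cmod c = 1 \<and> cmod d = 1 \<and> (\<forall>z. c * f z = (d * h z)\<^sup>2)"
proof -
  note tau = assms(1) and G = assms(2)
  let ?pu = "[(0, 8 * pi), (a, 4 * pi), (- a, 4 * pi)] :: (complex \<times> real) list"
  let ?pv = "[(0, 8 * pi)] :: (complex \<times> real) list"
  have a2: "2 * a \<notin> lattice \<tau>" using assms(3) by (simp add: nontrivial_critical_point_def)
  have aL: "a \<notin> lattice \<tau>" using a2 lattice_add[of a \<tau> a] unfolding mult_2 by blast
  have aa1: "a + a \<notin> lattice \<tau>" using a2 unfolding mult_2 .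
  have "- a - a = - (a + a)" by simp
  then have "- a - a \<notin> lattice \<tau>" using aa1 lattice_uminus_iff by metis
  note aa = aa1 this
  have mv: "mass_at \<tau> ?pv p = (if p \<in> lattice \<tau> then 8 * pi else 0)" for p by (simp add: mass_at_def)
  have mu0: "mass_at \<tau> ?pu 0 = 8 * pi" using aL by (simp add: mass_at_def)
  have mua: "mass_at \<tau> ?pu a = 4 * pi" using aL aa by (simp add: mass_at_def)
  have mu: "mass_at \<tau> ?pu p = 0" if "p \<notin> lattice \<tau>" "p - a \<notin> lattice \<tau>" "p - (- a) \<notin> lattice \<tau>" for p
    using that by (simp add: mass_at_def)
  have fu: "solution_family \<tau> ?pu f u" and hv: "solution_family \<tau> ?pv h v"
    using assms(11,14) by (auto simp: even_family_def)
  have tf: "type_II \<tau> f" and th: "type_II \<tau> h" using fu hv by (auto simp: solution_family_def)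
  have nf: "f nicely_meromorphic_on UNIV" and nh: "h nicely_meromorphic_on UNIV"
    using tf th by (auto simp: type_II_def)
  have fm: "f meromorphic_on UNIV" and hm: "h meromorphic_on UNIV"
    using nf nh by (auto simp: nicely_meromorphic_on_def)
  have ncf: "\<not> (\<exists>c. \<forall>z. f z = c)" by (rule family_not_constant[OF tau fu, of 0]) (simp add: mu0)
  have nch: "\<not> (\<exists>c. \<forall>z. h z = c)" by (rule family_not_constant[OF tau hv, of 0]) (simp add: mv)
  note pf = family_norm_periodic[OF tau fu ncf] and ph = family_norm_periodic[OF tau hv nch]
  obtain kf gf gf1 where bfa: "branch_value f a kf 0 gf gf1"
    using blow_up_top_imp_zero[OF tau G fu ncf assms(12)] by blast
  obtain kf' gf' gf1' where bfm: "branch_pole f (- a) kf' gf' gf1'"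
    using blow_up_bot_imp_pole[OF tau G fu ncf assms(13)] by blast
  obtain kh gh gh1 where bha: "branch_value h a kh 0 gh gh1"
    using blow_up_top_imp_zero[OF tau G hv nch assms(15)] by blast
  obtain kh' gh' gh1' where bhm: "branch_pole h (- a) kh' gh' gh1'"
    using blow_up_bot_imp_pole[OF tau G hv nch assms(16)] by blast
  \<comment> \<open>The masses \<open>4\<pi>\<close> and \<open>0\<close> at \<open>a\<close> make the zero of \<open>f\<close> double and that of \<open>h\<close> simple.\<close>
  have "kf - 1 = 1" using family_branch_mass(1)[OF tau fu bfa] mua by simp
  then have kf: "kf = 2" by simp
  have "kh - 1 = 0" using family_branch_mass(1)[OF tau hv bha] mv[of a] aL by simp
  then have kh: "kh = 1" using bha by (simp add: branch_value_def)
  let ?Kf = "newton_quotient f" and ?Kh = "newton_quotient h"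
  have Km: "?Kf meromorphic_on UNIV" "?Kh meromorphic_on UNIV"
    using fm hm by (auto intro: newton_quotient_meromorphic)
  note Kp = newton_quotient_periodic[OF tf] newton_quotient_periodic[OF th]
  have fa: "(\<lambda>z. ?Kf z / (z - a)) \<midarrow>a\<rightarrow> 1 / 2" and ha: "(\<lambda>z. ?Kh z / (z - a)) \<midarrow>a\<rightarrow> 1"
    using newton_quotient_value(2)[OF bfa] newton_quotient_value(2)[OF bha] kf kh by auto
  note zero = tendsto_0_from_quotient[OF fa] tendsto_0_from_quotient[OF ha]
    tendsto_0_from_quotient[OF newton_quotient_pole[OF bfm]] tendsto_0_from_quotient[OF newton_quotient_pole[OF bhm]]
  have limf: "\<exists>l. ?Kf \<midarrow>z\<rightarrow> l" if "z \<notin> lattice \<tau>" for z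
  proof -
    consider "z - a \<in> lattice \<tau>" | "z - (- a) \<in> lattice \<tau>" | "z - a \<notin> lattice \<tau>" "z - (- a) \<notin> lattice \<tau>" by blast
    then show ?thesis
    proof cases
      case 1
      then show ?thesis using doubly_periodic_tendsto_lattice[OF Kp(1) _ zero(1)] by blast
    next
      case 2
      then show ?thesis using doubly_periodic_tendsto_lattice[OF Kp(1) _ zero(3)] by blast
    next
      case 3
      then show ?thesis using newton_quotient_limit_regular[OF tau fu ncf mu[OF that]] by blast
    qed
  qed
  have limh: "\<exists>l. ?Kh \<midarrow>z\<rightarrow> l" if "z \<notin> lattice \<tau>" for z
    using newton_quotient_limit_regular[OF tau hv nch] mv[of z] that by simp
  obtain \<alpha>f where af: "(\<lambda>z. z\<^sup>2 * ?Kf z) \<midarrow>0\<rightarrow> \<alpha>f"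
    using newton_quotient_double_pole[OF tau fu ncf mu0] by blast
  obtain \<alpha>h where ah: "(\<lambda>z. z\<^sup>2 * ?Kh z) \<midarrow>0\<rightarrow> \<alpha>h"
    using newton_quotient_double_pole[OF tau hv nch] mv[of 0] by auto
  \<comment> \<open>Otherwise \<open>k\<^sub>h\<close> would have at most a simple pole, hence vanish identically, contradicting its slope \<open>1\<close> at \<open>a\<close>.\<close>
  have "\<alpha>h \<noteq> 0"
  proof
    assume "\<alpha>h = 0"
    then have "\<exists>C. \<forall>z. ?Kh \<midarrow>z\<rightarrow> C"
      using elliptic_at_most_simple_pole_constant[OF tau Km(2) Kp(2) limh] ah by blast
    then obtain C where C: "\<And>z. ?Kh \<midarrow>z\<rightarrow> C" by blast
    have "C = 0" using LIM_unique[OF C zero(2)] .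
    then have "remove_sings ?Kh z = 0" for z using remove_sings_eqI[OF C] by simp
    then have "\<forall>\<^sub>\<approx>z\<in>UNIV. ?Kh z = 0"
      using eventually_remove_sings_eq[OF Km(2)] by (auto elim!: eventually_mono)
    then have "\<forall>\<^sub>F z in at a. ?Kh z / (z - a) = 0" by (auto simp: cosparse_UNIV_iff elim!: allE eventually_mono)
    then have "(\<lambda>z. ?Kh z / (z - a)) \<midarrow>a\<rightarrow> 0" by (rule tendsto_eventually)
    from LIM_unique[OF ha this] show False by simp
  qed
  have proportional: "\<forall>\<^sub>F z in at p. \<alpha>h * ?Kf z = \<alpha>f * ?Kh z" for p
    using elliptic_double_pole_proportional[OF tau Km Kp limf limh af ah zero(1,2)] by (simp add: cosparse_UNIV_iff)
  \<comment> \<open>Comparing slopes at \<open>a\<close> determines the factor of proportionality.\<close>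
  have "(\<lambda>z. \<alpha>h * (?Kf z / (z - a))) \<midarrow>a\<rightarrow> \<alpha>h * (1 / 2)" by (intro tendsto_intros fa)
  moreover have "(\<lambda>z. \<alpha>f * (?Kh z / (z - a))) \<midarrow>a\<rightarrow> \<alpha>f * 1" by (intro tendsto_intros ha)
  then have "(\<lambda>z. \<alpha>h * (?Kf z / (z - a))) \<midarrow>a\<rightarrow> \<alpha>f * 1"
    by (rule Lim_transform_eventually) (use proportional[of a] in \<open>auto elim!: eventually_mono\<close>)
  ultimately have "\<alpha>h * (1 / 2) = \<alpha>f * 1" by (rule LIM_unique)
  then have half: "\<forall>\<^sub>F z in at p. ?Kh z = 2 * ?Kf z" for p
    using proportional[of p] \<open>\<alpha>h \<noteq> 0\<close> by (auto elim!: eventually_mono)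
  obtain C where C: "C \<noteq> 0" "\<And>z. f z = C * (h z)\<^sup>2"
    using newton_quotient_half_imp_square[OF tau nf ncf pf nh nch ph half] by blast
  \<comment> \<open>The reflected quotient satisfies the same hypotheses; it vanishes at \<open>a\<close> because \<open>h\<close> has a pole at \<open>-a\<close>.\<close>
  have even_h: "\<forall>\<^sub>F z in at p. ?Kh (- z) = ?Kh z" for p
  proof -
    have lu: "(\<lambda>z. F (- z)) \<midarrow>z\<rightarrow> l" if "F \<midarrow>- z\<rightarrow> l" for F :: "complex \<Rightarrow> complex" and z l
      using that by (simp add: filtermap_at_minus[symmetric] filterlim_filtermap)
    have km: "(\<lambda>z. ?Kh (- z)) meromorphic_on UNIV"
      by (rule meromorphic_on_compose[OF Km(2)]) (auto intro!: analytic_intros)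
    have "?Kh (- z - 1) = ?Kh (- z)" "?Kh (- z - \<tau>) = ?Kh (- z)" for z
      using Kp(2)[unfolded doubly_periodic_def] by (metis diff_add_cancel)+
    then have kp: "doubly_periodic \<tau> (\<lambda>z. ?Kh (- z))" by (simp add: doubly_periodic_def)
    have kl: "\<exists>l. (\<lambda>z. ?Kh (- z)) \<midarrow>z\<rightarrow> l" if "z \<notin> lattice \<tau>" for z
      using limh[of "- z"] that lu[of ?Kh] lattice_uminus_iff by blast
    have "(\<lambda>z. (- z)\<^sup>2 * ?Kh (- z)) \<midarrow>0\<rightarrow> \<alpha>h"
      by (rule lu[of "\<lambda>z. z\<^sup>2 * ?Kh z"]) (use ah in simp)
    then have kd: "(\<lambda>z. z\<^sup>2 * ?Kh (- z)) \<midarrow>0\<rightarrow> \<alpha>h" by simp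
    have kz: "(\<lambda>z. ?Kh (- z)) \<midarrow>a\<rightarrow> 0" by (rule lu[OF zero(4)])
    have "\<forall>\<^sub>\<approx>z\<in>UNIV. \<alpha>h * ?Kh (- z) = \<alpha>h * ?Kh z"
      by (rule elliptic_double_pole_proportional[OF tau km Km(2) kp Kp(2) kl limh kd ah kz zero(2)])
    then show ?thesis using \<open>\<alpha>h \<noteq> 0\<close> by (simp add: cosparse_UNIV_iff)
  qed
  obtain K where K: "K \<noteq> 0" "\<And>p. \<forall>\<^sub>F z in at p. h z * h (- z) = K"
    using even_newton_quotient_imp_product_constant[OF tau nh nch ph even_h] by blast
  have K1: "cmod K = 1"
    by (rule even_family_constant_norm[OF tau assms(14) nch bha K(2) K(1) even_h])
  have even_f: "\<forall>\<^sub>F z in at a. ?Kf (- z) = ?Kf z"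
    using even_h[of a] half[of a] eventually_at_uminus[OF half[of "- a"]] by eventually_elim simp
  have prod_f: "\<forall>\<^sub>F z in at a. f z * f (- z) = (C * K)\<^sup>2"
    using K(2)[of a]
  proof eventually_elim
    case (elim z)
    have "f z * f (- z) = C\<^sup>2 * (h z * h (- z))\<^sup>2" by (simp add: C(2) power2_eq_square mult_ac)
    then show ?case using elim by (simp add: power_mult_distrib)
  qed
  have "cmod ((C * K)\<^sup>2) = 1"
    by (rule even_family_constant_norm[OF tau assms(11) ncf bfa prod_f _ even_f]) (use C(1) K(1) in simp)
  then have "(cmod C)\<^sup>2 = 1" using K1 by (simp add: norm_power norm_mult)
  then have "cmod C = 1" by (simp add: power2_eq_1_iff) (use norm_ge_zero[of C] in linarith)
  then show ?thesis
    using C by (intro exI[of _ "1 / C"] exI[of _ 1]) (simp add: norm_divide)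
qed

end
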